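(* Let $M$ be a $(2n+1)$-dimensional smooth compact manifold admitting two cosymplectic structures $(\omega,\eta_0)$ and $(\omega,\eta_1)$ with $\eta_0$ cohomologous to $\eta_1$. For $t\in[0,1]$ put $\eta_t=(1-t)\eta_0+t\eta_1$, and assume that for each $t\in[0,1]$ the map $\widetilde I_{\eta_t,\omega}$ is an isomorphism of $C^\infty(M)$-modules. Then there exists a smooth isotopy $\{\phi_t\}$ of $M$ such that $\phi_t^\ast(\omega)=\omega$ and $\phi_t^\ast(\eta_t)=\eta_0$ for all $t\in[0,1]$.
   Context: For a $1$-form $\eta$ and a $2$-form $\omega$ on a manifold $M$, let $\widetilde I_{\eta,\omega}:\chi(M)\to\Omega^1(M)$, $\widetilde I_{\eta,\omega}(X)=\imath_X\omega+\eta(X)\eta$, from smooth vector fields to $1$-forms. A cosymplectic structure on $M$ is a pair $(\omega,\eta)$ of a closed $2$-form $\omega$ and a closed $1$-form $\eta$ such that at each $x\in M$, $\eta_x\neq 0$ and the linear map $T_xM\to T_x^*M$, $Y\mapsto \imath_Y\omega_x+\eta_x(Y)\eta_x$, is bijective. "Cohomologous" means having the same de Rham cohomology class. An isotopy is a smooth family $\{\phi_t\}_{t\in[0,1]}$ of diffeomorphisms of $M$ with $\phi_0=\mathrm{id}_M$. *)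

theory Defs
  imports "HOL-Analysis.Analysis"
begin

section \<open>Smooth functions between Euclidean spaces\<close>

primrec Ck_on :: "nat \<Rightarrow> 'a::euclidean_space set \<Rightarrow> ('a \<Rightarrow> 'b::real_normed_vector) \<Rightarrow> bool" where
  "Ck_on 0 S f \<longleftrightarrow> continuous_on S f"
| "Ck_on (Suc k) S f \<longleftrightarrow>
     (\<forall>x\<in>S. f differentiable (at x)) \<and>
     (\<forall>v. Ck_on k S (\<lambda>x. frechet_derivative f (at x) v))"

text \<open>Meant for open \<open>S\<close>; all derivatives are two-sided.\<close>
definition smooth_on :: "'a::euclidean_space set \<Rightarrow> ('a \<Rightarrow> 'b::real_normed_vector) \<Rightarrow> bool" where
  "smooth_on S f \<longleftrightarrow> (\<forall>k. Ck_on k S f)"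

text \<open>Smoothness on an arbitrary subset: locally the restriction of a smooth function on an open
  set. Used for functions on \<open>[0,1] \<times> V\<close>, \<open>V\<close> open.\<close>
definition smooth_within :: "'a::euclidean_space set \<Rightarrow> ('a \<Rightarrow> 'b::real_normed_vector) \<Rightarrow> bool" where
  "smooth_within S f \<longleftrightarrow>
     (\<forall>x\<in>S. \<exists>U g. open U \<and> x \<in> U \<and> smooth_on U g \<and> (\<forall>y\<in>S \<inter> U. f y = g y))"

section \<open>Manifolds\<close>

text \<open>The underlying set of the manifold is the whole type \<open>'m\<close>; being Hausdorff and second countable
  is part of its sort. A chart is a pair of a domain and a coordinate map into the model
  space \<open>'e\<close>. The atlas need not be maximal: every notion below depends only on the
  smooth structure that the atlas generates.\<close>

type_synonym ('m, 'e) chart = "'m set \<times> ('m \<Rightarrow> 'e)"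

abbreviation chart_dom :: "('m, 'e) chart \<Rightarrow> 'm set" where
  "chart_dom c \<equiv> fst c"

abbreviation chart_map :: "('m, 'e) chart \<Rightarrow> 'm \<Rightarrow> 'e" where
  "chart_map c \<equiv> snd c"

definition chart_img :: "('m, 'e) chart \<Rightarrow> 'e set" where
  "chart_img c = chart_map c ` chart_dom c"

definition chart_inv :: "('m, 'e) chart \<Rightarrow> 'e \<Rightarrow> 'm" where
  "chart_inv c = inv_into (chart_dom c) (chart_map c)"

definition smooth_manifold ::
  "('m::{t2_space,second_countable_topology}, 'e::euclidean_space) chart set \<Rightarrow> bool" where
  "smooth_manifold A \<longleftrightarrow>
     (\<Union>c\<in>A. chart_dom c) = UNIV \<and>
     (\<forall>c\<in>A. open (chart_dom c) \<and> open (chart_img c) \<and>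
        homeomorphism (chart_dom c) (chart_img c) (chart_map c) (chart_inv c)) \<and>
     (\<forall>c\<in>A. \<forall>d\<in>A. smooth_on (chart_map c ` (chart_dom c \<inter> chart_dom d))
        (chart_map d \<circ> chart_inv c))"

definition smooth_functions ::
  "('m::topological_space, 'e::euclidean_space) chart set \<Rightarrow> ('m \<Rightarrow> real) set" where
  "smooth_functions A = {f. \<forall>c\<in>A. smooth_on (chart_img c) (f \<circ> chart_inv c)}"

definition smooth_map ::
  "('m::topological_space, 'e::euclidean_space) chart set \<Rightarrow> ('m \<Rightarrow> 'm) \<Rightarrow> bool" where
  "smooth_map A h \<longleftrightarrow> continuous_on UNIV h \<and>
     (\<forall>c\<in>A. \<forall>d\<in>A. smooth_on (chart_map c ` (chart_dom c \<inter> h -` chart_dom d))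
        (chart_map d \<circ> h \<circ> chart_inv c))"

definition diffeomorphism ::
  "('m::topological_space, 'e::euclidean_space) chart set \<Rightarrow> ('m \<Rightarrow> 'm) \<Rightarrow> bool" where
  "diffeomorphism A h \<longleftrightarrow> bij h \<and> smooth_map A h \<and> smooth_map A (inv h)"

text \<open>Smooth isotopy: \<open>(t, x) \<mapsto> \<phi> t x\<close> is a smooth map \<open>[0,1] \<times> M \<rightarrow> M\<close>, where \<open>[0,1] \<times> M\<close> carries
  the product structure of a manifold with boundary. Values \<open>\<phi> t\<close> with \<open>t \<notin> [0,1]\<close> are irrelevant.\<close>
definition isotopy ::
  "('m::topological_space, 'e::euclidean_space) chart set \<Rightarrow> (real \<Rightarrow> 'm \<Rightarrow> 'm) \<Rightarrow> bool" where
  "isotopy A \<phi> \<longleftrightarrow>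
     continuous_on ({0..1} \<times> UNIV) (\<lambda>(t, x). \<phi> t x) \<and>
     (\<forall>c\<in>A. \<forall>d\<in>A. smooth_within
        {(t, u). t \<in> {0..1} \<and> u \<in> chart_img c \<and> \<phi> t (chart_inv c u) \<in> chart_dom d}
        (\<lambda>(t, u). chart_map d (\<phi> t (chart_inv c u)))) \<and>
     (\<forall>t\<in>{0..1}. diffeomorphism A (\<phi> t)) \<and>
     \<phi> 0 = id"

section \<open>Tangent vectors and vector fields\<close>

text \<open>Tangent vectors are derivations at \<open>x\<close> of the algebra of smooth functions, extended by \<open>0\<close> to
  nonsmooth functions so that equality of derivations is equality of HOL functions.\<close>

type_synonym 'm tvec = "('m \<Rightarrow> real) \<Rightarrow> real"

definition tangent_space ::
  "('m::topological_space, 'e::euclidean_space) chart set \<Rightarrow> 'm \<Rightarrow> 'm tvec set" where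
  "tangent_space A x = {v.
     (\<forall>f\<in>smooth_functions A. \<forall>g\<in>smooth_functions A. v (\<lambda>y. f y + g y) = v f + v g) \<and>
     (\<forall>a. \<forall>f\<in>smooth_functions A. v (\<lambda>y. a * f y) = a * v f) \<and>
     (\<forall>f\<in>smooth_functions A. \<forall>g\<in>smooth_functions A.
        v (\<lambda>y. f y * g y) = f x * v g + g x * v f) \<and>
     (\<forall>f. f \<notin> smooth_functions A \<longrightarrow> v f = 0)}"

definition tplus :: "'m tvec \<Rightarrow> 'm tvec \<Rightarrow> 'm tvec" where
  "tplus v w = (\<lambda>f. v f + w f)"

definition tscale :: "real \<Rightarrow> 'm tvec \<Rightarrow> 'm tvec" where
  "tscale a v = (\<lambda>f. a * v f)"

text \<open>The directional derivative along \<open>w\<close> in the coordinates \<open>c\<close>; for basis vectors \<open>w\<close> these are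
  the coordinate vectors of the chart at \<open>x\<close>.\<close>
definition coord_vector ::
  "('m::topological_space, 'e::euclidean_space) chart set \<Rightarrow> ('m, 'e) chart \<Rightarrow> 'm \<Rightarrow> 'e \<Rightarrow> 'm tvec" where
  "coord_vector A c x w = (\<lambda>f. if f \<in> smooth_functions A
     then frechet_derivative (f \<circ> chart_inv c) (at (chart_map c x)) w else 0)"

definition push_forward ::
  "('m::topological_space, 'e::euclidean_space) chart set \<Rightarrow> ('m \<Rightarrow> 'm) \<Rightarrow> 'm tvec \<Rightarrow> 'm tvec" where
  "push_forward A h v = (\<lambda>f. if f \<in> smooth_functions A then v (f \<circ> h) else 0)"

definition vector_fields ::
  "('m::topological_space, 'e::euclidean_space) chart set \<Rightarrow> ('m \<Rightarrow> 'm tvec) set" where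
  "vector_fields A = {X.
     (\<forall>x. X x \<in> tangent_space A x) \<and>
     (\<forall>c\<in>A. \<exists>\<xi>. smooth_on (chart_img c) \<xi> \<and>
        (\<forall>x\<in>chart_dom c. X x = coord_vector A c x (\<xi> (chart_map c x))))}"

section \<open>Differential forms of degree one and two\<close>

text \<open>Forms are extended by \<open>0\<close> to arguments that are not tangent vectors, so that equality of
  forms is equality of HOL functions.\<close>

type_synonym 'm form1 = "'m \<Rightarrow> 'm tvec \<Rightarrow> real"
type_synonym 'm form2 = "'m \<Rightarrow> 'm tvec \<Rightarrow> 'm tvec \<Rightarrow> real"

definition cotangent_space ::
  "('m::topological_space, 'e::euclidean_space) chart set \<Rightarrow> 'm \<Rightarrow> ('m tvec \<Rightarrow> real) set" where
  "cotangent_space A x = {\<alpha>.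
     (\<forall>v\<in>tangent_space A x. \<forall>w\<in>tangent_space A x. \<alpha> (tplus v w) = \<alpha> v + \<alpha> w) \<and>
     (\<forall>a. \<forall>v\<in>tangent_space A x. \<alpha> (tscale a v) = a * \<alpha> v) \<and>
     (\<forall>v. v \<notin> tangent_space A x \<longrightarrow> \<alpha> v = 0)}"

definition form1_local ::
  "('m::topological_space, 'e::euclidean_space) chart set \<Rightarrow> ('m, 'e) chart \<Rightarrow> 'm form1 \<Rightarrow>
     'e \<Rightarrow> 'e \<Rightarrow> real" where
  "form1_local A c \<eta> u v = \<eta> (chart_inv c u) (coord_vector A c (chart_inv c u) v)"

definition form2_local ::
  "('m::topological_space, 'e::euclidean_space) chart set \<Rightarrow> ('m, 'e) chart \<Rightarrow> 'm form2 \<Rightarrow>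
     'e \<Rightarrow> 'e \<Rightarrow> 'e \<Rightarrow> real" where
  "form2_local A c \<omega> u v w =
     \<omega> (chart_inv c u) (coord_vector A c (chart_inv c u) v) (coord_vector A c (chart_inv c u) w)"

definition one_forms ::
  "('m::topological_space, 'e::euclidean_space) chart set \<Rightarrow> 'm form1 set" where
  "one_forms A = {\<eta>.
     (\<forall>x. \<eta> x \<in> cotangent_space A x) \<and>
     (\<forall>c\<in>A. \<forall>v. smooth_on (chart_img c) (\<lambda>u. form1_local A c \<eta> u v))}"

definition two_forms ::
  "('m::topological_space, 'e::euclidean_space) chart set \<Rightarrow> 'm form2 set" where
  "two_forms A = {\<omega>.
     (\<forall>x. \<forall>v\<in>tangent_space A x. \<omega> x v \<in> cotangent_space A x) \<and>
     (\<forall>x v. v \<notin> tangent_space A x \<longrightarrow> \<omega> x v = (\<lambda>w. 0)) \<and>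
     (\<forall>x. \<forall>v\<in>tangent_space A x. \<forall>w\<in>tangent_space A x. \<omega> x v w = - \<omega> x w v) \<and>
     (\<forall>c\<in>A. \<forall>v w. smooth_on (chart_img c) (\<lambda>u. form2_local A c \<omega> u v w))}"

text \<open>The exterior derivative in the coordinates \<open>c\<close>, evaluated on constant coordinate vectors:
  \<open>d\<eta>(v,w) = v(\<eta>(w)) - w(\<eta>(v))\<close> and the cyclic sum for \<open>d\<omega>\<close>; the Lie bracket
  terms of the invariant formula vanish.\<close>

definition ext_deriv1_local ::
  "('m::topological_space, 'e::euclidean_space) chart set \<Rightarrow> ('m, 'e) chart \<Rightarrow> 'm form1 \<Rightarrow>
     'e \<Rightarrow> 'e \<Rightarrow> 'e \<Rightarrow> real" where
  "ext_deriv1_local A c \<eta> u v w =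
     frechet_derivative (\<lambda>z. form1_local A c \<eta> z w) (at u) v
     - frechet_derivative (\<lambda>z. form1_local A c \<eta> z v) (at u) w"

definition ext_deriv2_local ::
  "('m::topological_space, 'e::euclidean_space) chart set \<Rightarrow> ('m, 'e) chart \<Rightarrow> 'm form2 \<Rightarrow>
     'e \<Rightarrow> 'e \<Rightarrow> 'e \<Rightarrow> 'e \<Rightarrow> real" where
  "ext_deriv2_local A c \<omega> u v w z =
     frechet_derivative (\<lambda>y. form2_local A c \<omega> y w z) (at u) v
     + frechet_derivative (\<lambda>y. form2_local A c \<omega> y z v) (at u) w
     + frechet_derivative (\<lambda>y. form2_local A c \<omega> y v w) (at u) z"

definition closed1 ::
  "('m::topological_space, 'e::euclidean_space) chart set \<Rightarrow> 'm form1 \<Rightarrow> bool" where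
  "closed1 A \<eta> \<longleftrightarrow> (\<forall>c\<in>A. \<forall>u\<in>chart_img c. \<forall>v w. ext_deriv1_local A c \<eta> u v w = 0)"

definition closed2 ::
  "('m::topological_space, 'e::euclidean_space) chart set \<Rightarrow> 'm form2 \<Rightarrow> bool" where
  "closed2 A \<omega> \<longleftrightarrow> (\<forall>c\<in>A. \<forall>u\<in>chart_img c. \<forall>v w z. ext_deriv2_local A c \<omega> u v w z = 0)"

definition differential ::
  "('m::topological_space, 'e::euclidean_space) chart set \<Rightarrow> ('m \<Rightarrow> real) \<Rightarrow> 'm form1" where
  "differential A f = (\<lambda>x v. if v \<in> tangent_space A x then v f else 0)"

text \<open>Equality of de Rham classes, for closed 1-forms.\<close>
definition cohomologous1 ::
  "('m::topological_space, 'e::euclidean_space) chart set \<Rightarrow> 'm form1 \<Rightarrow> 'm form1 \<Rightarrow> bool" where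
  "cohomologous1 A \<eta> \<eta>' \<longleftrightarrow>
     (\<exists>f\<in>smooth_functions A. (\<lambda>x v. \<eta>' x v - \<eta> x v) = differential A f)"

definition pullback1 ::
  "('m::topological_space, 'e::euclidean_space) chart set \<Rightarrow> ('m \<Rightarrow> 'm) \<Rightarrow> 'm form1 \<Rightarrow> 'm form1" where
  "pullback1 A h \<eta> = (\<lambda>x v. if v \<in> tangent_space A x then \<eta> (h x) (push_forward A h v) else 0)"

definition pullback2 ::
  "('m::topological_space, 'e::euclidean_space) chart set \<Rightarrow> ('m \<Rightarrow> 'm) \<Rightarrow> 'm form2 \<Rightarrow> 'm form2" where
  "pullback2 A h \<omega> = (\<lambda>x v w. if v \<in> tangent_space A x \<and> w \<in> tangent_space A x
     then \<omega> (h x) (push_forward A h v) (push_forward A h w) else 0)"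

section \<open>Cosymplectic structures\<close>

definition flat_at :: "'m form1 \<Rightarrow> 'm form2 \<Rightarrow> 'm \<Rightarrow> 'm tvec \<Rightarrow> 'm tvec \<Rightarrow> real" where
  "flat_at \<eta> \<omega> x Y = (\<lambda>Z. \<omega> x Y Z + \<eta> x Y * \<eta> x Z)"

definition I_tilde :: "'m form1 \<Rightarrow> 'm form2 \<Rightarrow> ('m \<Rightarrow> 'm tvec) \<Rightarrow> 'm form1" where
  "I_tilde \<eta> \<omega> X = (\<lambda>x. flat_at \<eta> \<omega> x (X x))"

definition cosymplectic ::
  "('m::topological_space, 'e::euclidean_space) chart set \<Rightarrow> 'm form2 \<Rightarrow> 'm form1 \<Rightarrow> bool" where
  "cosymplectic A \<omega> \<eta> \<longleftrightarrow>
     \<omega> \<in> two_forms A \<and> closed2 A \<omega> \<and> \<eta> \<in> one_forms A \<and> closed1 A \<eta> \<and>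
     (\<forall>x. \<exists>v\<in>tangent_space A x. \<eta> x v \<noteq> 0) \<and>
     (\<forall>x. bij_betw (flat_at \<eta> \<omega> x) (tangent_space A x) (cotangent_space A x))"

definition smooth_module_iso ::
  "('m::topological_space, 'e::euclidean_space) chart set \<Rightarrow>
     (('m \<Rightarrow> 'm tvec) \<Rightarrow> 'm form1) \<Rightarrow> bool" where
  "smooth_module_iso A F \<longleftrightarrow>
     bij_betw F (vector_fields A) (one_forms A) \<and>
     (\<forall>X\<in>vector_fields A. \<forall>Y\<in>vector_fields A.
        F (\<lambda>x. tplus (X x) (Y x)) = (\<lambda>x v. F X x v + F Y x v)) \<and>
     (\<forall>f\<in>smooth_functions A. \<forall>X\<in>vector_fields A.
        F (\<lambda>x. tscale (f x) (X x)) = (\<lambda>x v. f x * F X x v))"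

definition segment1 :: "'m form1 \<Rightarrow> 'm form1 \<Rightarrow> real \<Rightarrow> 'm form1" where
  "segment1 \<eta>0 \<eta>1 t = (\<lambda>x v. (1 - t) * \<eta>0 x v + t * \<eta>1 x v)"

end

theory Submission
  imports Defs
begin

text \<open>Write \<open>\<eta>\<^sub>1 - \<eta>\<^sub>0 = dg\<close>. Because the dimension is odd, the vector field \<open>X\<close> that represents \<open>\<eta>\<^sub>0\<close> under
  \<open>Y \<mapsto> \<omega>(Y, _) + \<eta>\<^sub>0(Y) \<eta>\<^sub>0\<close> is the Reeb field: \<open>\<omega>(X, _) = 0\<close> and \<open>\<eta>\<^sub>0(X) = 1\<close>. The time-dependent field of
  Moser's method is then \<open>- g / (1 + t X(g)) X\<close>, always a multiple of \<open>X\<close>, and its flow can be written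
  through the flow \<open>F\<close> of \<open>X\<close> alone: \<open>\<phi> t x = F s x\<close>, where \<open>s = \<tau> t x\<close> solves \<open>s + t g (F s x) = 0\<close>.
  The derivative \<open>1 + t X(g) = \<eta>\<^sub>t(X)\<close> of the left hand side is positive because the module maps are surjective,
  so \<open>\<tau>\<close> is a smooth implicit function; the inverse of \<open>\<phi> t\<close> is \<open>y \<mapsto> F (t g y) y\<close>. Since \<open>F\<close> preserves
  \<open>\<omega>\<close> and \<open>\<eta>\<^sub>0\<close>, the pullback of \<open>\<omega>\<close> is \<open>\<omega>\<close> and that of \<open>\<eta>\<^sub>t\<close> is \<open>\<eta>\<^sub>0 + d\<tau> + t d(g \<circ> \<phi> t) = \<eta>\<^sub>0\<close>.

  Smoothness of \<open>F\<close> in the initial value is obtained from parametrised linear equations, whose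
  difference quotients solve equations of the same kind with one derivative less in the coefficients.\<close>

section \<open>Calculus of smooth functions\<close>

text \<open>The equation for s is Moser's equation integrated. If F s x moves with velocity - g / (1
  + t X(g)) X, then s' (1 + t X(g)) + g = 0, and this left hand side is the t-derivative of s + t
  g(F s x), which is 0 at t = 0. Solving a scalar equation at each point thus replaces a
  time-dependent flow by the autonomous flow of X, whose group law also yields the inverse maps. The
  analytic obstacle is smooth dependence on initial values. The increment F(t, p + w) - F(t, p) is
  written as the sum of w_j Q_j(t, p, w), where Q_j solves a linear system that still makes sense at
  w = 0; continuity of Q_j then takes the place of a limit of difference quotients. The coefficients
  are integrals of derivatives over segments, and the same factorisation of increments serves the
  implicit function. Smoothness on [0,1] x M means being locally a restriction of a smooth function
  on an open set, so the construction runs over an open set of times around [0,1], which compactness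
  of M provides.\<close>

lemma Ck_on_imp_continuous_on: "Ck_on k S f \<Longrightarrow> continuous_on S f"
  by (cases k) (auto intro!: continuous_at_imp_continuous_on differentiable_imp_continuous_within)

lemma Ck_on_SucD: "Ck_on (Suc k) S f \<Longrightarrow> Ck_on k S f"
proof (induction k arbitrary: f)
  case 0
  then show ?case using Ck_on_imp_continuous_on[of "Suc 0" S f] by simp
next
  case (Suc k)
  have "Ck_on k S (\<lambda>x. frechet_derivative f (at x) v)" for v
    using Suc.prems by (intro Suc.IH) (simp only: Ck_on.simps(2)[of "Suc k"])
  with Suc.prems show ?case by simp
qed

lemma Ck_on_le: "Ck_on k S f \<Longrightarrow> j \<le> k \<Longrightarrow> Ck_on j S f"
  by (induction k) (auto simp: le_Suc_eq dest: Ck_on_SucD simp del: Ck_on.simps)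

lemma Ck_on_subset: "Ck_on k S f \<Longrightarrow> T \<subseteq> S \<Longrightarrow> Ck_on k T f"
  by (induction k arbitrary: f) (auto intro: continuous_on_subset)

lemma Ck_on_cong:
  assumes "open S" "\<And>x. x \<in> S \<Longrightarrow> f x = g x" "Ck_on k S f"
  shows "Ck_on k S g"
  using assms(2,3)
proof (induction k arbitrary: f g)
  case 0
  then show ?case by (auto cong: continuous_on_cong)
next
  case (Suc k)
  have d: "g differentiable (at x)" if "x \<in> S" for x
  proof -
    have "f differentiable (at x)" using Suc.prems that by simp
    then show ?thesis unfolding differentiable_def
      using has_derivative_transform_within_open[OF _ assms(1) that] Suc.prems(1) by blast
  qed
  have "frechet_derivative f (at x) = frechet_derivative g (at x)" if "x \<in> S" for x
    by (rule frechet_derivative_transform_within_open[OF _ assms(1) that])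
      (use Suc.prems that in auto)
  with Suc.IH[of "\<lambda>x. frechet_derivative f (at x) v" "\<lambda>x. frechet_derivative g (at x) v" for v]
  show ?case using Suc.prems d by simp
qed

text \<open>\<open>Ck_on\<close> refers to \<open>frechet_derivative\<close>, a choice term. This
  rule lets a proof name the derivative itself, so that an induction on the order only has to
  recognise the explicit derivative as one order less smooth.\<close>

lemma Ck_on_SucI:
  assumes "open S" "\<And>x. x \<in> S \<Longrightarrow> (f has_derivative f' x) (at x)" "\<And>v. Ck_on k S (\<lambda>x. f' x v)"
  shows "Ck_on (Suc k) S f"
proof -
  have "Ck_on k S (\<lambda>x. frechet_derivative f (at x) v)" for v
    by (rule Ck_on_cong[OF assms(1) _ assms(3)[of v]]) (use assms(2) frechet_derivative_at in metis)
  then show ?thesis using assms(2) by (auto simp: differentiable_def)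
qed

lemma Ck_on_local:
  assumes "\<And>x. x \<in> S \<Longrightarrow> \<exists>U. open U \<and> x \<in> U \<and> Ck_on k U f"
  shows "Ck_on k S f"
  using assms
proof (induction k arbitrary: f)
  case 0
  then show ?case
    unfolding Ck_on.simps
    by (metis continuous_at_imp_continuous_on continuous_on_eq_continuous_at)
next
  case (Suc k)
  have "f differentiable (at x)" if "x \<in> S" for x
    using Suc.prems[OF that] by auto
  moreover have "Ck_on k S (\<lambda>x. frechet_derivative f (at x) v)" for v
  proof (rule Suc.IH)
    fix x assume "x \<in> S"
    from Suc.prems[OF this] show "\<exists>U. open U \<and> x \<in> U \<and> Ck_on k U (\<lambda>x. frechet_derivative f (at x) v)"
      by auto
  qed
  ultimately show ?case by simp
qed

lemma Ck_on_const: "Ck_on k S (\<lambda>x. c)"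
  by (induction k arbitrary: c) auto

lemma Ck_on_add:
  assumes "Ck_on k S f" "Ck_on k S g" "open S"
  shows "Ck_on k S (\<lambda>x. f x + g x)"
  using assms(1,2)
proof (induction k arbitrary: f g)
  case 0 then show ?case by (auto intro: continuous_intros)
next
  case (Suc k)
  show ?case
  proof (rule Ck_on_SucI[OF assms(3)])
    fix x assume "x \<in> S"
    then show "((\<lambda>x. f x + g x) has_derivative
        (\<lambda>v. frechet_derivative f (at x) v + frechet_derivative g (at x) v)) (at x)"
      using Suc.prems by (auto intro!: has_derivative_add simp: frechet_derivative_works[symmetric])
  qed (use Suc in auto)
qed

lemma Ck_on_sum:
  assumes "\<And>i. i \<in> I \<Longrightarrow> Ck_on k S (f i)" "open S"
  shows "Ck_on k S (\<lambda>x. \<Sum>i\<in>I. f i x)"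
  using assms(1)
  by (induction I rule: infinite_finite_induct) (auto intro!: Ck_on_const Ck_on_add assms(2))

lemma Ck_on_bounded_linear:
  assumes "bounded_linear h" "Ck_on k S f" "open S"
  shows "Ck_on k S (\<lambda>x. h (f x))"
  using assms(2)
proof (induction k arbitrary: f)
  case 0 then show ?case using bounded_linear.continuous_on[OF assms(1)] by auto
next
  case (Suc k)
  show ?case
  proof (rule Ck_on_SucI[OF assms(3)])
    fix x assume "x \<in> S"
    then show "((\<lambda>x. h (f x)) has_derivative (\<lambda>v. h (frechet_derivative f (at x) v))) (at x)"
      using Suc.prems by (intro bounded_linear.has_derivative[OF assms(1)])
        (auto simp: frechet_derivative_works[symmetric])
  qed (use Suc in auto)
qed

lemma Ck_on_ident: "open S \<Longrightarrow> Ck_on k S (\<lambda>x. x)"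
proof (cases k)
  case (Suc j)
  show "open S \<Longrightarrow> ?thesis" unfolding Suc
    by (rule Ck_on_SucI[where f' = "\<lambda>x v. v"]) (auto intro: Ck_on_const)
qed auto

lemma Ck_on_bilinear:
  assumes "bounded_bilinear h" "Ck_on k S f" "Ck_on k S g" "open S"
  shows "Ck_on k S (\<lambda>x. h (f x) (g x))"
  using assms(2,3)
proof (induction k arbitrary: f g)
  case 0 then show ?case using bounded_bilinear.continuous_on[OF assms(1)] by auto
next
  case (Suc k)
  show ?case
  proof (rule Ck_on_SucI[OF assms(4)])
    fix x assume "x \<in> S"
    then show "((\<lambda>x. h (f x) (g x)) has_derivative
        (\<lambda>v. h (f x) (frechet_derivative g (at x) v) + h (frechet_derivative f (at x) v) (g x))) (at x)"
      using Suc.prems by (intro bounded_bilinear.FDERIV[OF assms(1)])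
       (auto simp: frechet_derivative_works[symmetric])
  next
    fix v
    have "Ck_on k S f" "Ck_on k S g" using Suc.prems by (auto intro: Ck_on_SucD simp del: Ck_on.simps)
    then show "Ck_on k S (\<lambda>x. h (f x) (frechet_derivative g (at x) v) + h (frechet_derivative f (at x) v) (g x))"
      using Suc by (auto intro!: Ck_on_add assms(4))
  qed
qed

text \<open>\<open>Ck_on\<close> only speaks of derivatives in fixed directions. The expansion turns
  a derivative in a direction that varies with the point into a finite sum of derivatives in fixed
  basis directions with varying coefficients.\<close>

lemma linear_expand_Basis:
  fixes f :: "'a::euclidean_space \<Rightarrow> 'b::real_vector"
  assumes "linear f"
  shows "f v = (\<Sum>i\<in>Basis. (v \<bullet> i) *\<^sub>R f i)"
proof -
  interpret linear f by (rule assms)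
  show ?thesis
    using sum[of "\<lambda>i. (v \<bullet> i) *\<^sub>R i" Basis] by (simp add: euclidean_representation scaleR)
qed

lemmas frechet_derivative_expand = linear_expand_Basis[OF linear_frechet_derivative]

text \<open>The chain rule differentiates \<open>g\<close> in the moving direction Df(x) v. After
  expansion over the basis there remain products of components of Df(x) v with fixed-direction
  derivatives of \<open>g\<close> along \<open>f\<close>, and the latter are again compositions of
  the kind treated by the induction, with another \<open>g\<close>.\<close>

lemma Ck_on_compose:
  fixes f :: "'a::euclidean_space \<Rightarrow> 'b::euclidean_space" and g :: "'b \<Rightarrow> 'c::real_normed_vector"
  assumes "Ck_on k S f" "Ck_on k T g" "f ` S \<subseteq> T" "open S"
  shows "Ck_on k S (\<lambda>x. g (f x))"
  using assms(1,2)
proof (induction k arbitrary: g)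
  case 0 then show ?case using assms(3) by (auto intro: continuous_on_compose2)
next
  case (Suc k)
  show ?case
  proof (rule Ck_on_SucI[OF assms(4)])
    fix x assume x: "x \<in> S"
    have g: "g differentiable (at (f x))" using Suc.prems(2) x assms(3) by auto
    have f: "f differentiable (at x)" using Suc.prems(1) x by auto
    have "((\<lambda>x. g (f x)) has_derivative (\<lambda>v. frechet_derivative g (at (f x)) (frechet_derivative f (at x) v))) (at x)"
      using diff_chain_at[OF f[unfolded frechet_derivative_works] g[unfolded frechet_derivative_works]]
      by (simp add: o_def)
    then show "((\<lambda>x. g (f x)) has_derivative (\<lambda>v. \<Sum>i\<in>Basis.
        (frechet_derivative f (at x) v \<bullet> i) *\<^sub>R frechet_derivative g (at (f x)) i)) (at x)"
      by (simp only: frechet_derivative_expand[OF g, symmetric])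
  next
    fix v
    have "Ck_on k S f" using Suc.prems(1) by (rule Ck_on_SucD)
    then have "Ck_on k S (\<lambda>x. frechet_derivative g (at (f x)) i)" for i
      using Suc.IH[of "\<lambda>y. frechet_derivative g (at y) i"] Suc.prems(2) by auto
    moreover have "Ck_on k S (\<lambda>x. frechet_derivative f (at x) v \<bullet> i)" for i
      using Suc.prems(1) by (intro Ck_on_bounded_linear[OF bounded_linear_inner_left]) (auto simp: assms(4))
    ultimately show "Ck_on k S (\<lambda>x. \<Sum>i\<in>Basis. (frechet_derivative f (at x) v \<bullet> i) *\<^sub>R frechet_derivative g (at (f x)) i)"
      by (intro Ck_on_sum assms(4) Ck_on_bilinear[OF bounded_bilinear_scaleR])
  qed
qed

text \<open>The derivative is a multiple of the square of \<open>inverse\<close>, so the induction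
  closes with the product rule alone.\<close>

lemma Ck_on_inverse: "Ck_on k (- {0::real}) inverse"
proof (induction k)
  case 0 show ?case by (auto intro: continuous_intros)
next
  case (Suc k)
  have o: "open (- {0::real})" by auto
  show ?case
  proof (rule Ck_on_SucI[OF o])
    fix x :: real assume "x \<in> - {0}"
    then show "(inverse has_derivative (\<lambda>v. (- v) * (inverse x * inverse x))) (at x)"
      by (auto intro!: derivative_eq_intros simp: field_simps)
  next
    fix v :: real
    show "Ck_on k (- {0}) (\<lambda>x. (- v) * (inverse x * inverse x))"
      by (intro Ck_on_bilinear[OF bounded_bilinear_mult] Ck_on_const Suc o)
  qed
qed

lemma Ck_on_Pair:
  assumes "Ck_on k S f" "Ck_on k S g" "open S"
  shows "Ck_on k S (\<lambda>x. (f x, g x))"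
proof -
  have "Ck_on k S (\<lambda>x. (f x, 0) + (0, g x))"
    by (rule Ck_on_add)
      (auto intro!: Ck_on_bounded_linear[of "\<lambda>y. (y, 0)" k S f] Ck_on_bounded_linear[of "\<lambda>y. (0, y)" k S g]
        bounded_linear_Pair bounded_linear_ident bounded_linear_zero assms)
  then show ?thesis by simp
qed

section \<open>Closure properties of smooth maps\<close>

lemma smooth_on_subset: "smooth_on S f \<Longrightarrow> T \<subseteq> S \<Longrightarrow> smooth_on T f"
  by (auto simp: smooth_on_def intro: Ck_on_subset)

lemma smooth_on_cong: "open S \<Longrightarrow> (\<And>x. x \<in> S \<Longrightarrow> f x = g x) \<Longrightarrow> smooth_on S f \<Longrightarrow> smooth_on S g"
  unfolding smooth_on_def using Ck_on_cong[of S f g] by blast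

lemma smooth_on_local:
  assumes "\<And>x. x \<in> S \<Longrightarrow> \<exists>U. open U \<and> x \<in> U \<and> smooth_on U f"
  shows "smooth_on S f"
  unfolding smooth_on_def
proof
  fix k show "Ck_on k S f"
    by (rule Ck_on_local) (use assms smooth_on_def in blast)
qed

lemma smooth_on_const: "smooth_on S (\<lambda>x. c)"
  by (simp add: smooth_on_def Ck_on_const)

lemma smooth_on_ident: "open S \<Longrightarrow> smooth_on S (\<lambda>x. x)"
  by (simp add: smooth_on_def Ck_on_ident)

lemma smooth_on_add: "smooth_on S f \<Longrightarrow> smooth_on S g \<Longrightarrow> open S \<Longrightarrow> smooth_on S (\<lambda>x. f x + g x)"
  by (simp add: smooth_on_def Ck_on_add)

lemma smooth_on_sum:
  "(\<And>i. i \<in> I \<Longrightarrow> smooth_on S (f i)) \<Longrightarrow> open S \<Longrightarrow> smooth_on S (\<lambda>x. \<Sum>i\<in>I. f i x)"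
  by (simp add: smooth_on_def Ck_on_sum)

lemma smooth_on_bounded_linear:
  "bounded_linear h \<Longrightarrow> smooth_on S f \<Longrightarrow> open S \<Longrightarrow> smooth_on S (\<lambda>x. h (f x))"
  by (simp add: smooth_on_def Ck_on_bounded_linear)

lemma smooth_on_linear: "bounded_linear h \<Longrightarrow> open S \<Longrightarrow> smooth_on S h"
  by (rule smooth_on_bounded_linear[OF _ smooth_on_ident])

lemmas smooth_on_fst = smooth_on_linear[OF bounded_linear_fst]
lemmas smooth_on_snd = smooth_on_linear[OF bounded_linear_snd]
lemmas smooth_on_inner_left = smooth_on_bounded_linear[OF bounded_linear_inner_left]

lemma smooth_on_bilinear:
  "bounded_bilinear h \<Longrightarrow> smooth_on S f \<Longrightarrow> smooth_on S g \<Longrightarrow> open S \<Longrightarrow> smooth_on S (\<lambda>x. h (f x) (g x))"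
  by (simp add: smooth_on_def Ck_on_bilinear)

lemmas smooth_on_mult = smooth_on_bilinear[OF bounded_bilinear_mult]
lemmas smooth_on_scaleR = smooth_on_bilinear[OF bounded_bilinear_scaleR]

lemma smooth_on_minus: "smooth_on S f \<Longrightarrow> open S \<Longrightarrow> smooth_on S (\<lambda>x. - f x)"
  by (rule smooth_on_bounded_linear[OF bounded_linear_minus[OF bounded_linear_ident]])

lemma smooth_on_diff: "smooth_on S f \<Longrightarrow> smooth_on S g \<Longrightarrow> open S \<Longrightarrow> smooth_on S (\<lambda>x. f x - g x)"
  using smooth_on_add[OF _ smooth_on_minus, of S f g] by simp

lemma smooth_on_Pair:
  "smooth_on S f \<Longrightarrow> smooth_on S g \<Longrightarrow> open S \<Longrightarrow> smooth_on S (\<lambda>x. (f x, g x))"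
  by (simp add: smooth_on_def Ck_on_Pair)

lemma smooth_on_compose:
  fixes f :: "'a::euclidean_space \<Rightarrow> 'b::euclidean_space" and g :: "'b \<Rightarrow> 'c::real_normed_vector"
  shows "smooth_on T g \<Longrightarrow> smooth_on S f \<Longrightarrow> open S \<Longrightarrow> f ` S \<subseteq> T \<Longrightarrow> smooth_on S (\<lambda>x. g (f x))"
  unfolding smooth_on_def using Ck_on_compose[of _ S f T g] by blast

lemma smooth_on_continuous: "smooth_on S f \<Longrightarrow> continuous_on S f"
  using Ck_on_imp_continuous_on by (auto simp: smooth_on_def)

lemma smooth_on_derivative: "smooth_on S f \<Longrightarrow> smooth_on S (\<lambda>x. frechet_derivative f (at x) v)"
  and smooth_on_differentiable: "smooth_on S f \<Longrightarrow> x \<in> S \<Longrightarrow> f differentiable (at x)"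
proof -
  assume "smooth_on S f"
  then have "Ck_on (Suc k) S f" for k by (simp only: smooth_on_def)
  then show "smooth_on S (\<lambda>x. frechet_derivative f (at x) v)" "x \<in> S \<Longrightarrow> f differentiable (at x)"
    by (auto simp: smooth_on_def)
qed

lemma smooth_on_has_derivative:
  "smooth_on S f \<Longrightarrow> x \<in> S \<Longrightarrow> (f has_derivative frechet_derivative f (at x)) (at x)"
  unfolding frechet_derivative_works[symmetric] by (rule smooth_on_differentiable)

lemmas smooth_intros = smooth_on_const smooth_on_ident smooth_on_add smooth_on_sum smooth_on_fst smooth_on_snd
  smooth_on_inner_left smooth_on_mult smooth_on_scaleR smooth_on_minus smooth_on_diff smooth_on_Pair

section \<open>Factorised increments\<close>

text \<open>Caratheodory's form of differentiability: once the increment factors through functions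
  \<open>q i\<close> with limits at \<open>x\<close>, those limits are the partial derivatives. All
  later derivatives of solutions, implicit functions and Hadamard quotients come from such a
  factorisation, without further estimates.\<close>

lemma has_derivative_caratheodory:
  fixes f :: "'a::euclidean_space \<Rightarrow> 'b::real_normed_vector"
  assumes ev: "\<forall>\<^sub>F y in at x. f y = f x + (\<Sum>i\<in>Basis. ((y - x) \<bullet> i) *\<^sub>R q i y)"
    and cont: "\<And>i. i \<in> Basis \<Longrightarrow> (q i \<longlongrightarrow> l i) (at x)"
  shows "(f has_derivative (\<lambda>v. \<Sum>i\<in>Basis. (v \<bullet> i) *\<^sub>R l i)) (at x)"
  unfolding has_derivative_at_within
proof (intro conjI)
  show "bounded_linear (\<lambda>v. \<Sum>i\<in>Basis. (v \<bullet> i) *\<^sub>R l i)"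
    by (intro bounded_linear_sum bounded_linear_compose[OF bounded_linear_scaleR_left bounded_linear_inner_left])
  have z: "((\<lambda>y. \<Sum>i\<in>Basis. norm (q i y - l i)) \<longlongrightarrow> (\<Sum>i\<in>Basis. norm (l i - l i))) (at x)"
    by (intro tendsto_intros cont)
  show "((\<lambda>y. (f y - f x - (\<Sum>i\<in>Basis. ((y - x) \<bullet> i) *\<^sub>R l i)) /\<^sub>R norm (y - x)) \<longlongrightarrow> 0) (at x)"
  proof (rule Lim_null_comparison[OF _ z[simplified]])
    show "\<forall>\<^sub>F y in at x. norm ((f y - f x - (\<Sum>i\<in>Basis. ((y - x) \<bullet> i) *\<^sub>R l i)) /\<^sub>R norm (y - x))
            \<le> (\<Sum>i\<in>Basis. norm (q i y - l i))"
      using ev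
    proof eventually_elim
      case (elim y)
      \<comment> \<open>The remainder keeps the factor y - x, so its quotient by the norm is at most
        the sum of the deviations of \<open>q i y\<close> from \<open>l i\<close>.\<close>
      have "f y - f x - (\<Sum>i\<in>Basis. ((y - x) \<bullet> i) *\<^sub>R l i) = (\<Sum>i\<in>Basis. ((y - x) \<bullet> i) *\<^sub>R (q i y - l i))"
        unfolding elim by (simp add: sum_subtractf scaleR_diff_right)
      also have "norm \<dots> \<le> (\<Sum>i\<in>Basis. norm (y - x) * norm (q i y - l i))"
        by (rule order.trans[OF norm_sum]) (auto intro!: sum_mono mult_right_mono Basis_le_norm)
      finally show ?case
        by (cases "y = x") (auto simp: sum_distrib_left[symmetric] divide_simps mult.commute intro: sum_nonneg)
    qed
  qed
qed

text \<open>The fundamental theorem of calculus along the segment from \<open>x\<close> to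
  \<open>x + w\<close>, with the derivative split over the basis. The integrals are the factors
  needed above, and they remain meaningful at \<open>w = 0\<close>, where they equal the partial
  derivatives.\<close>

lemma Ck1_difference_integral:
  fixes f :: "'a::euclidean_space \<Rightarrow> 'b::euclidean_space"
  assumes f: "Ck_on (Suc 0) S f" and seg: "\<And>\<theta>. \<theta> \<in> {0..1} \<Longrightarrow> x + \<theta> *\<^sub>R w \<in> S"
  shows "f (x + w) = f x + (\<Sum>i\<in>Basis. (w \<bullet> i) *\<^sub>R integral {0..1} (\<lambda>\<theta>. frechet_derivative f (at (x + \<theta> *\<^sub>R w)) i))"
proof -
  let ?D = "\<lambda>\<theta>. frechet_derivative f (at (x + \<theta> *\<^sub>R w))"
  have c: "continuous_on {0..1} (\<lambda>\<theta>. ?D \<theta> i)" for i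
  proof -
    have "continuous_on S (\<lambda>x. frechet_derivative f (at x) i)" using f by simp
    then show ?thesis
      by (rule continuous_on_compose2) (use seg in \<open>auto intro!: continuous_intros\<close>)
  qed
  have "((\<lambda>\<theta>. f (x + \<theta> *\<^sub>R w)) has_vector_derivative ?D \<theta> w) (at \<theta> within {0..1})" if "\<theta> \<in> {0..1}" for \<theta>
  proof -
    have fd: "(f has_derivative ?D \<theta>) (at (x + \<theta> *\<^sub>R w))"
      using f seg[OF that] by (simp add: frechet_derivative_works)
    have "((\<lambda>\<theta>. x + \<theta> *\<^sub>R w) has_derivative (\<lambda>h. h *\<^sub>R w)) (at \<theta>)"
      by (auto intro!: derivative_eq_intros)
    from diff_chain_at[OF this fd] have "((\<lambda>\<theta>. f (x + \<theta> *\<^sub>R w)) has_derivative (\<lambda>h. ?D \<theta> (h *\<^sub>R w))) (at \<theta>)"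
      by (simp add: o_def)
    then show ?thesis
      unfolding has_vector_derivative_def
      by (simp add: linear_scale[OF has_derivative_linear[OF fd]] has_derivative_at_withinI)
  qed
  from fundamental_theorem_of_calculus[OF _ this]
  have "((\<lambda>\<theta>. ?D \<theta> w) has_integral (f (x + w) - f x)) {0..1}" by simp
  moreover have "((\<lambda>\<theta>. \<Sum>i\<in>Basis. (w \<bullet> i) *\<^sub>R ?D \<theta> i) has_integral (\<Sum>i\<in>Basis. (w \<bullet> i) *\<^sub>R integral {0..1} (\<lambda>\<theta>. ?D \<theta> i))) {0..1}"
    by (intro has_integral_sum has_integral_cmul integrable_integral integrable_continuous_real c) auto
  moreover have "?D \<theta> w = (\<Sum>i\<in>Basis. (w \<bullet> i) *\<^sub>R ?D \<theta> i)" if "\<theta> \<in> {0..1}" for \<theta>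
    using f seg[OF that] by (intro frechet_derivative_expand) simp
  ultimately have "f (x + w) - f x = (\<Sum>i\<in>Basis. (w \<bullet> i) *\<^sub>R integral {0..1} (\<lambda>\<theta>. ?D \<theta> i))"
    by (metis (no_types, lifting) has_integral_cong has_integral_unique)
  then show ?thesis by (simp add: algebra_simps)
qed

section \<open>Linear differential equations with parameters\<close>

text \<open>Gronwall's inequality without integrals: the squared norm of \<open>d\<close>, weighted
  by exp(-2Lt), cannot increase to the right of \<open>t0\<close>, and weighted by exp(2Lt) it
  cannot decrease towards \<open>t0\<close> from the left. Since it is 0 at \<open>t0\<close>, it is
  0 everywhere.\<close>

lemma gronwall_zero:
  fixes d :: "real \<Rightarrow> 'a::euclidean_space"
  assumes der: "\<And>t. t \<in> {a<..<b} \<Longrightarrow> (d has_vector_derivative d' t) (at t)"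
    and le: "\<And>t. t \<in> {a<..<b} \<Longrightarrow> norm (d' t) \<le> L * norm (d t)"
    and t0: "t0 \<in> {a<..<b}" "d t0 = 0" and t: "t \<in> {a<..<b}"
  shows "d t = 0"
proof -
  have q: "((\<lambda>t. exp (c * t) * (d t \<bullet> d t)) has_real_derivative
      exp (c * s) * (c * (d s \<bullet> d s) + 2 * (d s \<bullet> d' s))) (at s)" if "s \<in> {a<..<b}" for c s
  proof -
    have "((\<lambda>t. d t \<bullet> d t) has_real_derivative 2 * (d s \<bullet> d' s)) (at s)"
      unfolding has_field_derivative_def
      using der[OF that, unfolded has_vector_derivative_def]
      by (auto intro!: derivative_eq_intros simp: inner_commute algebra_simps)
    then show ?thesis by (auto intro!: derivative_eq_intros simp: algebra_simps)
  qed
  have b: "\<bar>2 * (d s \<bullet> d' s)\<bar> \<le> 2 * L * (d s \<bullet> d s)" if "s \<in> {a<..<b}" for s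
  proof -
    have "\<bar>d s \<bullet> d' s\<bar> \<le> norm (d s) * norm (d' s)" by (rule Cauchy_Schwarz_ineq2)
    also have "\<dots> \<le> norm (d s) * (L * norm (d s))" by (intro mult_left_mono le that) auto
    finally show ?thesis by (simp add: dot_square_norm power2_eq_square algebra_simps)
  qed
  have "d t \<bullet> d t \<le> 0"
  proof (cases "t0 \<le> t")
    case True
    have "exp (- 2 * L * t) * (d t \<bullet> d t) \<le> exp (- 2 * L * t0) * (d t0 \<bullet> d t0)"
    proof (rule DERIV_nonpos_imp_nonincreasing[OF True])
      fix x assume "t0 \<le> x" "x \<le> t"
      then have x: "x \<in> {a<..<b}" using t t0 by auto
      show "\<exists>y. ((\<lambda>t. exp (- 2 * L * t) * (d t \<bullet> d t)) has_real_derivative y) (at x) \<and> y \<le> 0"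
        using q[OF x, of "- 2 * L"] b[OF x] by (intro exI conjI) (auto simp: mult_le_0_iff)
    qed
    then show ?thesis using t0 by (simp add: mult_le_0_iff)
  next
    case False
    then have le: "t \<le> t0" by simp
    have "exp (2 * L * t) * (d t \<bullet> d t) \<le> exp (2 * L * t0) * (d t0 \<bullet> d t0)"
    proof (rule DERIV_nonneg_imp_nondecreasing[OF le])
      fix x assume "t \<le> x" "x \<le> t0"
      then have x: "x \<in> {a<..<b}" using t t0 by auto
      show "\<exists>y. ((\<lambda>t. exp (2 * L * t) * (d t \<bullet> d t)) has_real_derivative y) (at x) \<and> 0 \<le> y"
        using q[OF x, of "2 * L"] b[OF x] by (intro exI conjI) auto
    qed
    then show ?thesis using t0 by (simp add: mult_le_0_iff)
  qed
  then show ?thesis by (metis antisym inner_eq_zero_iff inner_ge_zero)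
qed

text \<open>This is the integral of \<open>g\<close> from 0 to \<open>t\<close>, rescaled to the
  unit interval. The form covers both signs of \<open>t\<close> and keeps the domain of integration
  fixed, so that continuity in parameters can be read off the integrand.\<close>

lemma scaled_integral_has_vector_derivative:
  fixes g :: "real \<Rightarrow> 'a::euclidean_space"
  assumes g: "continuous_on UNIV g"
  shows "((\<lambda>t. t *\<^sub>R integral {0..1} (\<lambda>\<theta>. g (\<theta> * t))) has_vector_derivative g t) (at t)"
proof -
  \<comment> \<open>An antiderivative is taken on a compact interval; the margin 1 makes
    \<open>t\<close> an interior point of it.\<close>
  define m where "m = \<bar>t\<bar> + 1"
  obtain G where G: "\<And>x. x \<in> {-m..m} \<Longrightarrow> (G has_vector_derivative g x) (at x within {-m..m})"
    using antiderivative_continuous[of "-m" m g] continuous_on_subset[OF g] by auto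
  have eq: "G s - G 0 = s *\<^sub>R integral {0..1} (\<lambda>\<theta>. g (\<theta> * s))" if "s \<in> {-m<..<m}" for s
  proof -
    have "((\<lambda>\<theta>. G (\<theta> * s)) has_vector_derivative s *\<^sub>R g (\<theta> * s)) (at \<theta> within {0..1})"
      if \<theta>: "\<theta> \<in> {0..1}" for \<theta>
    proof -
      have in1: "(\<lambda>\<theta>. \<theta> * s) ` {0..1} \<subseteq> {-m..m}"
      proof clarify
        fix \<theta> :: real assume "\<theta> \<in> {0..1}"
        then have "\<bar>\<theta> * s\<bar> \<le> \<bar>s\<bar>" by (simp add: abs_mult mult_left_le_one_le)
        then show "\<theta> * s \<in> {-m..m}" using \<open>s \<in> {-m<..<m}\<close> by auto
      qed
      then have "(G has_vector_derivative g (\<theta> * s)) (at (\<theta> * s) within (\<lambda>\<theta>. \<theta> * s) ` {0..1})"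
        using \<theta> by (intro has_vector_derivative_within_subset[OF G]) blast+
      moreover have "((\<lambda>\<theta>. \<theta> * s) has_vector_derivative s) (at \<theta> within {0..1})"
        by (auto simp: has_vector_derivative_def intro!: derivative_eq_intros)
      ultimately show ?thesis
        using vector_diff_chain_within[of "\<lambda>\<theta>. \<theta> * s" s \<theta> "{0..1}" G "g (\<theta> * s)"] by (simp add: o_def)
    qed
    from fundamental_theorem_of_calculus[OF _ this]
    have "((\<lambda>\<theta>. s *\<^sub>R g (\<theta> * s)) has_integral (G s - G 0)) {0..1}" by simp
    moreover have "((\<lambda>\<theta>. s *\<^sub>R g (\<theta> * s)) has_integral (s *\<^sub>R integral {0..1} (\<lambda>\<theta>. g (\<theta> * s)))) {0..1}"
      by (intro has_integral_cmul integrable_integral integrable_continuous_real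
          continuous_on_compose2[OF g]) (auto intro!: continuous_intros)
    ultimately show ?thesis by (rule has_integral_unique)
  qed
  have t: "t \<in> {-m<..<m}" by (auto simp: m_def)
  have "(G has_vector_derivative g t) (at t)"
    using has_vector_derivative_within_subset[OF G, of t "{-m<..<m}"] t
    by (metis at_within_open box_real(1) greaterThanLessThan_subseteq_atLeastAtMost_iff less_eq_real_def open_greaterThanLessThan greaterThanLessThan_iff atLeastAtMost_iff order_refl)
  then have "((\<lambda>s. G s - G 0) has_vector_derivative g t) (at t)"
    by (auto intro!: derivative_eq_intros)
  then show ?thesis
    by (rule has_vector_derivative_transform_within_open[OF _ open_greaterThanLessThan t eq])
qed

section \<open>Existence by a contraction\<close>

text \<open>The contraction acts on bounded continuous functions of time and parameter together, so
  its fixed point is jointly continuous and dependence on the parameter needs no separate argument.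
  Solutions start at 0; other initial values are absorbed into \<open>f\<close> by a shift.\<close>

lemma picard_parametric:
  fixes f :: "real \<Rightarrow> 'p::metric_space \<Rightarrow> 'e::euclidean_space \<Rightarrow> 'e"
  assumes cont: "continuous_on UNIV (\<lambda>(t, p, y). f t p y)"
    and bnd: "\<And>t p. norm (f t p 0) \<le> B"
    and lip: "\<And>t p y z. norm (f t p y - f t p z) \<le> L * norm (y - z)"
    and \<delta>: "0 < \<delta>" "\<delta> * L \<le> 1/2" and L: "0 \<le> L"
  obtains Y :: "real \<times> 'p \<Rightarrow> 'e" where "continuous_on UNIV Y" "\<And>p. Y (0, p) = 0"
    "\<And>t p. \<bar>t\<bar> < \<delta> \<Longrightarrow> ((\<lambda>t. Y (t, p)) has_vector_derivative f t p (Y (t, p))) (at t)"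
proof -
  \<comment> \<open>Clamping time to the interval of radius \<delta> lets the operator act on
    functions on the whole space, which form a complete space. Inside that interval
    \<open>c t = t\<close>, so there the fixed point satisfies the original equation.\<close>
  define c :: "real \<Rightarrow> real" where "c t = max (-\<delta>) (min \<delta> t)" for t
  have c: "\<bar>c t\<bar> \<le> \<delta>" for t using \<delta> by (auto simp: c_def)
  have cc: "continuous_on UNIV c" unfolding c_def by (intro continuous_intros)
  have fc: "continuous_on S (\<lambda>x. f (g x) (h x) (k x))"
    if "continuous_on S g" "continuous_on S h" "continuous_on S k" for S :: "'z::topological_space set" and g h k
    using continuous_on_compose2[OF cont continuous_on_Pair[OF that(1) continuous_on_Pair[OF that(2,3)]]] by simp
  have comp: "continuous_on S (\<lambda>x. Y (k x))" if "continuous_on UNIV Y" "continuous_on S k" 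
    for S :: "'z::topological_space set" and Y :: "'w::topological_space \<Rightarrow> 'e" and k
    by (rule continuous_on_compose2[OF that]) auto
  define T :: "(real \<times> 'p \<Rightarrow> 'e) \<Rightarrow> real \<times> 'p \<Rightarrow> 'e" where
    "T Y z = c (fst z) *\<^sub>R integral {0..1} (\<lambda>\<theta>. f (\<theta> * c (fst z)) (snd z) (Y (\<theta> * c (fst z), snd z)))" for Y z
  have ic: "continuous_on {0..1} (\<lambda>\<theta>. f (\<theta> * s) p (Y (\<theta> * s, p)))" if "continuous_on UNIV Y"
    for Y s p by (intro fc comp[OF that] continuous_intros)
  have Tc: "continuous_on UNIV (T Y)" if Y: "continuous_on UNIV Y" for Y
  proof -
    have "continuous_on (UNIV \<times> cbox 0 1) (\<lambda>(z, \<theta>). f (\<theta> * c (fst z)) (snd z) (Y (\<theta> * c (fst z), snd z)))"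
      unfolding split_beta by (intro fc comp[OF Y] continuous_intros continuous_on_compose2[OF cc]) auto
    from integral_continuous_on_param[OF this]
    show ?thesis unfolding T_def 
      by (intro continuous_intros continuous_on_compose2[OF cc]) auto
  qed
  have Tb: "T Y \<in> bcontfun" if Y: "Y \<in> bcontfun" for Y
  proof -
    from Y obtain N where N: "\<And>z. norm (Y z) \<le> N" by (auto simp: bcontfun_def bounded_iff)
    have Yc: "continuous_on UNIV Y" using Y by (auto simp: bcontfun_def)
    show ?thesis
    proof (rule bcontfun_normI[OF Tc[OF Yc]])
      fix z
      have "norm (f s p (Y w)) \<le> B + L * N" for s p w
        using lip[of s p "Y w" 0] bnd[of s p] norm_triangle_sub[of "f s p (Y w)" "f s p 0"]
          mult_left_mono[OF N[of w] L] by simp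
      then have "norm (integral {0..1} (\<lambda>\<theta>. f (\<theta> * c (fst z)) (snd z) (Y (\<theta> * c (fst z), snd z)))) \<le> (B + L * N) * (1 - 0)"
        by (intro integral_bound ic[OF Yc]) auto
      then show "norm (T Y z) \<le> \<delta> * (B + L * N)"
        unfolding T_def norm_scaleR using c \<delta>(1) by (intro mult_mono) auto
    qed
  qed
  define TT where "TT Y = Bcontfun (T (apply_bcontfun Y))" for Y
  have TT: "apply_bcontfun (TT Y) = T (apply_bcontfun Y)" for Y
    unfolding TT_def by (rule Bcontfun_inverse) (rule Tb, rule apply_bcontfun)
  have "\<exists>!Y. TT Y = Y"
  proof (rule banach_fix_type[of "1/2"])
    show "\<forall>Y Z. dist (TT Y) (TT Z) \<le> 1/2 * dist Y Z"
    proof (intro allI dist_bound)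
      fix Y Z :: "(real \<times> 'p) \<Rightarrow>\<^sub>C 'e" and z
      let ?i = "\<lambda>Y \<theta>. f (\<theta> * c (fst z)) (snd z) (apply_bcontfun Y (\<theta> * c (fst z), snd z))"
      have ii: "?i Y integrable_on {0..1}" for Y
        by (intro integrable_continuous_real ic continuous_on_apply_bcontfun)
      have "norm (?i Y \<theta> - ?i Z \<theta>) \<le> L * dist Y Z" for \<theta>
        using lip dist_bounded[of Y _ Z] L by (smt (verit) dist_norm mult_left_mono)
      then have "norm (integral {0..1} (\<lambda>\<theta>. ?i Y \<theta> - ?i Z \<theta>)) \<le> L * dist Y Z * (1 - 0)"
        by (intro integral_bound continuous_on_diff ic continuous_on_apply_bcontfun) auto
      then have "\<bar>c (fst z)\<bar> * norm (integral {0..1} (?i Y) - integral {0..1} (?i Z)) \<le> \<delta> * (L * dist Y Z)"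
        using c[of "fst z"] \<delta>(1) by (intro mult_mono) (auto simp: integral_diff[OF ii ii])
      also have "\<dots> \<le> 1/2 * dist Y Z"
        using mult_right_mono[OF \<delta>(2), of "dist Y Z"] by (simp add: mult.assoc)
      finally show "dist (apply_bcontfun (TT Y) z) (apply_bcontfun (TT Z) z) \<le> 1/2 * dist Y Z"
        unfolding TT T_def dist_norm scaleR_diff_right[symmetric] norm_scaleR .
    qed
  qed auto
  then obtain Y where "TT Y = Y" by blast
  then have eqT: "apply_bcontfun Y = T (apply_bcontfun Y)" using TT by metis
  define y where "y = apply_bcontfun Y"
  have yc: "continuous_on UNIV y" by (simp add: y_def)
  have y: "y z = T y z" for z using eqT by (simp add: y_def)
  show ?thesis
  proof
    show "continuous_on UNIV y" by (rule yc)
    show "y (0, p) = 0" for p by (subst y) (use \<delta> in \<open>simp add: T_def c_def\<close>)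
    fix t p assume t: "\<bar>t\<bar> < \<delta>"
    have "continuous_on UNIV (\<lambda>s. f s p (y (s, p)))" by (intro fc comp[OF yc] continuous_intros)
    from scaled_integral_has_vector_derivative[OF this, of t]
    show "((\<lambda>t. y (t, p)) has_vector_derivative f t p (y (t, p))) (at t)"
    proof (rule has_vector_derivative_transform_within_open)
      show "t \<in> {-\<delta><..<\<delta>}" using t by auto
      fix s assume "s \<in> {-\<delta><..<\<delta>}"
      then have "c s = s" by (auto simp: c_def)
      then show "s *\<^sub>R integral {0..1} (\<lambda>\<theta>. f (\<theta> * s) p (y (\<theta> * s, p))) = y (s, p)"
        by (subst (2) y) (simp add: T_def)
    qed auto
  qed
qed

section \<open>Linear systems and their regularity\<close>

text \<open>The vectors \<open>a i\<close> are the columns of the matrix of the system. This makes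
  \<open>DIM('e) * K\<close> a common Lipschitz constant, and the condition
  \<open>d * (DIM('e) * K) \<le> 1/2\<close> below is the contraction condition for it.\<close>

lemma linear_ode_bound:
  fixes y :: "'e::euclidean_space" and a :: "'e \<Rightarrow> 'e" and K :: real
  assumes "\<And>i. i \<in> Basis \<Longrightarrow> norm (a i) \<le> K"
  shows "norm (\<Sum>i\<in>Basis. (y \<bullet> i) *\<^sub>R a i) \<le> (DIM('e) * K) * norm y"
proof -
  have "norm (\<Sum>i\<in>Basis. (y \<bullet> i) *\<^sub>R a i) \<le> (\<Sum>i\<in>(Basis::'e set). norm y * K)"
    by (rule order.trans[OF norm_sum], rule sum_mono) (simp add: mult_mono Basis_le_norm assms)
  then show ?thesis by (simp add: algebra_simps)
qed

lemma linear_ode_unique: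
  fixes Y Z :: "real \<Rightarrow> 'e::euclidean_space" and K :: real
  assumes Y: "\<And>t. t \<in> {-d<..<d} \<Longrightarrow> (Y has_vector_derivative (\<Sum>i\<in>Basis. (Y t \<bullet> i) *\<^sub>R a i t) + b t) (at t)"
    and Z: "\<And>t. t \<in> {-d<..<d} \<Longrightarrow> (Z has_vector_derivative (\<Sum>i\<in>Basis. (Z t \<bullet> i) *\<^sub>R a i t) + b t) (at t)"
    and a: "\<And>i t. i \<in> Basis \<Longrightarrow> t \<in> {-d<..<d} \<Longrightarrow> norm (a i t) \<le> K"
    and "Y 0 = Z 0" "t \<in> {-d<..<d}"
  shows "Y t = Z t"
proof -
  have "Y t - Z t = 0"
  proof (rule gronwall_zero[of "-d" d "\<lambda>t. Y t - Z t"])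
    fix t assume t: "t \<in> {-d<..<d}"
    show "((\<lambda>t. Y t - Z t) has_vector_derivative (\<Sum>i\<in>Basis. ((Y t - Z t) \<bullet> i) *\<^sub>R a i t)) (at t)"
      using has_vector_derivative_diff[OF Y[OF t] Z[OF t]]
      by (simp add: inner_diff_left scaleR_diff_left sum_subtractf)
    show "norm (\<Sum>i\<in>Basis. ((Y t - Z t) \<bullet> i) *\<^sub>R a i t) \<le> (DIM('e) * K) * norm (Y t - Z t)"
      by (rule linear_ode_bound) (use a t in auto)
  qed (use assms in auto)
  then show ?thesis by simp
qed

text \<open>The coefficients live on a compact convex box only. Composition with the closest-point
  retraction \<open>R\<close> extends them continuously to the whole space with the same bounds and
  does not change them on the box.\<close>

lemma linear_ode_exists:
  fixes a :: "'e::euclidean_space \<Rightarrow> real \<times> 'p::euclidean_space \<Rightarrow> 'e" and d K :: real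
  assumes d: "0 < d" "d * (DIM('e) * K) \<le> 1/2" and C: "compact C" "convex C" "C \<noteq> {}"
    and a: "\<And>i. i \<in> Basis \<Longrightarrow> continuous_on ({-d..d} \<times> C) (a i)"
    and b: "continuous_on ({-d..d} \<times> C) b"
    and K: "\<And>i z. i \<in> Basis \<Longrightarrow> z \<in> {-d..d} \<times> C \<Longrightarrow> norm (a i z) \<le> K"
  obtains Y where "continuous_on UNIV Y" "\<And>p. Y (0, p) = y0"
    "\<And>t p. t \<in> {-d<..<d} \<Longrightarrow> p \<in> C \<Longrightarrow>
      ((\<lambda>t. Y (t, p)) has_vector_derivative (\<Sum>i\<in>Basis. (Y (t, p) \<bullet> i) *\<^sub>R a i (t, p)) + b (t, p)) (at t)"
proof -
  define D where "D = {-d..d} \<times> C"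
  have D: "closed D" "convex D" "D \<noteq> {}" "compact D"
    using C d by (auto simp: D_def intro!: convex_Times compact_Times closed_Times compact_imp_closed)
  define R where "R = closest_point D"
  have Rc: "continuous_on UNIV R" unfolding R_def by (intro continuous_on_closest_point D)
  have RD: "R z \<in> D" for z unfolding R_def by (rule closest_point_in_set) (use D in auto)
  have R: "R z = z" if "z \<in> D" for z unfolding R_def using that by (rule closest_point_self)
  have aR: "continuous_on UNIV (\<lambda>z. a i (R z))" if "i \<in> Basis" for i
    by (rule continuous_on_compose2[OF a[OF that] Rc]) (use RD[unfolded D_def] in blast)
  have bR: "continuous_on UNIV (\<lambda>z. b (R z))"
    by (rule continuous_on_compose2[OF b Rc]) (use RD[unfolded D_def] in blast)
  have KR: "norm (a i (R z)) \<le> K" if "i \<in> Basis" for i z using K[OF that] RD by (auto simp: D_def)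
  have K0: "0 \<le> K" using KR[of "SOME i. i \<in> Basis"] norm_ge_zero by (metis SOME_Basis order_trans)
  obtain B where B: "\<And>z. norm (b (R z)) \<le> B"
  proof -
    have "compact (b ` D)" using D b by (auto intro!: compact_continuous_image simp: D_def)
    then obtain B where "\<And>x. x \<in> b ` D \<Longrightarrow> norm x \<le> B" using compact_imp_bounded bounded_iff by metis
    then show thesis using RD that by blast
  qed
  \<comment> \<open>The unknown is the deviation from \<open>y0\<close>, because the contraction
    produces solutions that start at 0.\<close>
  define f where "f t p y = (\<Sum>i\<in>Basis. ((y0 + y) \<bullet> i) *\<^sub>R a i (R (t, p))) + b (R (t, p))" for t p y
  have "continuous_on UNIV (\<lambda>(t, p, y). f t p y)"
    unfolding f_def split_beta
    by (intro continuous_intros continuous_on_compose2[OF aR] continuous_on_compose2[OF bR]) auto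
  moreover have "norm (f t p 0) \<le> (DIM('e) * K) * norm y0 + B" for t p
    unfolding f_def using linear_ode_bound[of "\<lambda>i. a i (R (t, p))" K "y0 + 0"] KR B
    by (intro order.trans[OF norm_triangle_ineq] add_mono) auto
  moreover have "norm (f t p y - f t p z) \<le> (DIM('e) * K) * norm (y - z)" for t p y z
  proof -
    have "f t p y - f t p z = (\<Sum>i\<in>Basis. ((y - z) \<bullet> i) *\<^sub>R a i (R (t, p)))"
      by (simp add: f_def sum_subtractf[symmetric] algebra_simps)
    then show ?thesis using linear_ode_bound[of "\<lambda>i. a i (R (t, p))" K "y - z"] KR by auto
  qed
  ultimately obtain Y where Y: "continuous_on UNIV Y" "\<And>p. Y (0, p) = 0"
    "\<And>t p. \<bar>t\<bar> < d \<Longrightarrow> ((\<lambda>t. Y (t, p)) has_vector_derivative f t p (Y (t, p))) (at t)"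
    using picard_parametric[of f _ "DIM('e) * K" d] d K0 by (metis mult_nonneg_nonneg of_nat_0_le_iff)
  show ?thesis
  proof
    show "continuous_on UNIV (\<lambda>z. y0 + Y z)" by (intro continuous_intros Y)
    show "y0 + Y (0, p) = y0" for p by (simp add: Y)
    fix t p assume "t \<in> {-d<..<d}" "p \<in> C"
    then show "((\<lambda>t. y0 + Y (t, p)) has_vector_derivative
       (\<Sum>i\<in>Basis. ((y0 + Y (t, p)) \<bullet> i) *\<^sub>R a i (t, p)) + b (t, p)) (at t)"
      using has_vector_derivative_add[OF has_vector_derivative_const Y(3), of t y0 p] R[of "(t, p)"]
      by (auto simp: f_def D_def)
  qed
qed

lemma sum_Basis_prod:
  fixes f :: "'a::euclidean_space \<times> 'b::euclidean_space \<Rightarrow> 'c::comm_monoid_add"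
  shows "(\<Sum>i\<in>Basis. f i) = (\<Sum>i\<in>Basis. f (i, 0)) + (\<Sum>i\<in>Basis. f (0, i))"
proof -
  have "inj_on (\<lambda>u. (u::'a, 0::'b)) Basis" "inj_on (\<lambda>u. (0::'a, u::'b)) Basis"
    by (auto intro!: inj_onI)
  moreover have "(\<lambda>u. (u::'a, 0::'b)) ` Basis \<inter> (\<lambda>u. (0::'a, u::'b)) ` Basis = {}"
    by (auto simp: nonzero_Basis)
  ultimately show ?thesis
    unfolding Basis_prod_def by (subst sum.union_disjoint) (auto simp: sum.reindex)
qed

text \<open>Assembles a joint derivative from a time derivative at the single parameter
  \<open>p0\<close> and a factorisation of the parameter increment, valid for all nearby times, with
  continuous factors. The last argument of \<open>Q j\<close> is the increment; at increment 0 the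
  factor is the partial derivative.\<close>

lemma factor_has_derivative:
  fixes Y :: "real \<times> 'p::euclidean_space \<Rightarrow> 'e::euclidean_space"
  assumes t: "((\<lambda>t. Y (t, p0)) has_vector_derivative e) (at t0)"
    and Q: "\<And>j. j \<in> Basis \<Longrightarrow> continuous_on UNIV (Q j)"
    and T: "open T" "t0 \<in> T" and r: "0 < r"
    and eq: "\<And>t w. t \<in> T \<Longrightarrow> w \<in> ball 0 r \<Longrightarrow>
      Y (t, p0 + w) = Y (t, p0) + (\<Sum>j\<in>Basis. (w \<bullet> j) *\<^sub>R Q j (t, (p0, w)))"
  shows "(Y has_derivative (\<lambda>v. fst v *\<^sub>R e + (\<Sum>j\<in>Basis. (snd v \<bullet> j) *\<^sub>R Q j (t0, (p0, 0))))) (at (t0, p0))"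
proof -
  let ?z = "(t0, p0)" and ?W = "T \<times> ball p0 r"
  \<comment> \<open>A basis vector of the product is either the time direction, which gets the
    factor 0 because the increment \<open>?S\<close> vanishes along \<open>p0\<close>, or some (0,
    j), which gets \<open>Q j\<close>.\<close>
  let ?q = "\<lambda>i z. if fst i = 0 then Q (snd i) (fst z, (p0, snd z - p0)) else 0"
  let ?S = "\<lambda>z. \<Sum>j\<in>Basis. ((snd z - p0) \<bullet> j) *\<^sub>R Q j (fst z, (p0, snd z - p0))"
  have W: "open ?W" "?z \<in> ?W" using T r by (auto intro: open_Times)
  have B: "(i :: real \<times> 'p) \<in> Basis \<Longrightarrow> i = (1, 0) \<or> (\<exists>j\<in>Basis. i = (0, j))" for i
    by (auto simp: Basis_prod_def)
  have nz: "(j::'p) \<in> Basis \<Longrightarrow> (0::real, j) \<in> Basis" for j by (auto simp: Basis_prod_def)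
  have "(?S has_derivative (\<lambda>v. \<Sum>i\<in>Basis. (v \<bullet> i) *\<^sub>R ?q i ?z)) (at ?z)"
  proof (rule has_derivative_caratheodory[where q = ?q])
    show "\<forall>\<^sub>F y in at ?z. ?S y = ?S ?z + (\<Sum>i\<in>Basis. ((y - ?z) \<bullet> i) *\<^sub>R ?q i y)"
      unfolding sum_Basis_prod by (rule always_eventually) (simp add: inner_prod_def)
    fix i :: "real \<times> 'p" assume i: "i \<in> Basis"
    show "(?q i \<longlongrightarrow> ?q i ?z) (at ?z)"
    proof (cases "fst i = 0")
      case True
      then have "snd i \<in> Basis" using B[OF i] by auto
      have "continuous_on UNIV (\<lambda>z :: real \<times> 'p. (fst z, (p0, snd z - p0)))" by (intro continuous_intros)
      from continuous_on_compose2[OF Q[OF \<open>snd i \<in> Basis\<close>] this]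
      have "continuous_on UNIV (?q i)" using True by simp
      then have "isCont (?q i) ?z" by (simp add: continuous_on_eq_continuous_at)
      then show ?thesis by (simp only: isCont_def)
    qed auto
  qed
  moreover have "((\<lambda>z. Y (fst z, p0)) has_derivative (\<lambda>v. fst v *\<^sub>R e)) (at ?z)"
    using has_derivative_compose[of fst fst ?z UNIV "\<lambda>t. Y (t, p0)" "\<lambda>h. h *\<^sub>R e"] t
    by (auto simp: has_vector_derivative_def intro: bounded_linear_imp_has_derivative bounded_linear_fst)
  ultimately have "((\<lambda>z. Y (fst z, p0) + ?S z) has_derivative
      (\<lambda>v. fst v *\<^sub>R e + (\<Sum>i\<in>Basis. (v \<bullet> i) *\<^sub>R ?q i ?z))) (at ?z)"
    by (intro has_derivative_add)
  then have "(Y has_derivative (\<lambda>v. fst v *\<^sub>R e + (\<Sum>i\<in>Basis. (v \<bullet> i) *\<^sub>R ?q i ?z))) (at ?z)"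
  proof (rule has_derivative_transform_within_open[OF _ W])
    fix z assume "z \<in> ?W"
    then show "Y (fst z, p0) + ?S z = Y z"
      using eq[of "fst z" "snd z - p0"] by (auto simp: dist_norm norm_minus_commute)
  qed
  then show ?thesis by (simp add: sum_Basis_prod inner_prod_def)
qed


lemma continuous_on_segment_integral:
  fixes g :: "'a::euclidean_space \<Rightarrow> 'b::euclidean_space"
  assumes g: "continuous_on U g" and m: "continuous_on (D \<times> {0..1}) m" "m ` (D \<times> {0..1}) \<subseteq> U"
  shows "continuous_on D (\<lambda>z. integral {0..1} (\<lambda>\<theta>::real. g (m (z, \<theta>))))"
proof -
  have "continuous_on (D \<times> cbox 0 1) (\<lambda>(z, \<theta>). g (m (z, \<theta>)))"
    using continuous_on_compose2[OF g m] by (simp add: split_beta cbox_interval)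
  from integral_continuous_on_param[OF this] show ?thesis by (simp add: cbox_interval)
qed

lemma norm_integral_le_unit:
  fixes f :: "real \<Rightarrow> 'a::euclidean_space"
  assumes "continuous_on {0..1} f" "\<And>t. t \<in> {0..1} \<Longrightarrow> norm (f t) \<le> K"
  shows "norm (integral {0..1} f) \<le> K"
  using integral_bound[of 0 1 f K] assms by auto

text \<open>The given family is only known to solve the equation for each parameter. On a small
  compact box it must coincide, by uniqueness, with the jointly continuous solution constructed
  there.\<close>

lemma linear_ode_continuous:
  fixes a :: "'e::euclidean_space \<Rightarrow> real \<times> 'p::euclidean_space \<Rightarrow> 'e" and K \<delta> :: real
  assumes \<delta>: "0 < \<delta>" "\<delta> * (DIM('e) * K) \<le> 1/2" and S: "open S"
    and a: "\<And>i. i \<in> Basis \<Longrightarrow> continuous_on ({-\<delta><..<\<delta>} \<times> S) (a i)"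
    and b: "continuous_on ({-\<delta><..<\<delta>} \<times> S) b"
    and K: "\<And>i z. i \<in> Basis \<Longrightarrow> z \<in> {-\<delta><..<\<delta>} \<times> S \<Longrightarrow> norm (a i z) \<le> K"
    and Y0: "\<And>p. p \<in> S \<Longrightarrow> Y (0, p) = y0"
    and Y: "\<And>t p. t \<in> {-\<delta><..<\<delta>} \<Longrightarrow> p \<in> S \<Longrightarrow>
      ((\<lambda>t. Y (t, p)) has_vector_derivative (\<Sum>i\<in>Basis. (Y (t, p) \<bullet> i) *\<^sub>R a i (t, p)) + b (t, p)) (at t)"
  shows "continuous_on ({-\<delta><..<\<delta>} \<times> S) Y"
proof (rule continuous_at_imp_continuous_on, rule ballI)
  fix z0 assume "z0 \<in> {-\<delta><..<\<delta>} \<times> S"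
  then obtain t0 p0 where z0: "z0 = (t0, p0)" "t0 \<in> {-\<delta><..<\<delta>}" "p0 \<in> S" by auto
  obtain r where r: "r > 0" "cball p0 r \<subseteq> S" using S z0 open_contains_cball by blast
  \<comment> \<open>The midpoint of |t0| and \<delta>: the closed interval of radius
    \<open>d\<close> lies in the open one of radius \<delta> and has \<open>t0\<close> in its
    interior.\<close>
  define d where "d = (\<bar>t0\<bar> + \<delta>) / 2"
  have d: "0 < d" "d < \<delta>" "\<bar>t0\<bar> < d" using z0 by (auto simp: d_def)
  have K0: "0 \<le> K"
    using K[of "SOME i. i \<in> Basis" z0] z0 norm_ge_zero by (metis SOME_Basis mem_Sigma_iff order_trans)
  have sub: "{-d..d} \<times> cball p0 r \<subseteq> {-\<delta><..<\<delta>} \<times> S" using d r by auto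
  have dK: "d * (DIM('e) * K) \<le> 1/2"
    using \<delta> d K0 by (intro order.trans[OF mult_right_mono \<delta>(2)]) auto
  obtain Z where Z: "continuous_on UNIV Z" "\<And>p. Z (0, p) = y0"
    "\<And>t p. t \<in> {-d<..<d} \<Longrightarrow> p \<in> cball p0 r \<Longrightarrow>
      ((\<lambda>t. Z (t, p)) has_vector_derivative (\<Sum>i\<in>Basis. (Z (t, p) \<bullet> i) *\<^sub>R a i (t, p)) + b (t, p)) (at t)"
  proof (rule linear_ode_exists[OF d(1) dK, of "cball p0 r" a b y0])
    show "continuous_on ({- d..d} \<times> cball p0 r) (a i)" if "i \<in> Basis" for i
      using a[OF that] sub by (rule continuous_on_subset)
    show "continuous_on ({- d..d} \<times> cball p0 r) b" using b sub by (rule continuous_on_subset)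
  qed (use K sub r in auto)
  have eq: "Z z = Y z" if "z \<in> {-d<..<d} \<times> ball p0 r" for z
  proof -
    obtain t p where z: "z = (t, p)" by (cases z)
    have p: "p \<in> cball p0 r" "p \<in> S" and t: "t \<in> {-d<..<d}" using that r by (auto simp: z)
    have "Z (t, p) = Y (t, p)"
      by (rule linear_ode_unique[of d "\<lambda>t. Z (t, p)" "\<lambda>i t. a i (t, p)" "\<lambda>t. b (t, p)" "\<lambda>t. Y (t, p)" K])
        (use Z Y K Y0 p t d in auto)
    then show ?thesis by (simp add: z)
  qed
  have o: "open ({-d<..<d} \<times> ball p0 r)" by (auto intro: open_Times)
  have "continuous_on ({-d<..<d} \<times> ball p0 r) Y"
    by (rule continuous_on_eq[OF continuous_on_subset[OF Z(1) subset_UNIV] eq])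
  moreover have "z0 \<in> {-d<..<d} \<times> ball p0 r" using d r z0 by auto
  ultimately show "isCont Y z0" using o continuous_on_eq_continuous_at by blast
qed

text \<open>Induction on the order with all data generalised. The parameter increment of
  \<open>Y\<close> factors through solutions \<open>Q j\<close> of a linear system; at increment 0
  this is the variational equation, whose matrix is again \<open>a\<close> and whose forcing term
  has one order less than \<open>a\<close> and \<open>b\<close>. As the matrix does not change, the
  bound \<open>K\<close> and the admissible length of time stay the same at every order.\<close>

lemma linear_ode_Ck:
  fixes a :: "'e::euclidean_space \<Rightarrow> real \<times> 'p::euclidean_space \<Rightarrow> 'e" and K \<delta> :: real
  assumes "0 < \<delta>" "\<delta> * (DIM('e) * K) \<le> 1/2" "open S"
    and "\<And>i. i \<in> Basis \<Longrightarrow> Ck_on k ({-\<delta><..<\<delta>} \<times> S) (a i)"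
    and "Ck_on k ({-\<delta><..<\<delta>} \<times> S) b"
    and "\<And>i z. i \<in> Basis \<Longrightarrow> z \<in> {-\<delta><..<\<delta>} \<times> S \<Longrightarrow> norm (a i z) \<le> K"
    and "\<And>p. p \<in> S \<Longrightarrow> Y (0, p) = y0"
    and "\<And>t p. t \<in> {-\<delta><..<\<delta>} \<Longrightarrow> p \<in> S \<Longrightarrow>
      ((\<lambda>t. Y (t, p)) has_vector_derivative (\<Sum>i\<in>Basis. (Y (t, p) \<bullet> i) *\<^sub>R a i (t, p)) + b (t, p)) (at t)"
  shows "Ck_on k ({-\<delta><..<\<delta>} \<times> S) Y"
  using assms
proof (induction k arbitrary: \<delta> S a b Y y0)
  case 0
  then show ?case using linear_ode_continuous[of \<delta> K S a b Y y0] by simp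
next
  case (Suc k)
  note \<delta> = Suc.prems(1,2) and S = Suc.prems(3) and aS = Suc.prems(4) and bS = Suc.prems(5)
    and K = Suc.prems(6) and Y0 = Suc.prems(7) and Y = Suc.prems(8)
  let ?W = "{-\<delta><..<\<delta>} \<times> S"
  have oW: "open ?W" using S by (auto intro: open_Times)
  have ak: "Ck_on k ?W (a i)" if "i \<in> Basis" for i using aS[OF that] by (rule Ck_on_SucD)
  have bk: "Ck_on k ?W b" using bS by (rule Ck_on_SucD)
  \<comment> \<open>The forcing term of the variational equation contains \<open>Y\<close> itself,
    so order \<open>k\<close> of \<open>Y\<close> is secured before its derivatives are
    examined.\<close>
  have Yk: "Ck_on k ?W Y" by (rule Suc.IH[OF \<delta> S ak bk K Y0 Y])
  have Yc: "continuous_on ?W Y" using Yk by (rule Ck_on_imp_continuous_on)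
  have ac: "continuous_on ?W (a i)" if "i \<in> Basis" for i using ak[OF that] by (rule Ck_on_imp_continuous_on)
  define da where "da i j z = frechet_derivative (a i) (at z) (0, j)" for i j z
  define db where "db j z = frechet_derivative b (at z) (0, j)" for j z
  have dak: "Ck_on k ?W (da i j)" if "i \<in> Basis" for i j using aS[OF that] by (simp add: da_def[abs_def])
  have dbk: "Ck_on k ?W (db j)" for j using bS by (simp add: db_def[abs_def])
  show ?case
  proof (rule Ck_on_local)
    fix z0 assume "z0 \<in> ?W"
    then obtain t0 p0 where z0: "z0 = (t0, p0)" "t0 \<in> {-\<delta><..<\<delta>}" "p0 \<in> S" by auto
    obtain r' where r': "r' > 0" "cball p0 r' \<subseteq> S" using S z0 open_contains_cball by blast
    \<comment> \<open>Half the radius is reserved for the base parameter and half for the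
      increment.\<close>
    define r where "r = r' / 2"
    have r: "r > 0" using r' by (simp add: r_def)
    have rS: "p + \<theta> *\<^sub>R w \<in> S" if "p \<in> cball p0 r" "w \<in> cball 0 r" "\<theta> \<in> {0..1}" for p w \<theta>
    proof -
      have "norm (\<theta> *\<^sub>R w) \<le> r" using that mult_left_le_one_le[of "norm w" \<theta>] by auto
      then have "dist p0 (p + \<theta> *\<^sub>R w) \<le> r + r" using that(1)
        by (smt (verit) dist_norm dist_triangle mem_cball add_diff_cancel_left' norm_minus_commute)
      then show ?thesis using r' by (auto simp: r_def)
    qed
    define d where "d = (\<bar>t0\<bar> + \<delta>) / 2"
    have d: "0 < d" "d < \<delta>" "\<bar>t0\<bar> < d" using z0 by (auto simp: d_def)
    have K0: "0 \<le> K"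
      using K[of "SOME i. i \<in> Basis" z0] z0 norm_ge_zero by (metis SOME_Basis mem_Sigma_iff order_trans)
    have dK: "d * (DIM('e) * K) \<le> 1/2"
      using \<delta> d K0 by (intro order.trans[OF mult_right_mono \<delta>(2)]) auto
    define C where "C = cball p0 r \<times> cball (0::'p) r"
    have C: "compact C" "convex C" "C \<noteq> {}" using r by (auto simp: C_def intro!: compact_Times convex_Times)
    \<comment> \<open>The segment from the parameter \<open>p\<close> to \<open>p + w\<close> at
      fixed time, run through by \<theta>; the value \<theta> = 1 is its far end.\<close>
    define m where "m = (\<lambda>(z::real \<times> 'p \<times> 'p, \<theta>::real). (fst z, fst (snd z) + \<theta> *\<^sub>R snd (snd z)))"
    have mc: "continuous_on X m" for X unfolding m_def split_beta by (intro continuous_intros)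
    have mW: "m ` (({-d..d} \<times> C) \<times> {0..1}) \<subseteq> ?W" using d rS by (auto simp: m_def C_def)
    have mW1: "m (z, 1) \<in> ?W" if "z \<in> {-d..d} \<times> C" for z
    proof -
      have "m (z, 1) \<in> m ` (({-d..d} \<times> C) \<times> {0..1})" using that by (intro imageI) simp
      then show ?thesis using mW by blast
    qed
    define DA where "DA i j z = integral {0..1} (\<lambda>\<theta>. da i j (m (z, \<theta>)))" for i j z
    define DB where "DB j z = integral {0..1} (\<lambda>\<theta>. db j (m (z, \<theta>)))" for j z
    have DAc: "continuous_on ({-d..d} \<times> C) (DA i j)" if "i \<in> Basis" for i j
      unfolding DA_def by (rule continuous_on_segment_integral[OF Ck_on_imp_continuous_on[OF dak[OF that]] mc mW])
    have DBc: "continuous_on ({-d..d} \<times> C) (DB j)" for j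
      unfolding DB_def by (rule continuous_on_segment_integral[OF Ck_on_imp_continuous_on[OF dbk] mc mW])
    define a' where "a' i z = a i (m (z, 1))" for i z
    have a'c: "continuous_on ({-d..d} \<times> C) (a' i)" if "i \<in> Basis" for i
      unfolding a'_def
    proof (rule continuous_on_compose2[OF ac[OF that], where f = "\<lambda>z. m (z, 1)"])
      show "continuous_on ({-d..d} \<times> C) (\<lambda>z. m (z, 1))"
        by (rule continuous_on_compose2[OF mc[of UNIV]]) (auto intro!: continuous_intros)
    qed (use mW1 in blast)
    have a'K: "norm (a' i z) \<le> K" if "i \<in> Basis" "z \<in> {-d..d} \<times> C" for i z
      unfolding a'_def using K[OF that(1) mW1[OF that(2)]] .
    \<comment> \<open>Subtracting the equations at \<open>p + w\<close> and \<open>p\<close>, the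
      matrix at \<open>p + w\<close> acts on the increment of \<open>Y\<close>, and the increments
      of \<open>a\<close> and \<open>b\<close> remain as forcing. \<open>b' j\<close> is the
      coefficient of w_j in that forcing.\<close>
    define b' where "b' j z = (\<Sum>i\<in>Basis. (Y (fst z, fst (snd z)) \<bullet> i) *\<^sub>R DA i j z) + DB j z" for j z
    have b'c: "continuous_on ({-d..d} \<times> C) (b' j)" for j
    proof -
      have "continuous_on ({-d..d} \<times> C) (\<lambda>z. Y (fst z, fst (snd z)))"
        by (rule continuous_on_compose2[OF Yc]) (use d rS[of _ 0 0] r in \<open>auto simp: C_def intro!: continuous_intros\<close>)
      then show ?thesis unfolding b'_def by (intro continuous_intros DAc DBc)
    qed
    define good where "good j Q \<longleftrightarrow> continuous_on UNIV Q \<and> (\<forall>p. Q (0, p) = 0) \<and> (\<forall>t\<in>{-d<..<d}. \<forall>p\<in>C.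
      ((\<lambda>t. Q (t, p)) has_vector_derivative (\<Sum>i\<in>Basis. (Q (t, p) \<bullet> i) *\<^sub>R a' i (t, p)) + b' j (t, p)) (at t))" for j Q
    have "\<exists>Q. good j Q" for j
    proof (rule linear_ode_exists[where ?y0.0 = 0, OF d(1) dK C a'c b'c[of j] a'K])
      fix Q assume "continuous_on UNIV Q" "\<And>p. Q (0, p) = 0"
        "\<And>t p. t \<in> {-d<..<d} \<Longrightarrow> p \<in> C \<Longrightarrow>
          ((\<lambda>t. Q (t, p)) has_vector_derivative (\<Sum>i\<in>Basis. (Q (t, p) \<bullet> i) *\<^sub>R a' i (t, p)) + b' j (t, p)) (at t)"
      then show "\<exists>Q. good j Q" unfolding good_def by blast
    qed
    then obtain Q where good: "\<And>j. good j (Q j)" by metis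
    have Qc: "\<And>j. continuous_on UNIV (Q j)" and Q0: "\<And>j p. Q j (0, p) = 0"
      and Q: "\<And>j t p. t \<in> {-d<..<d} \<Longrightarrow> p \<in> C \<Longrightarrow> ((\<lambda>t. Q j (t, p)) has_vector_derivative
         (\<Sum>i\<in>Basis. (Q j (t, p) \<bullet> i) *\<^sub>R a' i (t, p)) + b' j (t, p)) (at t)"
      using good unfolding good_def by blast+
    have inc: "f (t, p + w) = f (t, p) + (\<Sum>j\<in>Basis. (w \<bullet> j) *\<^sub>R integral {0..1} (\<lambda>\<theta>. frechet_derivative f (at (m ((t, p, w), \<theta>))) (0, j)))"
      if f: "Ck_on (Suc k) ?W f" and t: "t \<in> {-d<..<d}" and p: "(p, w) \<in> C" for f :: "real \<times> 'p \<Rightarrow> 'e" and t p w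
    proof -
      have "Ck_on (Suc 0) ?W f" using f by (rule Ck_on_le) simp
      from Ck1_difference_integral[OF this, of "(t, p)" "(0, w)"] show ?thesis
        using rS p t d by (simp add: sum_Basis_prod m_def C_def)
    qed
    \<comment> \<open>Both sides solve the same linear system in \<open>t\<close> with matrix taken
      at \<open>p + w\<close>, and both start at \<open>y0\<close>; uniqueness identifies
      them.\<close>
    have eq: "Y (t, p + w) = Y (t, p) + (\<Sum>j\<in>Basis. (w \<bullet> j) *\<^sub>R Q j (t, (p, w)))"
      if t: "t \<in> {-d<..<d}" and p: "(p, w) \<in> C" for t p w
    proof (rule linear_ode_unique[of d "\<lambda>t. Y (t, p + w)" "\<lambda>i t. a i (t, p + w)" "\<lambda>t. b (t, p + w)" _ K])
      have pS: "p + w \<in> S" "p \<in> S" using rS[of p w 1] rS[of p w 0] p by (auto simp: C_def)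
      fix t assume t: "t \<in> {-d<..<d}"
      then have t': "t \<in> {-\<delta><..<\<delta>}" using d by auto
      show "((\<lambda>t. Y (t, p + w)) has_vector_derivative (\<Sum>i\<in>Basis. (Y (t, p + w) \<bullet> i) *\<^sub>R a i (t, p + w)) + b (t, p + w)) (at t)"
        by (rule Y[OF t' pS(1)])
      have m1: "a' i (t, p, w) = a i (t, p + w)" for i by (simp add: a'_def m_def)
      have "((\<lambda>t. Y (t, p) + (\<Sum>j\<in>Basis. (w \<bullet> j) *\<^sub>R Q j (t, p, w))) has_vector_derivative
         ((\<Sum>i\<in>Basis. (Y (t, p) \<bullet> i) *\<^sub>R a i (t, p)) + b (t, p)) + (\<Sum>j\<in>Basis. (w \<bullet> j) *\<^sub>R ((\<Sum>i\<in>Basis. (Q j (t, p, w) \<bullet> i) *\<^sub>R a' i (t, p, w)) + b' j (t, p, w)))) (at t)"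
        by (intro has_vector_derivative_add has_vector_derivative_sum Y[OF t' pS(2)]
           bounded_linear.has_vector_derivative[OF bounded_linear_scaleR_right] Q t p)
      also have "((\<Sum>i\<in>Basis. (Y (t, p) \<bullet> i) *\<^sub>R a i (t, p)) + b (t, p)) + (\<Sum>j\<in>Basis. (w \<bullet> j) *\<^sub>R ((\<Sum>i\<in>Basis. (Q j (t, p, w) \<bullet> i) *\<^sub>R a' i (t, p, w)) + b' j (t, p, w)))
        = (\<Sum>i\<in>Basis. ((Y (t, p) + (\<Sum>j\<in>Basis. (w \<bullet> j) *\<^sub>R Q j (t, p, w))) \<bullet> i) *\<^sub>R a i (t, p + w)) + b (t, p + w)"
      proof -
        have e1: "(\<Sum>j\<in>Basis. (w \<bullet> j) *\<^sub>R (\<Sum>i\<in>Basis. (Q j (t, p, w) \<bullet> i) *\<^sub>R a i (t, p + w))) =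
            (\<Sum>i\<in>Basis. ((\<Sum>j\<in>Basis. (w \<bullet> j) *\<^sub>R Q j (t, p, w)) \<bullet> i) *\<^sub>R a i (t, p + w))"
          unfolding scaleR_sum_right inner_sum_left scaleR_sum_left by (subst sum.swap) simp
        have e2: "(\<Sum>j\<in>Basis. (w \<bullet> j) *\<^sub>R (\<Sum>i\<in>Basis. (Y (t, p) \<bullet> i) *\<^sub>R DA i j (t, p, w))) =
            (\<Sum>i\<in>Basis. (Y (t, p) \<bullet> i) *\<^sub>R (a i (t, p + w) - a i (t, p)))"
        proof -
          have "a i (t, p + w) - a i (t, p) = (\<Sum>j\<in>Basis. (w \<bullet> j) *\<^sub>R DA i j (t, p, w))" if "i \<in> Basis" for i
            using inc[OF aS[OF that] t p] by (simp add: DA_def da_def)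
          then show ?thesis 
            by (simp add: scaleR_sum_right) (subst sum.swap, simp add: mult.commute)
        qed
        have e3: "(\<Sum>j\<in>Basis. (w \<bullet> j) *\<^sub>R DB j (t, p, w)) = b (t, p + w) - b (t, p)"
          using inc[OF bS t p] by (simp add: DB_def db_def)
        show ?thesis
          unfolding b'_def m1 fst_conv snd_conv scaleR_add_right sum.distrib e1 e2 e3
          by (simp add: inner_add_left scaleR_add_left sum.distrib scaleR_diff_right sum_subtractf)
      qed
      finally show "((\<lambda>t. Y (t, p) + (\<Sum>j\<in>Basis. (w \<bullet> j) *\<^sub>R Q j (t, p, w))) has_vector_derivative \<dots>) (at t)" .
      show "norm (a i (t, p + w)) \<le> K" if "i \<in> Basis" for i using K[OF that] t' pS by auto
    next
      show "Y (0, p + w) = Y (0, p) + (\<Sum>j\<in>Basis. (w \<bullet> j) *\<^sub>R Q j (0, p, w))"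
        using Y0 Q0 rS[of p w 1] rS[of p w 0] p by (simp add: C_def)
    qed (rule t)
    let ?U = "{-d<..<d} \<times> ball p0 r"
    have UW: "?U \<subseteq> ?W" using d rS[of _ 0 0] r by auto
    have oU: "open ?U" by (auto intro: open_Times)
    let ?E = "\<lambda>z. (\<Sum>i\<in>Basis. (Y z \<bullet> i) *\<^sub>R a i z) + b z"
    \<comment> \<open>At increment 0 the segment means become the partial derivatives themselves,
      and the initial value is 0 because \<open>Y (0, p)\<close> does not depend on
      \<open>p\<close>.\<close>
    have Zk: "Ck_on k ?U (\<lambda>z. Q j (fst z, (snd z, 0)))" if "j \<in> Basis" for j
    proof (rule Suc.IH[OF d(1) dK, where a = a and b = "\<lambda>z. (\<Sum>i\<in>Basis. (Y z \<bullet> i) *\<^sub>R da i j z) + db j z" and ?y0.0 = 0])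
      show "Ck_on k ?U (a i)" if "i \<in> Basis" for i using ak[OF that] UW by (rule Ck_on_subset)
      have "Ck_on k ?W (\<lambda>z. (\<Sum>i\<in>Basis. (Y z \<bullet> i) *\<^sub>R da i j z) + db j z)"
        by (intro Ck_on_add Ck_on_sum Ck_on_bilinear[OF bounded_bilinear_scaleR] dak dbk oW
            Ck_on_bounded_linear[OF bounded_linear_inner_left] Yk)
      then show "Ck_on k ?U (\<lambda>z. (\<Sum>i\<in>Basis. (Y z \<bullet> i) *\<^sub>R da i j z) + db j z)"
        using UW by (rule Ck_on_subset)
      show "norm (a i z) \<le> K" if "i \<in> Basis" "z \<in> ?U" for i z using K UW that by blast
      fix t p assume t: "t \<in> {-d<..<d}" and p: "p \<in> ball p0 r"
      then have "(p, 0) \<in> C" using r by (auto simp: C_def)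
      from Q[OF t this, of j]
      show "((\<lambda>t. Q j (fst (t, p), snd (t, p), 0)) has_vector_derivative
            (\<Sum>i\<in>Basis. (Q j (fst (t, p), snd (t, p), 0) \<bullet> i) *\<^sub>R a i (t, p)) +
            ((\<Sum>i\<in>Basis. (Y (t, p) \<bullet> i) *\<^sub>R da i j (t, p)) + db j (t, p))) (at t)"
        by (simp add: a'_def b'_def DA_def DB_def m_def)
    qed (use Q0 in auto)
    have "Ck_on (Suc k) ?U Y"
    proof (rule Ck_on_SucI[OF oU])
      fix z assume "z \<in> ?U"
      then obtain t p where z: "z = (t, p)" "t \<in> {-d<..<d}" "p \<in> ball p0 r" by auto
      have "(Y has_derivative (\<lambda>v. fst v *\<^sub>R ?E (t, p) + (\<Sum>j\<in>Basis. (snd v \<bullet> j) *\<^sub>R Q j (t, (p, 0))))) (at (t, p))"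
      proof (rule factor_has_derivative[OF Y Qc open_greaterThanLessThan z(2) r])
        show "t \<in> {-\<delta><..<\<delta>}" "p \<in> S" using z UW by blast+
      qed (use eq z in \<open>auto simp: C_def\<close>)
      then show "(Y has_derivative (\<lambda>v. fst v *\<^sub>R ?E z + (\<Sum>j\<in>Basis. (snd v \<bullet> j) *\<^sub>R Q j (fst z, (snd z, 0))))) (at z)"
        by (simp add: z)
    next
      fix v :: "real \<times> 'p"
      have "Ck_on k ?W ?E"
        by (intro Ck_on_add Ck_on_sum Ck_on_bilinear[OF bounded_bilinear_scaleR] ak bk oW
            Ck_on_bounded_linear[OF bounded_linear_inner_left] Yk)
      then have "Ck_on k ?U ?E" using UW by (rule Ck_on_subset)
      then show "Ck_on k ?U (\<lambda>z. fst v *\<^sub>R ?E z + (\<Sum>j\<in>Basis. (snd v \<bullet> j) *\<^sub>R Q j (fst z, (snd z, 0))))"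
        by (intro Ck_on_add[OF Ck_on_bounded_linear[OF bounded_linear_scaleR_right]] Ck_on_sum
            Ck_on_bounded_linear[OF bounded_linear_scaleR_right] Zk oU)
    qed
    moreover have "z0 \<in> ?U" using z0 d r by auto
    ultimately show "\<exists>U. open U \<and> z0 \<in> U \<and> Ck_on (Suc k) U Y" using oU by blast
  qed
qed

section \<open>Local flows\<close>

text \<open>Convexity keeps segments inside \<open>C\<close> and compactness bounds the derivatives
  there. One constant \<open>K\<close> controls the derivatives, their means over segments and the
  Lipschitz quotient, so a single time step can serve both the nonlinear equation and its
  linearisations.\<close>

lemma smooth_increment:
  fixes f :: "'e::euclidean_space \<Rightarrow> 'e"
  assumes f: "smooth_on V f" and C: "compact C" "convex C" "C \<subseteq> V"
  obtains K :: real where "0 \<le> K" "\<And>i x. x \<in> C \<Longrightarrow> i \<in> Basis \<Longrightarrow> norm (frechet_derivative f (at x) i) \<le> K"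
    "\<And>x y. x \<in> C \<Longrightarrow> y \<in> C \<Longrightarrow> f y - f x =
      (\<Sum>i\<in>Basis. ((y - x) \<bullet> i) *\<^sub>R integral {0..1} (\<lambda>\<theta>. frechet_derivative f (at (x + \<theta> *\<^sub>R (y - x))) i))"
    "\<And>x y i. x \<in> C \<Longrightarrow> y \<in> C \<Longrightarrow> i \<in> Basis \<Longrightarrow>
      norm (integral {0..1} (\<lambda>\<theta>. frechet_derivative f (at (x + \<theta> *\<^sub>R (y - x))) i)) \<le> K"
    "\<And>x y. x \<in> C \<Longrightarrow> y \<in> C \<Longrightarrow> norm (f x - f y) \<le> (DIM('e) * K) * norm (x - y)"
proof -
  note CV = C(3)
  have fk: "Ck_on k V f" for k using f by (simp add: smooth_on_def)
  define D where "D i x = frechet_derivative f (at x) i" for i x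
  have Dk: "Ck_on k V (D i)" for k i using fk[of "Suc k"] by (simp add: D_def[abs_def])
  have Dc: "continuous_on V (D i)" for i using Dk by (rule Ck_on_imp_continuous_on)
  have "\<exists>B. \<forall>x\<in>C. norm (D i x) \<le> B" for i
  proof -
    have "compact (D i ` C)" using C continuous_on_subset[OF Dc CV] by (intro compact_continuous_image)
    from compact_imp_bounded[OF this] show ?thesis by (auto simp: bounded_iff)
  qed
  then obtain B where B: "\<And>i x. x \<in> C \<Longrightarrow> norm (D i x) \<le> B i" by metis
  define K where "K = (\<Sum>i\<in>(Basis::'e set). \<bar>B i\<bar>)"
  have K: "norm (D i x) \<le> K" if "x \<in> C" "i \<in> Basis" for i x
  proof -
    have "norm (D i x) \<le> \<bar>B i\<bar>" using B[OF that(1), of i] by simp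
    also have "\<dots> \<le> K" unfolding K_def using that by (intro member_le_sum) auto
    finally show ?thesis .
  qed
  have K0: "0 \<le> K" by (simp add: K_def sum_nonneg)
  have inc: "f y - f x = (\<Sum>i\<in>Basis. ((y - x) \<bullet> i) *\<^sub>R integral {0..1} (\<lambda>\<theta>. D i (x + \<theta> *\<^sub>R (y - x))))"
    and Dint: "\<And>i. i \<in> Basis \<Longrightarrow> norm (integral {0..1} (\<lambda>\<theta>. D i (x + \<theta> *\<^sub>R (y - x)))) \<le> K"
    if "x \<in> C" "y \<in> C" for x y
  proof -
    have seg: "x + \<theta> *\<^sub>R (y - x) \<in> C" if "\<theta> \<in> {0..1}" for \<theta>
      using convexD_alt[OF C(2) \<open>x \<in> C\<close> \<open>y \<in> C\<close>, of \<theta>] that by (simp add: algebra_simps)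
    show "f y - f x = (\<Sum>i\<in>Basis. ((y - x) \<bullet> i) *\<^sub>R integral {0..1} (\<lambda>\<theta>. D i (x + \<theta> *\<^sub>R (y - x))))"
    proof -
      have "f (x + (y - x)) = f x + (\<Sum>i\<in>Basis. ((y - x) \<bullet> i) *\<^sub>R integral {0..1} (\<lambda>\<theta>. D i (x + \<theta> *\<^sub>R (y - x))))"
        unfolding D_def by (rule Ck1_difference_integral[OF fk]) (use seg CV in blast)
      then show ?thesis by simp
    qed
    fix i :: 'e assume i: "i \<in> Basis"
    show "norm (integral {0..1} (\<lambda>\<theta>. D i (x + \<theta> *\<^sub>R (y - x)))) \<le> K"
    proof (rule norm_integral_le_unit)
      show "continuous_on {0..1} (\<lambda>\<theta>. D i (x + \<theta> *\<^sub>R (y - x)))"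
        by (rule continuous_on_compose2[OF Dc]) (use seg CV in \<open>auto intro!: continuous_intros\<close>)
    qed (use K seg i in auto)
  qed
  have lip: "norm (f x - f y) \<le> (DIM('e) * K) * norm (x - y)" if "x \<in> C" "y \<in> C" for x y
    unfolding inc[OF that(2,1)] by (rule linear_ode_bound) (rule Dint[OF that(2,1)])
  show thesis
    by (rule that[OF K0]) (use K inc Dint lip in \<open>auto simp: D_def\<close>)
qed

lemma smooth_locally_lipschitz:
  fixes f :: "'e::euclidean_space \<Rightarrow> 'e"
  assumes f: "smooth_on V f" "open V" "u \<in> V"
  obtains R L where "0 < R" "ball u R \<subseteq> V" "\<And>x y. x \<in> ball u R \<Longrightarrow> y \<in> ball u R \<Longrightarrow> norm (f x - f y) \<le> L * norm (x - y)"
proof -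
  obtain R where R: "R > 0" "cball u R \<subseteq> V" using f open_contains_cball by blast
  obtain K :: real where "\<And>x y. x \<in> cball u R \<Longrightarrow> y \<in> cball u R \<Longrightarrow> norm (f x - f y) \<le> (DIM('e) * K) * norm (x - y)"
    by (rule smooth_increment[OF f(1) compact_cball convex_cball R(2)]) blast
  then show thesis using that[of R "DIM('e) * K"] R by (meson ball_subset_cball subset_trans subsetD)
qed

text \<open>The increment of the flow between two initial values solves a homogeneous linear system
  whose matrix is the mean of Df over the segment joining the two trajectories. At increment 0 the
  matrix is Df along \<open>F\<close>, which is as smooth as \<open>F\<close> so far; the linear
  theory then makes the space derivatives of \<open>F\<close> equally smooth, and \<open>F\<close>
  gains one order.\<close>

lemma local_flow:
  fixes f :: "'e::euclidean_space \<Rightarrow> 'e"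
  assumes V: "open V" "u0 \<in> V" and f: "smooth_on V f"
  obtains \<delta> r F where "0 < \<delta>" "0 < r" "ball u0 r \<subseteq> V" "smooth_on ({-\<delta><..<\<delta>} \<times> ball u0 r) F"
    "\<And>u. F (0, u) = u" "\<And>z. z \<in> {-\<delta><..<\<delta>} \<times> ball u0 r \<Longrightarrow> F z \<in> V"
    "\<And>t u. t \<in> {-\<delta><..<\<delta>} \<Longrightarrow> u \<in> ball u0 r \<Longrightarrow>
      ((\<lambda>t. F (t, u)) has_vector_derivative f (F (t, u))) (at t)"
proof -
  obtain R where R: "R > 0" "cball u0 R \<subseteq> V" using V open_contains_cball by blast
  define C where "C = cball u0 R"
  have C: "compact C" "convex C" "closed C" "C \<noteq> {}" using R by (auto simp: C_def)
  have CV: "C \<subseteq> V" using R by (simp add: C_def)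
  have fk: "Ck_on k V f" for k using f by (simp add: smooth_on_def)
  define D where "D i x = frechet_derivative f (at x) i" for i x
  have Dk: "Ck_on k V (D i)" for k i using fk[of "Suc k"] by (simp add: D_def[abs_def])
  have Dc: "continuous_on V (D i)" for i using Dk by (rule Ck_on_imp_continuous_on)
  obtain K :: real where K0: "0 \<le> K" and K: "\<And>i x. x \<in> C \<Longrightarrow> i \<in> Basis \<Longrightarrow> norm (D i x) \<le> K"
    and inc: "\<And>x y. x \<in> C \<Longrightarrow> y \<in> C \<Longrightarrow> f y - f x =
      (\<Sum>i\<in>Basis. ((y - x) \<bullet> i) *\<^sub>R integral {0..1} (\<lambda>\<theta>. D i (x + \<theta> *\<^sub>R (y - x))))"
    and Dint: "\<And>x y i. x \<in> C \<Longrightarrow> y \<in> C \<Longrightarrow> i \<in> Basis \<Longrightarrow>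
      norm (integral {0..1} (\<lambda>\<theta>. D i (x + \<theta> *\<^sub>R (y - x)))) \<le> K"
    and lip': "\<And>x y. x \<in> C \<Longrightarrow> y \<in> C \<Longrightarrow> norm (f x - f y) \<le> (DIM('e) * K) * norm (x - y)"
    by (rule smooth_increment[OF f C(1,2) CV, folded D_def]) blast
  define L where "L = DIM('e) * K"
  have L0: "0 \<le> L" using K0 by (simp add: L_def)
  note lip = lip'[folded L_def]
  \<comment> \<open>The projection is 1-Lipschitz, so \<open>f\<close> composed with it is globally
    Lipschitz and bounded. The truncation disappears as long as the solution stays in
    \<open>C\<close>.\<close>
  define P where "P = closest_point C"
  have P: "P x \<in> C" "x \<in> C \<Longrightarrow> P x = x" for x
    unfolding P_def using C closest_point_in_set closest_point_self by auto
  have Pl: "norm (P x - P y) \<le> norm (x - y)" for x y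
    unfolding P_def using closest_point_lipschitz[of C x y] C by (simp add: dist_norm)
  have Pc: "continuous_on UNIV P" unfolding P_def by (intro continuous_on_closest_point C)
  have fP: "continuous_on UNIV (\<lambda>x. f (P x))"
    by (rule continuous_on_compose2[OF Ck_on_imp_continuous_on[OF fk] Pc]) (use P CV in auto)
  have "compact (f ` C)"
    using C continuous_on_subset[OF Ck_on_imp_continuous_on[OF fk] CV] by (intro compact_continuous_image)
  from compact_imp_bounded[OF this] obtain M where M: "\<And>x. x \<in> C \<Longrightarrow> norm (f x) \<le> M" by (auto simp: bounded_iff)
  \<comment> \<open>The summand 1 keeps the denominator positive when \<open>L = 0\<close>.\<close>
  define \<delta>0 where "\<delta>0 = 1 / (2 * (L + 1))"
  have \<delta>0: "0 < \<delta>0" "\<delta>0 * L \<le> 1/2" using L0 by (auto simp: \<delta>0_def field_simps)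
  have "norm (f (P (u + y)) - f (P (u + z))) \<le> L * norm (y - z)" for u y z
    using lip[OF P(1) P(1), of "u + y" "u + z"] mult_left_mono[OF Pl[of "u + y" "u + z"] L0] by simp
  moreover have "continuous_on UNIV (\<lambda>(t::real, u, y). f (P (u + y)))"
    unfolding split_beta by (rule continuous_on_compose2[OF fP]) (auto intro!: continuous_intros)
  ultimately obtain G where G: "continuous_on UNIV G" "\<And>u. G (0, u) = 0"
    "\<And>t u. \<bar>t\<bar> < \<delta>0 \<Longrightarrow> ((\<lambda>t. G (t, u)) has_vector_derivative f (P (u + G (t, u)))) (at t)"
    using picard_parametric[of "\<lambda>t u y. f (P (u + y))" M L \<delta>0] M[OF P(1)] \<delta>0 L0 by metis
  define F where "F z = snd z + G z" for z
  have Fc: "continuous_on X F" for X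
    unfolding F_def by (intro continuous_intros continuous_on_subset[OF G(1)]) auto
  have F0: "F (0, u) = u" for u by (simp add: F_def G)
  \<comment> \<open>Joint continuity at (0, u0) yields a product neighbourhood on which trajectories
    remain where the truncated field agrees with \<open>f\<close>.\<close>
  have "open (F -` ball u0 R)" by (rule open_vimage[OF open_ball Fc])
  moreover have "(0, u0) \<in> F -` ball u0 R" using R by (simp add: F0)
  ultimately obtain X Y where XY: "open X" "open Y" "(0, u0) \<in> X \<times> Y" "X \<times> Y \<subseteq> F -` ball u0 R"
    by (rule open_prod_elim)
  from XY obtain \<delta>1 where \<delta>1: "\<delta>1 > 0" "ball 0 \<delta>1 \<subseteq> X" using open_contains_ball by blast
  from XY have "open (Y \<inter> V)" "u0 \<in> Y \<inter> V" using V by auto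
  then obtain r where r: "r > 0" "ball u0 r \<subseteq> Y \<inter> V" using open_contains_ball by blast
  define \<delta> where "\<delta> = min \<delta>0 \<delta>1"
  have \<delta>: "0 < \<delta>" "\<delta> \<le> \<delta>0" "\<delta> \<le> \<delta>1" using \<delta>0 \<delta>1 by (auto simp: \<delta>_def)
  have \<delta>K: "\<delta> * (DIM('e) * K) \<le> 1/2" using mult_right_mono[OF \<delta>(2) L0] \<delta>0(2) unfolding L_def by linarith
  let ?W = "{-\<delta><..<\<delta>} \<times> ball u0 r"
  have oW: "open ?W" by (auto intro: open_Times)
  have "?W \<subseteq> X \<times> Y" using \<delta>1 r \<delta> by (auto simp: subset_iff)
  then have FB: "F z \<in> ball u0 R" if "z \<in> ?W" for z using XY(4) that by blast
  then have FC: "F z \<in> C" if "z \<in> ?W" for z using that by (auto simp: C_def less_imp_le)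
  have ode: "((\<lambda>t. F (t, u)) has_vector_derivative f (F (t, u))) (at t)"
    if "t \<in> {-\<delta><..<\<delta>}" "u \<in> ball u0 r" for t u
  proof -
    have "P (F (t, u)) = F (t, u)" using FC that by (intro P) (simp add: mem_Times_iff)
    then show ?thesis
      using has_vector_derivative_add[OF has_vector_derivative_const G(3), of t u u] that \<delta> by (auto simp: F_def)
  qed
  \<comment> \<open>The matrix of the variational equation along \<open>F\<close>.\<close>
  define A where "A i z = D i (F z)" for i z
  have AK: "norm (A i z) \<le> K" if "i \<in> Basis" "z \<in> ?W" for i z using K FC that by (simp add: A_def)
  have "Ck_on k ?W F" for k
  proof (induction k)
    case 0 then show ?case by (simp add: Fc)
  next
    case (Suc k)
    have Ak: "Ck_on k ?W (A i)" for i
      unfolding A_def by (rule Ck_on_compose[OF Suc Dk _ oW]) (use FC CV in auto)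
    show ?case
    proof (rule Ck_on_local)
      fix z0 assume "z0 \<in> ?W"
      then obtain t0 p0 where z0: "z0 = (t0, p0)" "t0 \<in> {-\<delta><..<\<delta>}" "p0 \<in> ball u0 r" by blast
      then obtain \<rho>' where \<rho>': "\<rho>' > 0" "cball p0 \<rho>' \<subseteq> ball u0 r" using open_contains_cball[of "ball u0 r"] by blast
      define \<rho> where "\<rho> = \<rho>' / 2"
      have \<rho>: "\<rho> > 0" using \<rho>' by (simp add: \<rho>_def)
      have \<rho>S: "p + w \<in> ball u0 r" if "p \<in> cball p0 \<rho>" "w \<in> cball 0 \<rho>" for p w
      proof -
        have "dist p0 (p + w) \<le> \<rho> + \<rho>" using that
          by (smt (verit) dist_norm dist_triangle mem_cball add_diff_cancel_left' norm_minus_commute dist_0_norm)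
        then show ?thesis using \<rho>' by (auto simp: \<rho>_def)
      qed
      define d where "d = (\<bar>t0\<bar> + \<delta>) / 2"
      have d: "0 < d" "d < \<delta>" "\<bar>t0\<bar> < d" using z0 by (auto simp: d_def)
      have dK: "d * (DIM('e) * K) \<le> 1/2"
        using \<delta>K d K0 by (intro order.trans[OF mult_right_mono \<delta>K]) auto
      define C' where "C' = cball p0 \<rho> \<times> cball (0::'e) \<rho>"
      have C': "compact C'" "convex C'" "C' \<noteq> {}" using \<rho> by (auto simp: C'_def intro!: compact_Times convex_Times)
      have C'F: "F (t, p) \<in> C" "F (t, p + w) \<in> C" if "t \<in> {-d..d}" "(p, w) \<in> C'" for t p w
        using that \<rho>S[of p w] \<rho>S[of p 0] d \<rho> by (auto intro!: FC simp: C'_def)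
      \<comment> \<open>Here the segment joins the two trajectories in phase space; convexity of
        \<open>C\<close> keeps it in the domain of \<open>f\<close>.\<close>
      define m where "m = (\<lambda>(z::real \<times> 'e \<times> 'e, \<theta>::real). F (fst z, fst (snd z)) +
          \<theta> *\<^sub>R (F (fst z, fst (snd z) + snd (snd z)) - F (fst z, fst (snd z))))"
      have mc: "continuous_on X m" for X
        unfolding m_def split_beta by (intro continuous_intros continuous_on_compose2[OF Fc[of UNIV]]) auto
      have mW: "m ` (({-d..d} \<times> C') \<times> {0..1}) \<subseteq> V"
      proof clarify
        fix t p w \<theta> assume "t \<in> {-d..d}" "(p, w) \<in> C'" "\<theta> \<in> {0..1::real}"
        then show "m ((t, p, w), \<theta>) \<in> V"
          using convexD_alt[OF C(2) C'F[of t p w], of \<theta>] CV by (auto simp: m_def algebra_simps)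
      qed
      define a where "a i z = integral {0..1} (\<lambda>\<theta>. D i (m (z, \<theta>)))" for i z
      have ac: "continuous_on ({-d..d} \<times> C') (a i)" for i
        unfolding a_def by (rule continuous_on_segment_integral[OF Dc mc mW])
      have aK: "norm (a i z) \<le> K" if i: "i \<in> Basis" and z: "z \<in> {-d..d} \<times> C'" for i z
      proof -
        obtain t p w where z': "z = (t, p, w)" "t \<in> {-d..d}" "(p, w) \<in> C'" using z by auto
        show ?thesis unfolding a_def z' m_def using Dint[OF C'F[OF z'(2,3)] i] by simp
      qed
      define good where "good j Q \<longleftrightarrow> continuous_on UNIV Q \<and> (\<forall>p. Q (0, p) = j) \<and> (\<forall>t\<in>{-d<..<d}. \<forall>p\<in>C'.
        ((\<lambda>t. Q (t, p)) has_vector_derivative (\<Sum>i\<in>Basis. (Q (t, p) \<bullet> i) *\<^sub>R a i (t, p)) + 0) (at t))" for j Q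
      have "\<exists>Q. good j Q" for j
      proof (rule linear_ode_exists[where ?y0.0 = j, OF d(1) dK C' ac continuous_on_const[of _ 0] aK])
        fix Q assume "continuous_on UNIV Q" "\<And>p. Q (0, p) = j"
          "\<And>t p. t \<in> {-d<..<d} \<Longrightarrow> p \<in> C' \<Longrightarrow>
            ((\<lambda>t. Q (t, p)) has_vector_derivative (\<Sum>i\<in>Basis. (Q (t, p) \<bullet> i) *\<^sub>R a i (t, p)) + 0) (at t)"
        then show "\<exists>Q. good j Q" unfolding good_def by blast
      qed
      then obtain Q where good: "\<And>j. good j (Q j)" by metis
      have Qc: "\<And>j. continuous_on UNIV (Q j)" and Q0: "\<And>j p. Q j (0, p) = j"
        and Q: "\<And>j t p. t \<in> {-d<..<d} \<Longrightarrow> p \<in> C' \<Longrightarrow> ((\<lambda>t. Q j (t, p)) has_vector_derivative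
           (\<Sum>i\<in>Basis. (Q j (t, p) \<bullet> i) *\<^sub>R a i (t, p)) + 0) (at t)"
        using good unfolding good_def by blast+
      have eq: "F (t, p + w) = F (t, p) + (\<Sum>j\<in>Basis. (w \<bullet> j) *\<^sub>R Q j (t, (p, w)))"
        if t: "t \<in> {-d<..<d}" and p: "(p, w) \<in> C'" for t p w
      proof -
        \<comment> \<open>Both sides solve the homogeneous system with the mean matrix. At time 0
          both equal \<open>w\<close>, since \<open>Q j\<close> starts at the basis vector
          \<open>j\<close>.\<close>
        have "F (t, p + w) - F (t, p) = (\<Sum>j\<in>Basis. (w \<bullet> j) *\<^sub>R Q j (t, (p, w)))"
        proof (rule linear_ode_unique[of d "\<lambda>t. F (t, p + w) - F (t, p)" "\<lambda>i t. a i (t, p, w)" "\<lambda>t. 0" _ K])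
          have pS: "p + w \<in> ball u0 r" "p \<in> ball u0 r" using \<rho>S[of p w] \<rho>S[of p 0] p \<rho> by (auto simp: C'_def)
          fix t assume t: "t \<in> {-d<..<d}"
          then have t': "t \<in> {-\<delta><..<\<delta>}" "t \<in> {-d..d}" using d by auto
          show "((\<lambda>t. F (t, p + w) - F (t, p)) has_vector_derivative
              (\<Sum>i\<in>Basis. ((F (t, p + w) - F (t, p)) \<bullet> i) *\<^sub>R a i (t, p, w)) + 0) (at t)"
            using has_vector_derivative_diff[OF ode[OF t'(1) pS(1)] ode[OF t'(1) pS(2)]]
              inc[OF C'F[OF t'(2) p]] by (simp add: a_def m_def)
          have "((\<lambda>t. \<Sum>j\<in>Basis. (w \<bullet> j) *\<^sub>R Q j (t, p, w)) has_vector_derivative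
              (\<Sum>j\<in>Basis. (w \<bullet> j) *\<^sub>R ((\<Sum>i\<in>Basis. (Q j (t, p, w) \<bullet> i) *\<^sub>R a i (t, p, w)) + 0))) (at t)"
            by (intro has_vector_derivative_sum bounded_linear.has_vector_derivative[OF bounded_linear_scaleR_right] Q t p)
          also have "(\<Sum>j\<in>Basis. (w \<bullet> j) *\<^sub>R ((\<Sum>i\<in>Basis. (Q j (t, p, w) \<bullet> i) *\<^sub>R a i (t, p, w)) + 0)) =
              (\<Sum>i\<in>Basis. ((\<Sum>j\<in>Basis. (w \<bullet> j) *\<^sub>R Q j (t, p, w)) \<bullet> i) *\<^sub>R a i (t, p, w)) + 0"
            unfolding scaleR_sum_right inner_sum_left scaleR_sum_left add_0_right by (subst sum.swap) simp
          finally show "((\<lambda>t. \<Sum>j\<in>Basis. (w \<bullet> j) *\<^sub>R Q j (t, p, w)) has_vector_derivative \<dots>) (at t)" .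
          show "norm (a i (t, p, w)) \<le> K" if "i \<in> Basis" for i using aK[OF that] t' p by auto
        qed (use t in \<open>auto simp: F0 Q0 euclidean_representation\<close>)
        then show ?thesis by (simp add: algebra_simps)
      qed
      let ?U = "{-d<..<d} \<times> ball p0 \<rho>"
      have UW: "?U \<subseteq> ?W" using d \<rho>S[of _ 0] \<rho> by (auto simp: dist_commute)
      have oU: "open ?U" by (auto intro: open_Times)
      have Zk: "Ck_on k ?U (\<lambda>z. Q j (fst z, (snd z, 0)))" for j
      proof (rule linear_ode_Ck[OF d(1) dK, where a = A and b = "\<lambda>z. 0" and ?y0.0 = j])
        show "Ck_on k ?U (A i)" for i using Ak UW by (rule Ck_on_subset)
        show "norm (A i z) \<le> K" if "i \<in> Basis" "z \<in> ?U" for i z using AK UW that by blast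
        fix t p assume t: "t \<in> {-d<..<d}" and p: "p \<in> ball p0 \<rho>"
        then have "(p, 0) \<in> C'" using \<rho> by (auto simp: C'_def)
        from Q[OF t this, of j]
        show "((\<lambda>t. Q j (fst (t, p), snd (t, p), 0)) has_vector_derivative
            (\<Sum>i\<in>Basis. (Q j (fst (t, p), snd (t, p), 0) \<bullet> i) *\<^sub>R A i (t, p)) + 0) (at t)"
          by (simp add: a_def A_def m_def)
      qed (use Q0 in \<open>auto intro: Ck_on_const\<close>)
      have "Ck_on (Suc k) ?U F"
      proof (rule Ck_on_SucI[OF oU])
        fix z assume "z \<in> ?U"
        then obtain t p where z: "z = (t, p)" "t \<in> {-d<..<d}" "p \<in> ball p0 \<rho>" by auto
        have "(F has_derivative (\<lambda>v. fst v *\<^sub>R f (F (t, p)) + (\<Sum>j\<in>Basis. (snd v \<bullet> j) *\<^sub>R Q j (t, (p, 0))))) (at (t, p))"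
        proof (rule factor_has_derivative[OF ode Qc open_greaterThanLessThan z(2) \<rho>])
          show "t \<in> {-\<delta><..<\<delta>}" "p \<in> ball u0 r" using z UW by blast+
        qed (use eq z in \<open>auto simp: C'_def\<close>)
        then show "(F has_derivative (\<lambda>v. fst v *\<^sub>R f (F z) + (\<Sum>j\<in>Basis. (snd v \<bullet> j) *\<^sub>R Q j (fst z, (snd z, 0))))) (at z)"
          by (simp add: z)
      next
        fix v :: "real \<times> 'e"
        have "Ck_on k ?W (\<lambda>z. f (F z))" by (rule Ck_on_compose[OF Suc fk _ oW]) (use FC CV in auto)
        then have "Ck_on k ?U (\<lambda>z. f (F z))" using UW by (rule Ck_on_subset)
        then show "Ck_on k ?U (\<lambda>z. fst v *\<^sub>R f (F z) + (\<Sum>j\<in>Basis. (snd v \<bullet> j) *\<^sub>R Q j (fst z, (snd z, 0))))"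
          by (intro Ck_on_add[OF Ck_on_bounded_linear[OF bounded_linear_scaleR_right]] Ck_on_sum
              Ck_on_bounded_linear[OF bounded_linear_scaleR_right] Zk oU)
      qed
      moreover have "z0 \<in> ?U" using z0 d \<rho> by auto
      ultimately show "\<exists>U. open U \<and> z0 \<in> U \<and> Ck_on (Suc k) U F" using oU by blast
    qed
  qed
  then have "smooth_on ?W F" by (simp add: smooth_on_def)
  moreover have "F z \<in> V" if "z \<in> ?W" for z using FC[OF that] CV by auto
  ultimately show thesis using that[of \<delta> r F] \<delta>(1) r F0 ode by blast
qed

section \<open>Symmetry of second derivatives, implicit functions, Hadamard's lemma, bump functions\<close>

text \<open>The second difference is symmetric in \<open>v\<close> and \<open>w\<close>, while two
  applications of the mean value theorem expose the mixed derivative in a prescribed order.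
  Comparing the two orders gives the symmetry.\<close>

lemma second_difference_mvt:
  fixes f :: "'a::euclidean_space \<Rightarrow> real"
  assumes f: "smooth_on S f" and h: "0 < h"
    and seg: "\<And>s t. s \<in> {0..h} \<Longrightarrow> t \<in> {0..h} \<Longrightarrow> x + s *\<^sub>R v + t *\<^sub>R w \<in> S"
  shows "\<exists>s\<in>{0..h}. \<exists>t\<in>{0..h}. f (x + h *\<^sub>R v + h *\<^sub>R w) - f (x + h *\<^sub>R v) - f (x + h *\<^sub>R w) + f x
    = h * (h * frechet_derivative (\<lambda>y. frechet_derivative f (at y) v) (at (x + s *\<^sub>R v + t *\<^sub>R w)) w)"
proof -
  have d1: "((\<lambda>s. f (x + s *\<^sub>R v + t *\<^sub>R w)) has_real_derivative
      frechet_derivative f (at (x + s *\<^sub>R v + t *\<^sub>R w)) v) (at s)"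
    if "s \<in> {0..h}" "t \<in> {0..h}" for s t
  proof -
    have "((\<lambda>s. x + s *\<^sub>R v + t *\<^sub>R w) has_derivative (\<lambda>r. r *\<^sub>R v)) (at s)"
      by (auto intro!: derivative_eq_intros)
    from has_derivative_compose[OF this smooth_on_has_derivative[OF f seg[OF that]]]
    show ?thesis unfolding has_field_derivative_def
      by (rule has_derivative_eq_rhs)
        (simp add: fun_eq_iff linear_scale[OF linear_frechet_derivative[OF smooth_on_differentiable[OF f seg[OF that]]]])
  qed
  let ?g = "\<lambda>y. frechet_derivative f (at y) v"
  have g: "smooth_on S ?g" using f by (rule smooth_on_derivative)
  have d2: "((\<lambda>t. ?g (x + s *\<^sub>R v + t *\<^sub>R w)) has_real_derivative
      frechet_derivative ?g (at (x + s *\<^sub>R v + t *\<^sub>R w)) w) (at t)"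
    if "s \<in> {0..h}" "t \<in> {0..h}" for s t
  proof -
    have "((\<lambda>t. x + s *\<^sub>R v + t *\<^sub>R w) has_derivative (\<lambda>r. r *\<^sub>R w)) (at t)"
      by (auto intro!: derivative_eq_intros)
    from has_derivative_compose[OF this smooth_on_has_derivative[OF g seg[OF that]]]
    show ?thesis unfolding has_field_derivative_def
      by (rule has_derivative_eq_rhs)
        (simp add: fun_eq_iff linear_scale[OF linear_frechet_derivative[OF smooth_on_differentiable[OF g seg[OF that]]]])
  qed
  have "\<exists>s. 0 < s \<and> s < h \<and> (f (x + h *\<^sub>R v + h *\<^sub>R w) - f (x + h *\<^sub>R v + 0 *\<^sub>R w))
      - (f (x + 0 *\<^sub>R v + h *\<^sub>R w) - f (x + 0 *\<^sub>R v + 0 *\<^sub>R w))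
      = (h - 0) * (?g (x + s *\<^sub>R v + h *\<^sub>R w) - ?g (x + s *\<^sub>R v + 0 *\<^sub>R w))"
    by (rule MVT2[OF h]) (use d1[of _ 0] d1[of _ h] h in \<open>auto intro!: DERIV_diff\<close>)
  then obtain s where s: "0 < s" "s < h" and e1: "f (x + h *\<^sub>R v + h *\<^sub>R w) - f (x + h *\<^sub>R v) - f (x + h *\<^sub>R w) + f x
      = h * (?g (x + s *\<^sub>R v + h *\<^sub>R w) - ?g (x + s *\<^sub>R v + 0 *\<^sub>R w))" by auto
  have "\<exists>t. 0 < t \<and> t < h \<and> ?g (x + s *\<^sub>R v + h *\<^sub>R w) - ?g (x + s *\<^sub>R v + 0 *\<^sub>R w)
      = (h - 0) * frechet_derivative ?g (at (x + s *\<^sub>R v + t *\<^sub>R w)) w"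
    by (rule MVT2[OF h]) (use s in \<open>auto intro!: d2\<close>)
  then obtain t where "0 < t" "t < h" "?g (x + s *\<^sub>R v + h *\<^sub>R w) - ?g (x + s *\<^sub>R v + 0 *\<^sub>R w)
      = h * frechet_derivative ?g (at (x + s *\<^sub>R v + t *\<^sub>R w)) w" by auto
  with e1 s show ?thesis by (intro bexI[of _ s] bexI[of _ t]) auto
qed

lemma second_derivative_symmetric_real:
  fixes f :: "'a::euclidean_space \<Rightarrow> real"
  assumes S: "open S" "x \<in> S" and f: "smooth_on S f"
  shows "frechet_derivative (\<lambda>y. frechet_derivative f (at y) v) (at x) w =
    frechet_derivative (\<lambda>y. frechet_derivative f (at y) w) (at x) v"
proof (rule ccontr)
  define g where "g v w y = frechet_derivative (\<lambda>y. frechet_derivative f (at y) v) (at y) w" for v w y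
  assume "\<not> ?thesis"
  then have e: "0 < \<bar>g v w x - g w v x\<bar> / 2" (is "0 < ?e") by (simp add: g_def)
  have "isCont (g v w) x" for v w
    using smooth_on_continuous[OF smooth_on_derivative[OF smooth_on_derivative[OF f]]] S
    unfolding g_def[abs_def] continuous_on_eq_continuous_at[OF S(1)] by blast
  then have "\<exists>d>0. \<forall>y. dist y x < d \<longrightarrow> dist (g v w y) (g v w x) < ?e" for v w
    using e unfolding continuous_at_eps_delta by blast
  then obtain d where d: "\<And>v w. d v w > 0" "\<And>v w y. dist y x < d v w \<Longrightarrow> dist (g v w y) (g v w x) < ?e"
    by metis
  obtain d0 where d0: "d0 > 0" "ball x d0 \<subseteq> S" using S open_contains_ball by blast
  define D where "D = Min {d v w, d w v, d0}"
  have D: "D > 0" "D \<le> d v w" "D \<le> d w v" "D \<le> d0" using d d0 by (auto simp: D_def)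
  \<comment> \<open>With this step the parallelogram stays within \<open>D / 2\<close> of
    \<open>x\<close>; the summand 1 covers the case that both vectors vanish.\<close>
  define h where "h = D / (2 * (norm v + norm w + 1))"
  have h: "0 < h" using D by (auto simp: h_def intro!: divide_pos_pos add_nonneg_pos)
  have near: "dist (x + s *\<^sub>R v + t *\<^sub>R w) x < D" if "s \<in> {0..h}" "t \<in> {0..h}" for s t
  proof -
    have "norm (s *\<^sub>R v + t *\<^sub>R w) \<le> h * norm v + h * norm w"
      using that by (intro order.trans[OF norm_triangle_ineq] add_mono) (auto intro!: mult_right_mono)
    also have "\<dots> \<le> h * (norm v + norm w + 1)" using h by (simp add: algebra_simps)
    also have "\<dots> = D / 2" by (simp add: h_def field_simps add_nonneg_eq_0_iff)
    finally show ?thesis using D by (simp add: dist_norm add.assoc)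
  qed
  then have seg: "x + s *\<^sub>R v + t *\<^sub>R w \<in> S" if "s \<in> {0..h}" "t \<in> {0..h}" for s t
    using that d0 D by (force simp: dist_commute)
  obtain s t where st: "s \<in> {0..h}" "t \<in> {0..h}"
    "f (x + h *\<^sub>R v + h *\<^sub>R w) - f (x + h *\<^sub>R v) - f (x + h *\<^sub>R w) + f x = h * (h * g v w (x + s *\<^sub>R v + t *\<^sub>R w))"
    using second_difference_mvt[OF f h seg] unfolding g_def by blast
  have seg': "x + s *\<^sub>R w + t *\<^sub>R v \<in> S" if "s \<in> {0..h}" "t \<in> {0..h}" for s t
    using seg[OF that(2,1)] by (simp add: algebra_simps)
  obtain s' t' where st': "s' \<in> {0..h}" "t' \<in> {0..h}"
    "f (x + h *\<^sub>R w + h *\<^sub>R v) - f (x + h *\<^sub>R w) - f (x + h *\<^sub>R v) + f x = h * (h * g w v (x + s' *\<^sub>R w + t' *\<^sub>R v))"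
    using second_difference_mvt[OF f h seg'] unfolding g_def by blast
  \<comment> \<open>The two mixed derivatives, each at its own intermediate point, represent the
    same second difference.\<close>
  have "h * (h * g v w (x + s *\<^sub>R v + t *\<^sub>R w)) = h * (h * g w v (x + s' *\<^sub>R w + t' *\<^sub>R v))"
    unfolding st(3)[symmetric] st'(3)[symmetric] by (simp add: algebra_simps)
  then have eq: "g v w (x + s *\<^sub>R v + t *\<^sub>R w) = g w v (x + t' *\<^sub>R v + s' *\<^sub>R w)" using h by (simp add: algebra_simps)
  have "dist (g v w (x + s *\<^sub>R v + t *\<^sub>R w)) (g v w x) < ?e"
    using near[OF st(1,2)] D by (intro d) auto
  moreover have "dist (g w v (x + t' *\<^sub>R v + s' *\<^sub>R w)) (g w v x) < ?e"
    using near[OF st'(2,1)] D by (intro d) auto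
  ultimately have "\<bar>g v w x - g w v x\<bar> < ?e + ?e" unfolding eq dist_real_def by linarith
  then show False by simp
qed

lemma frechet_derivative_inner:
  fixes f :: "'a::euclidean_space \<Rightarrow> 'b::euclidean_space"
  assumes "f differentiable (at x)"
  shows "frechet_derivative (\<lambda>y. f y \<bullet> b) (at x) v = frechet_derivative f (at x) v \<bullet> b"
proof -
  have "((\<lambda>y. f y \<bullet> b) has_derivative (\<lambda>v. frechet_derivative f (at x) v \<bullet> b)) (at x)"
    using assms frechet_derivative_works by (intro has_derivative_inner_left) blast
  then show ?thesis using frechet_derivative_at by metis
qed

lemma second_derivative_symmetric:
  fixes f :: "'a::euclidean_space \<Rightarrow> 'b::euclidean_space"
  assumes S: "open S" "x \<in> S" and f: "smooth_on S f"
  shows "frechet_derivative (\<lambda>y. frechet_derivative f (at y) v) (at x) w =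
    frechet_derivative (\<lambda>y. frechet_derivative f (at y) w) (at x) v"
proof (rule euclidean_eqI)
  fix b :: 'b
  have fb: "smooth_on S (\<lambda>y. f y \<bullet> b)" using f S by (intro smooth_on_inner_left)
  have eq: "frechet_derivative (\<lambda>y. frechet_derivative (\<lambda>y. f y \<bullet> b) (at y) v) (at x) w =
      frechet_derivative (\<lambda>y. frechet_derivative f (at y) v) (at x) w \<bullet> b" for v w
  proof -
    have "frechet_derivative (\<lambda>y. frechet_derivative f (at y) v \<bullet> b) (at x) =
        frechet_derivative (\<lambda>y. frechet_derivative (\<lambda>y. f y \<bullet> b) (at y) v) (at x)"
      by (rule frechet_derivative_transform_within_open[OF _ S])
        (use smooth_on_differentiable[OF smooth_on_inner_left[OF smooth_on_derivative[OF f] S(1)] S(2)]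
           frechet_derivative_inner[OF smooth_on_differentiable[OF f]] in auto)
    then show ?thesis
      using frechet_derivative_inner[OF smooth_on_differentiable[OF smooth_on_derivative[OF f] S(2)]] by metis
  qed
  show "frechet_derivative (\<lambda>y. frechet_derivative f (at y) v) (at x) w \<bullet> b =
    frechet_derivative (\<lambda>y. frechet_derivative f (at y) w) (at x) v \<bullet> b"
    using second_derivative_symmetric_real[OF S fb, of v w] unfolding eq .
qed

section \<open>Implicit functions\<close>

text \<open>\<open>G\<close> vanishes at both ends of the segment between two points of the graph,
  so its factorised increment is a linear relation between the increments of \<tau> and of
  \<open>p\<close>; dividing by the coefficient of the former gives Caratheodory's factorisation for
  \<tau>. The resulting formula expresses the derivative through \<tau> itself and raises the order
  step by step, starting from the assumed continuity.\<close>

lemma implicit_scalar_smooth: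
  fixes G :: "real \<times> 'p::euclidean_space \<Rightarrow> real"
  assumes W: "open W" and G: "smooth_on W G" and S: "open S"
    and \<tau>: "continuous_on S \<tau>" "\<And>p. p \<in> S \<Longrightarrow> (\<tau> p, p) \<in> W" "\<And>p. p \<in> S \<Longrightarrow> G (\<tau> p, p) = 0"
    and nz: "\<And>p. p \<in> S \<Longrightarrow> frechet_derivative G (at (\<tau> p, p)) (1, 0) \<noteq> 0"
  shows "smooth_on S \<tau>"
proof -
  let ?D = "\<lambda>z. frechet_derivative G (at z)"
  have der: "(\<tau> has_derivative (\<lambda>v. \<Sum>j\<in>Basis. (v \<bullet> j) *\<^sub>R (- ?D (\<tau> p0, p0) (0, j) / ?D (\<tau> p0, p0) (1, 0)))) (at p0)"
    if p0: "p0 \<in> S" for p0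
  proof -
    define z0 where "z0 = (\<tau> p0, p0)"
    obtain e where e: "e > 0" "ball z0 e \<subseteq> W" using W \<tau>(2)[OF p0] open_contains_ball unfolding z0_def by blast
    have zc: "continuous_on S (\<lambda>p. (\<tau> p, p))" by (intro continuous_intros \<tau>)
    define N where "N = S \<inter> (\<lambda>p. (\<tau> p, p)) -` ball z0 e"
    have oN: "open N" unfolding N_def by (rule continuous_open_preimage[OF zc S open_ball])
    have p0N: "p0 \<in> N" using p0 e by (simp add: N_def z0_def)
    have zN: "(\<tau> p, p) \<in> ball z0 e" if "p \<in> N" for p using that by (simp add: N_def)
    define m where "m = (\<lambda>(p, \<theta>). z0 + \<theta> *\<^sub>R ((\<tau> p, p) - z0))"
    have mc: "continuous_on (N \<times> {0..1}) m"
      unfolding m_def split_beta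
      by (intro continuous_intros continuous_on_compose2[OF \<tau>(1)]) (auto simp: N_def)
    have mW: "m (p, \<theta>) \<in> W" if "p \<in> N" "\<theta> \<in> {0..1}" for p \<theta>
    proof -
      have "(1 - \<theta>) *\<^sub>R z0 + \<theta> *\<^sub>R (\<tau> p, p) \<in> ball z0 e"
        using convexD_alt[OF convex_ball, of z0 z0 e "(\<tau> p, p)" \<theta>] zN[OF that(1)] that(2) e by auto
      moreover have "(1 - \<theta>) *\<^sub>R z0 + \<theta> *\<^sub>R (\<tau> p, p) = m (p, \<theta>)" by (simp add: m_def algebra_simps)
      ultimately show ?thesis using e by auto
    qed
    define q where "q i p = integral {0..1} (\<lambda>\<theta>. ?D (m (p, \<theta>)) i)" for i p
    have qc: "continuous_on N (q i)" for i
      unfolding q_def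
      by (rule continuous_on_segment_integral[OF smooth_on_continuous[OF smooth_on_derivative[OF G]] mc])
        (use mW in auto)
    have q0: "q i p0 = ?D z0 i" for i by (simp add: q_def m_def z0_def)
    have qt: "(q i \<longlongrightarrow> ?D z0 i) (at p0)" for i
      using qc oN p0N q0 by (metis continuous_on_eq_continuous_at isCont_def)
    have e0: "0 = (\<Sum>i\<in>Basis. (((\<tau> p, p) - z0) \<bullet> i) *\<^sub>R q i p)" if "p \<in> N" for p
    proof -
      have "G (z0 + ((\<tau> p, p) - z0)) = G z0 + (\<Sum>i\<in>Basis. (((\<tau> p, p) - z0) \<bullet> i) *\<^sub>R q i p)"
        unfolding q_def m_def split_conv
      proof (rule Ck1_difference_integral[where S = W])
        show "Ck_on (Suc 0) W G" using G unfolding smooth_on_def by blast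
        show "z0 + \<theta> *\<^sub>R ((\<tau> p, p) - z0) \<in> W" if "\<theta> \<in> {0..1}" for \<theta>
          using mW[OF \<open>p \<in> N\<close> that] by (simp add: m_def)
      qed
      then show ?thesis using \<tau>(3)[OF p0] \<tau>(3)[of p] that by (simp add: z0_def N_def)
    qed
    have nz0: "?D z0 (1, 0) \<noteq> 0" using nz[OF p0] by (simp add: z0_def)
    have ev: "\<forall>\<^sub>F p in at p0. q (1, 0) p \<noteq> 0 \<and> p \<in> N"
      using tendsto_imp_eventually_ne[OF qt nz0] eventually_at_in_open'[OF oN p0N] by eventually_elim auto
    show ?thesis
    proof (rule has_derivative_caratheodory[where q = "\<lambda>j p. - q (0, j) p / q (1, 0) p"])
      show "\<forall>\<^sub>F y in at p0. \<tau> y = \<tau> p0 + (\<Sum>j\<in>Basis. ((y - p0) \<bullet> j) *\<^sub>R (- q (0, j) y / q (1, 0) y))"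
        using ev
      proof eventually_elim
        case (elim p)
        have "0 = (\<tau> p - \<tau> p0) * q (1, 0) p + (\<Sum>j\<in>Basis. ((p - p0) \<bullet> j) * q (0, j) p)"
          using e0[of p] elim by (simp add: sum_Basis_prod z0_def)
        then have "(\<tau> p - \<tau> p0) * q (1, 0) p = - (\<Sum>j\<in>Basis. ((p - p0) \<bullet> j) * q (0, j) p)" by linarith
        then have "\<tau> p - \<tau> p0 = - (\<Sum>j\<in>Basis. ((p - p0) \<bullet> j) * q (0, j) p) / q (1, 0) p"
          using elim by (simp add: field_simps)
        also have "\<dots> = (\<Sum>j\<in>Basis. ((p - p0) \<bullet> j) *\<^sub>R (- q (0, j) p / q (1, 0) p))"
          by (simp add: sum_divide_distrib sum_negf)
        finally show ?case by simp
      qed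
      show "((\<lambda>p. - q (0, j) p / q (1, 0) p) \<longlongrightarrow> - ?D (\<tau> p0, p0) (0, j) / ?D (\<tau> p0, p0) (1, 0)) (at p0)" for j
        using tendsto_divide[OF tendsto_minus[OF qt] qt nz0] by (simp add: z0_def)
    qed
  qed
  have "Ck_on k S \<tau>" for k
  proof (induction k)
    case 0 then show ?case using \<tau> by simp
  next
    case (Suc k)
    have z: "Ck_on k S (\<lambda>p. (\<tau> p, p))" by (intro Ck_on_Pair Suc Ck_on_ident S)
    have Dk: "Ck_on k S (\<lambda>p. ?D (\<tau> p, p) i)" for i
      by (rule Ck_on_compose[OF z, of W]) (use smooth_on_derivative[OF G] \<tau> S in \<open>auto simp: smooth_on_def\<close>)
    have "Ck_on k S (\<lambda>p. inverse (?D (\<tau> p, p) (1, 0)))"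
      by (rule Ck_on_compose[OF Dk Ck_on_inverse]) (use nz S in auto)
    then show ?case
      by (intro Ck_on_SucI[OF S der] Ck_on_sum Ck_on_bounded_linear[OF bounded_linear_scaleR_right] S)
        (auto simp: divide_inverse intro!: Ck_on_bounded_linear[OF bounded_linear_minus[OF bounded_linear_ident]]
          Ck_on_bilinear[OF bounded_bilinear_mult] Dk S)
  qed
  then show ?thesis by (simp add: smooth_on_def)
qed

section \<open>Hadamard's lemma\<close>

text \<open>The factor \<open>g i\<close> is the integral over [0,1] of the i-th partial derivative
  along the ray from \<open>x0\<close> to \<open>y\<close>. It is obtained as the value at time 1 of
  a parametrised differential equation with zero linear part, so that \<open>linear_ode_Ck\<close>
  supplies differentiation under the integral sign.\<close>

lemma hadamard_smooth:
  fixes f :: "'a::euclidean_space \<Rightarrow> real"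
  assumes r: "0 < r" and f: "smooth_on (ball x0 (2 * r)) f"
  obtains g where "\<And>i. i \<in> Basis \<Longrightarrow> smooth_on (ball x0 r) (g i)"
    "\<And>y. y \<in> ball x0 r \<Longrightarrow> f y = f x0 + (\<Sum>i\<in>Basis. ((y - x0) \<bullet> i) * g i y)"
    "\<And>i. i \<in> Basis \<Longrightarrow> g i x0 = frechet_derivative f (at x0) i"
proof -
  define h where "h i z = frechet_derivative f (at (x0 + fst z *\<^sub>R (snd z - x0))) i" for i and z :: "real \<times> 'a"
  \<comment> \<open>Any bound strictly between 1 and 2 would do: time 1 has to be interior, and
    points of the ball of radius \<open>r\<close> must not be scaled out of the ball of radius
    \<open>2 * r\<close>.\<close>
  have inb: "x0 + s *\<^sub>R (y - x0) \<in> ball x0 (2 * r)" if "s \<in> {-3/2..3/2}" "y \<in> cball x0 r" for s y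
  proof -
    have "norm (s *\<^sub>R (y - x0)) \<le> 3/2 * r"
      unfolding norm_scaleR using that by (intro mult_mono) (auto simp: dist_norm norm_minus_commute)
    then show ?thesis using r by (simp add: dist_norm)
  qed
  let ?W = "{-(3/2)<..<3/2::real} \<times> ball x0 r"
  have oW: "open ?W" by (auto intro: open_Times)
  have hs: "smooth_on ?W (h i)" for i
    unfolding h_def
    by (rule smooth_on_compose[OF smooth_on_derivative[OF f]])
      (use inb[OF _ subsetD[OF ball_subset_cball]] oW in \<open>auto intro!: smooth_intros simp del: mem_ball\<close>)
  have hc: "continuous_on ({-(3/2)..3/2} \<times> cball x0 r) (h i)" for i
    unfolding h_def
    by (rule continuous_on_compose2[OF smooth_on_continuous[OF smooth_on_derivative[OF f]]])
      (use inb in \<open>auto intro!: continuous_intros simp del: mem_ball\<close>)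
  define good where "good i Y \<longleftrightarrow> (\<forall>y. Y (0, y) = 0) \<and> (\<forall>t\<in>{-(3/2)<..<3/2}. \<forall>y\<in>cball x0 r.
    ((\<lambda>t. Y (t, y)) has_vector_derivative (\<Sum>k\<in>Basis. (Y (t, y) \<bullet> k) *\<^sub>R 0) + h i (t, y)) (at t))" for i and Y :: "real \<times> 'a \<Rightarrow> real"
  have "\<exists>Y. good i Y" for i
  \<comment> \<open>For the zero matrix the bound \<open>K = 0\<close> is admissible, so the
    smallness condition puts no restriction on the length of time.\<close>
  proof (rule linear_ode_exists[where d = "3/2" and K = 0 and C = "cball x0 r" and a = "\<lambda>_ _. 0" and b = "h i" and ?y0.0 = 0])
    fix Y assume "\<And>p. Y (0, p) = (0::real)" "\<And>t p. t \<in> {- (3 / 2)<..<3 / 2} \<Longrightarrow> p \<in> cball x0 r \<Longrightarrow>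
       ((\<lambda>t. Y (t, p)) has_vector_derivative (\<Sum>i\<in>Basis. (Y (t, p) \<bullet> i) *\<^sub>R 0) + h i (t, p)) (at t)"
    then show "\<exists>Y. good i Y" unfolding good_def by blast
  qed (use hc r in auto)
  then obtain Y where good: "\<And>i. good i (Y i)" by metis
  have Y0: "Y i (0, y) = 0" for i y using good[of i] by (simp add: good_def)
  have Y: "((\<lambda>t. Y i (t, y)) has_vector_derivative h i (t, y)) (at t)"
    if "t \<in> {-(3/2)<..<3/2}" "y \<in> cball x0 r" for i t y
    using good[of i] that unfolding good_def by auto
  have Ys: "smooth_on ?W (Y i)" for i
    unfolding smooth_on_def
  proof
    fix k
    show "Ck_on k ?W (Y i)"
      by (rule linear_ode_Ck[where K = 0 and a = "\<lambda>_ _. 0" and b = "h i" and ?y0.0 = 0])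
        (use Y Y0 hs[of i] in \<open>auto simp: smooth_on_def Ck_on_const\<close>)
  qed
  define g where "g i y = Y i (1, y)" for i y
  have gs: "smooth_on (ball x0 r) (g i)" for i
    unfolding g_def by (rule smooth_on_compose[OF Ys]) (auto intro!: smooth_intros)
  have eq: "f y = f x0 + (\<Sum>i\<in>Basis. ((y - x0) \<bullet> i) * g i y)" if y: "y \<in> ball x0 r" for y
  proof -
    let ?d = "\<lambda>t. f (x0 + t *\<^sub>R (y - x0)) - f x0 - (\<Sum>i\<in>Basis. ((y - x0) \<bullet> i) * Y i (t, y))"
    have "?d 1 = 0"
    proof (rule gronwall_zero[of "-(3/2)" "3/2" ?d "\<lambda>t. 0" 0 0])
      fix t :: real assume t: "t \<in> {-(3/2)<..<3/2}"
      have z: "x0 + t *\<^sub>R (y - x0) \<in> ball x0 (2 * r)" using inb[of t y] t y by auto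
      have "((\<lambda>t. x0 + t *\<^sub>R (y - x0)) has_derivative (\<lambda>h. h *\<^sub>R (y - x0))) (at t)"
        by (auto intro!: derivative_eq_intros)
      from has_derivative_compose[OF this smooth_on_has_derivative[OF f z]]
      have "((\<lambda>t. f (x0 + t *\<^sub>R (y - x0))) has_vector_derivative frechet_derivative f (at (x0 + t *\<^sub>R (y - x0))) (y - x0)) (at t)"
        unfolding has_vector_derivative_def
        by (simp only: linear_scale[OF linear_frechet_derivative[OF smooth_on_differentiable[OF f z]]])
      also have "frechet_derivative f (at (x0 + t *\<^sub>R (y - x0))) (y - x0) = (\<Sum>i\<in>Basis. ((y - x0) \<bullet> i) * h i (t, y))"
        by (subst frechet_derivative_expand[OF smooth_on_differentiable[OF f z]]) (simp add: h_def)
      finally have "((\<lambda>t. f (x0 + t *\<^sub>R (y - x0)) - f x0 - (\<Sum>i\<in>Basis. ((y - x0) \<bullet> i) * Y i (t, y))) has_vector_derivative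
          ((\<Sum>i\<in>Basis. ((y - x0) \<bullet> i) * h i (t, y)) - 0 - (\<Sum>i\<in>Basis. ((y - x0) \<bullet> i) * h i (t, y)))) (at t)"
        by (intro has_vector_derivative_diff has_vector_derivative_const has_vector_derivative_sum
            bounded_linear.has_vector_derivative[OF bounded_linear_mult_right] Y t) (use y in auto)
      then show "(?d has_vector_derivative 0) (at t)" by simp
    qed (auto simp: Y0)
    then show ?thesis by (simp add: g_def)
  qed
  have "(f has_derivative (\<lambda>v. \<Sum>i\<in>Basis. (v \<bullet> i) *\<^sub>R g i x0)) (at x0)"
  proof (rule has_derivative_caratheodory[where q = g])
    show "\<forall>\<^sub>F y in at x0. f y = f x0 + (\<Sum>i\<in>Basis. ((y - x0) \<bullet> i) *\<^sub>R g i y)"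
      using eventually_at_in_open'[OF open_ball centre_in_ball[THEN iffD2, OF r]] by eventually_elim (simp add: eq)
    show "(g i \<longlongrightarrow> g i x0) (at x0)" for i
      using smooth_on_continuous[OF gs] r by (metis centre_in_ball continuous_on_eq_continuous_at isCont_def open_ball)
  qed
  then have "frechet_derivative f (at x0) = (\<lambda>v. \<Sum>i\<in>Basis. (v \<bullet> i) *\<^sub>R g i x0)"
    using frechet_derivative_at by metis
  then have g0: "g i x0 = frechet_derivative f (at x0) i" if "i \<in> Basis" for i
    using that by (simp add: inner_Basis if_distrib[of "\<lambda>x. x * _"] cong: if_cong)
  show thesis by (rule that[of g]) (use gs eq g0 in auto)
qed

section \<open>Flat functions\<close>

text \<open>The classical flat function is the case \<open>k = 0\<close>. The powers in the
  denominator make the family closed under differentiation up to linear combinations, which is what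
  an induction on the order needs.\<close>

definition exp_bump :: "nat \<Rightarrow> real \<Rightarrow> real" where
  "exp_bump k s = (if s > 0 then exp (- (1 / s)) / s ^ k else 0)"

lemma exp_bump_tendsto_0: "(exp_bump k \<longlongrightarrow> 0) (at 0)"
proof -
  have "((\<lambda>s. inverse s ^ k / exp (inverse s)) \<longlongrightarrow> 0) (at_right (0::real))"
    using filterlim_compose[OF tendsto_power_div_exp_0 filterlim_inverse_at_top_right] .
  then have "(exp_bump k \<longlongrightarrow> 0) (at_right 0)"
    by (rule Lim_transform_eventually)
      (auto simp: eventually_at_filter exp_bump_def exp_minus divide_simps power_inverse intro!: always_eventually)
  moreover have "(exp_bump k \<longlongrightarrow> 0) (at_left 0)"
    by (rule Lim_transform_eventually[OF tendsto_const])
      (auto simp: eventually_at_filter exp_bump_def intro!: always_eventually)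
  ultimately show ?thesis by (simp add: filterlim_split_at)
qed

lemma exp_bump_has_derivative:
  "(exp_bump k has_real_derivative exp_bump (Suc (Suc k)) s - real k * exp_bump (Suc k) s) (at s)"
proof -
  consider "s > 0" | "s < 0" | "s = 0" by linarith
  then show ?thesis
  proof cases
    case 1
    have "((\<lambda>s. exp (- (1 / s)) / s ^ k) has_real_derivative exp_bump (Suc (Suc k)) s - real k * exp_bump (Suc k) s) (at s)"
      using 1 by (cases k; auto intro!: derivative_eq_intros simp: exp_bump_def field_simps power2_eq_square; metis One_nat_def power_eq_if)
    then show ?thesis
      by (rule has_field_derivative_transform_within_open[of _ _ _ "{0<..}"]) (use 1 in \<open>auto simp: exp_bump_def\<close>)
  next
    case 2
    have "((\<lambda>s::real. 0::real) has_real_derivative exp_bump (Suc (Suc k)) s - real k * exp_bump (Suc k) s) (at s)"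
      using 2 by (simp add: exp_bump_def)
    then show ?thesis
      by (rule has_field_derivative_transform_within_open[of _ _ _ "{..<0}"]) (use 2 in \<open>auto simp: exp_bump_def\<close>)
  next
    case 3
    \<comment> \<open>At 0 the difference quotient of \<open>exp_bump k\<close> is
      \<open>exp_bump (Suc k)\<close>, whose limit is already known.\<close>
    have "((\<lambda>h. (exp_bump k (0 + h) - exp_bump k 0) / h) \<longlongrightarrow> 0) (at 0)"
      by (rule Lim_transform_eventually[OF exp_bump_tendsto_0[of "Suc k"]])
        (auto simp: eventually_at_filter exp_bump_def intro!: always_eventually)
    then show ?thesis using 3 by (simp add: DERIV_def exp_bump_def)
  qed
qed

lemma smooth_on_exp_bump: "smooth_on UNIV (exp_bump k)"
proof -
  have "Ck_on n UNIV (exp_bump k)" for n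
  proof (induction n arbitrary: k)
    case 0
    then show ?case by (simp add: continuous_at_imp_continuous_on DERIV_isCont[OF exp_bump_has_derivative])
  next
    case (Suc n)
    show ?case
    proof (rule Ck_on_SucI[OF open_UNIV])
      show "(exp_bump k has_derivative (\<lambda>v. v * (exp_bump (Suc (Suc k)) s + (- real k) * exp_bump (Suc k) s))) (at s)" for s
        by (rule has_derivative_eq_rhs[OF exp_bump_has_derivative[unfolded has_field_derivative_def]])
          (simp add: fun_eq_iff mult.commute)
    qed (intro Ck_on_bounded_linear[OF bounded_linear_mult_right] Ck_on_add Suc open_UNIV)
  qed
  then show ?thesis by (simp add: smooth_on_def)
qed

section \<open>Kernels of antisymmetric bilinear forms\<close>

text \<open>If the form does not vanish, two vectors \<open>v\<close>, \<open>w\<close> with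
  \<open>B v w \<noteq> 0\<close> span a nondegenerate plane. Its orthogonal complement
  \<open>U\<close> in \<open>V\<close> has dimension smaller by 2, hence is again odd-dimensional,
  and a kernel vector for \<open>U\<close> is also orthogonal to the plane.\<close>

lemma antisymmetric_kernel:
  fixes B :: "'e::euclidean_space \<Rightarrow> 'e \<Rightarrow> real"
  assumes B: "\<And>y. linear (\<lambda>x. B x y)" "\<And>x y. B x y = - B y x" and V: "subspace V" "odd (dim V)"
  shows "\<exists>z\<in>V. z \<noteq> 0 \<and> (\<forall>y\<in>V. B z y = 0)"
  using V
proof (induction "dim V" arbitrary: V rule: less_induct)
  case less
  note [simp] = linear_add[OF B(1)] linear_diff[OF B(1)] linear_scale[OF B(1)] linear_0[OF B(1)]
  show ?case
  proof (cases "\<forall>x\<in>V. \<forall>y\<in>V. B x y = 0")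
    case True
    have "dim V \<noteq> 0" using less.prems(2) by (metis even_zero)
    then obtain z where "z \<in> V" "z \<noteq> 0" by (auto simp: dim_eq_0)
    then show ?thesis using True by blast
  next
    case False
    then obtain v w where vw: "v \<in> V" "w \<in> V" "B v w \<noteq> 0" by blast
    have wv: "B w v \<noteq> 0" "B v v = 0" "B w w = 0" using vw B(2)[of v w] B(2)[of v v] B(2)[of w w] by auto
    define U where "U = {x \<in> V. B x v = 0 \<and> B x w = 0}"
    have U: "subspace U" using less.prems(1) by (auto simp: U_def subspace_def)
    have dec: "\<exists>u\<in>U. \<exists>a b. x = u + a *\<^sub>R v + b *\<^sub>R w" if x: "x \<in> V" for x
    proof (intro bexI exI)
      \<comment> \<open>The projection along the plane: as \<open>v\<close> and \<open>w\<close> are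
        isotropic, the coefficient of \<open>v\<close> is determined by pairing with
        \<open>w\<close> and conversely.\<close>
      let ?u = "x - (B x w / B v w) *\<^sub>R v - (B x v / B w v) *\<^sub>R w"
      show "x = ?u + (B x w / B v w) *\<^sub>R v + (B x v / B w v) *\<^sub>R w" by simp
      show "?u \<in> U" using x vw wv less.prems(1) by (auto simp: U_def intro!: subspace_diff subspace_scale)
    qed
    have "w \<notin> span U" using wv U by (auto simp: span_eq_iff[THEN iffD2] U_def)
    moreover have "v \<notin> span (insert w U)"
    proof
      assume "v \<in> span (insert w U)"
      then obtain c where "v - c *\<^sub>R w \<in> span U" by (auto simp: span_breakdown_eq)
      then have "B (v - c *\<^sub>R w) w = 0" using U by (auto simp: span_eq_iff[THEN iffD2] U_def)
      then show False using vw wv by simp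
    qed
    ultimately have "dim (insert v (insert w U)) = dim U + 2" by (simp add: dim_insert)
    moreover have "dim (insert v (insert w U)) = dim V"
    proof (rule antisym)
      show "dim (insert v (insert w U)) \<le> dim V" by (rule dim_subset) (use vw in \<open>auto simp: U_def\<close>)
      have "V \<subseteq> span (insert v (insert w U))"
        using dec by (fastforce intro: span_add span_scale span_base)
      then show "dim V \<le> dim (insert v (insert w U))" by (metis dim_subset dim_span)
    qed
    ultimately have d: "dim V = dim U + 2" by simp
    then have "odd (dim U)" "dim U < dim V" using less.prems(2) by auto
    from less.hyps[OF this(2) U this(1)] obtain z where z: "z \<in> U" "z \<noteq> 0" "\<And>y. y \<in> U \<Longrightarrow> B z y = 0" by blast
    have "B z y = 0" if y: "y \<in> V" for y
    proof -
      obtain u a b where "u \<in> U" "y = u + a *\<^sub>R v + b *\<^sub>R w" using dec[OF y] by blast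
      then show ?thesis using z B(2)[of z] by (simp add: U_def)
    qed
    then show ?thesis using z by (auto simp: U_def)
  qed
qed

section \<open>Plots and tangent vectors\<close>

text \<open>A smooth map from an open set of a Euclidean space of any dimension into the manifold,
  called a plot as in diffeology. Inverse charts and flows in time and coordinates are both of this
  kind, so one chain rule serves them all and no smooth structure on a product with the time axis
  has to be set up.\<close>

definition plot ::
  "('m::topological_space, 'e::euclidean_space) chart set \<Rightarrow> 'p::euclidean_space set \<Rightarrow> ('p \<Rightarrow> 'm) \<Rightarrow> bool" where
  "plot A S p \<longleftrightarrow> open S \<and> continuous_on S p \<and>
     (\<forall>d\<in>A. smooth_on (S \<inter> p -` chart_dom d) (\<lambda>z. chart_map d (p z)))"

text \<open>The image of \<open>w\<close> under the differential of \<open>p\<close> at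
  \<open>z\<close>, as a derivation with the value 0 on nonsmooth functions that
  \<open>tangent_space\<close> prescribes.\<close>

definition plot_vec ::
  "('m::topological_space, 'e::euclidean_space) chart set \<Rightarrow> ('p::euclidean_space \<Rightarrow> 'm) \<Rightarrow> 'p \<Rightarrow> 'p \<Rightarrow> 'm tvec" where
  "plot_vec A p z w = (\<lambda>f. if f \<in> smooth_functions A
     then frechet_derivative (\<lambda>z. f (p z)) (at z) w else 0)"

lemma coord_vector_eq_plot_vec: "coord_vector A c x w = plot_vec A (chart_inv c) (chart_map c x) w"
  unfolding coord_vector_def plot_vec_def o_def ..

text \<open>The squared distance keeps the function smooth at the centre; the argument is positive
  exactly inside the ball when \<open>r\<close> is positive.\<close>

definition bump :: "'e::euclidean_space \<Rightarrow> real \<Rightarrow> 'e \<Rightarrow> real" where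
  "bump u0 r u = exp_bump 0 (r\<^sup>2 - (u - u0) \<bullet> (u - u0))"

lemma smooth_on_bump: "open S \<Longrightarrow> smooth_on S (bump u0 r)"
  unfolding bump_def[abs_def]
  by (rule smooth_on_compose[OF smooth_on_exp_bump])
    (auto intro!: smooth_intros smooth_on_bilinear[OF bounded_bilinear_inner])

lemma bump_pos: "0 < r \<Longrightarrow> 0 < bump u0 r u0"
  by (simp add: bump_def exp_bump_def)

lemma bump_eq_0: "0 \<le> r \<Longrightarrow> u \<notin> ball u0 r \<Longrightarrow> bump u0 r u = 0"
proof -
  assume "0 \<le> r" "u \<notin> ball u0 r"
  then have "r\<^sup>2 \<le> (norm (u - u0))\<^sup>2" by (intro power_mono) (auto simp: dist_norm norm_minus_commute)
  then show ?thesis by (simp add: bump_def exp_bump_def dot_square_norm)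
qed

section \<open>Charts and plots of a manifold\<close>

locale smooth_mfd =
  fixes A :: "('m::{t2_space,second_countable_topology}, 'e::euclidean_space) chart set"
  assumes A: "smooth_manifold A"
begin

lemma chart_at: obtains c where "c \<in> A" "x \<in> chart_dom c"
  using A unfolding smooth_manifold_def by blast

context
  fixes c assumes c: "c \<in> A"
begin

lemma open_dom: "open (chart_dom c)" and open_img: "open (chart_img c)"
  and chart_homeo: "homeomorphism (chart_dom c) (chart_img c) (chart_map c) (chart_inv c)"
  using A c unfolding smooth_manifold_def by blast+

lemma map_in: "x \<in> chart_dom c \<Longrightarrow> chart_map c x \<in> chart_img c"
  by (simp add: chart_img_def)

lemma inv_in: "u \<in> chart_img c \<Longrightarrow> chart_inv c u \<in> chart_dom c"
  and inv_map: "x \<in> chart_dom c \<Longrightarrow> chart_inv c (chart_map c x) = x"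
  and map_inv: "u \<in> chart_img c \<Longrightarrow> chart_map c (chart_inv c u) = u"
  and map_cont: "continuous_on (chart_dom c) (chart_map c)"
  and inv_cont: "continuous_on (chart_img c) (chart_inv c)"
  using chart_homeo unfolding homeomorphism_def by auto

lemma transition:
  assumes d: "d \<in> A"
  shows "open (chart_img c \<inter> chart_inv c -` chart_dom d)"
    "smooth_on (chart_img c \<inter> chart_inv c -` chart_dom d) (\<lambda>u. chart_map d (chart_inv c u))"
proof -
  have "open (chart_dom d)" using A d unfolding smooth_manifold_def by blast
  then show "open (chart_img c \<inter> chart_inv c -` chart_dom d)"
    by (intro continuous_open_preimage inv_cont open_img)
  have eq: "chart_map c ` (chart_dom c \<inter> chart_dom d) = chart_img c \<inter> chart_inv c -` chart_dom d"
    by (auto simp: inv_map map_in image_iff) (metis Int_iff inv_in map_inv)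
  have "smooth_on (chart_map c ` (chart_dom c \<inter> chart_dom d)) (chart_map d \<circ> chart_inv c)"
    using A c d unfolding smooth_manifold_def by blast
  then show "smooth_on (chart_img c \<inter> chart_inv c -` chart_dom d) (\<lambda>u. chart_map d (chart_inv c u))"
    unfolding eq by (simp add: o_def)
qed

end

lemma plot_open: "plot A S p \<Longrightarrow> open S"
  by (simp add: plot_def)

lemma plot_open_preimage: "plot A S p \<Longrightarrow> open X \<Longrightarrow> open (S \<inter> p -` X)"
  by (auto simp: plot_def intro: continuous_open_preimage)

lemma plot_smooth: "plot A S p \<Longrightarrow> d \<in> A \<Longrightarrow> smooth_on (S \<inter> p -` chart_dom d) (\<lambda>z. chart_map d (p z))"
  by (simp add: plot_def)

text \<open>One chart near each parameter is enough: the transition maps carry smoothness to all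
  other charts, and continuity follows from that of the inverse chart.\<close>

lemma plotI_local:
  assumes S: "open S"
    and loc: "\<And>z. z \<in> S \<Longrightarrow> \<exists>d\<in>A. \<exists>U. open U \<and> z \<in> U \<and> p ` U \<subseteq> chart_dom d \<and> smooth_on U (\<lambda>z. chart_map d (p z))"
  shows "plot A S p"
  unfolding plot_def
proof (intro conjI ballI S)
  show cp: "continuous_on S p"
  proof (rule continuous_at_imp_continuous_on, rule ballI)
    fix z assume "z \<in> S"
    from loc[OF this] obtain d U where d: "d \<in> A" and U: "open U" "z \<in> U" "p ` U \<subseteq> chart_dom d"
      "smooth_on U (\<lambda>z. chart_map d (p z))" by blast
    have "continuous_on U (\<lambda>z. chart_inv d (chart_map d (p z)))"
      by (rule continuous_on_compose2[OF inv_cont[OF d] smooth_on_continuous[OF U(4)]])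
        (use U map_in[OF d] in auto)
    then have "continuous_on U p"
      by (rule continuous_on_eq) (use U inv_map[OF d] in auto)
    then show "isCont p z" using U by (simp add: continuous_on_eq_continuous_at)
  qed
  fix e assume e: "e \<in> A"
  show "smooth_on (S \<inter> p -` chart_dom e) (\<lambda>z. chart_map e (p z))"
  proof (rule smooth_on_local)
    fix z assume z: "z \<in> S \<inter> p -` chart_dom e"
    then obtain d U where d: "d \<in> A" and U: "open U" "z \<in> U" "p ` U \<subseteq> chart_dom d"
      "smooth_on U (\<lambda>z. chart_map d (p z))" using loc[of z] by blast
    let ?U = "U \<inter> (S \<inter> p -` chart_dom e)"
    have oU: "open ?U" by (intro open_Int U continuous_open_preimage[OF cp S open_dom[OF e]])
    have "smooth_on ?U (\<lambda>z. chart_map e (chart_inv d (chart_map d (p z))))"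
      by (rule smooth_on_compose[OF transition(2)[OF d e] smooth_on_subset[OF U(4)] oU])
        (use U(3) map_in[OF d] inv_map[OF d] in auto)
    then have "smooth_on ?U (\<lambda>z. chart_map e (p z))"
      by (rule smooth_on_cong[OF oU, rotated]) (use U(3) inv_map[OF d] in auto)
    then show "\<exists>U. open U \<and> z \<in> U \<and> smooth_on U (\<lambda>z. chart_map e (p z))" using oU z U by blast
  qed
qed

lemma plot_chart_inv: "c \<in> A \<Longrightarrow> plot A (chart_img c) (chart_inv c)"
  using transition(2) inv_cont open_img by (auto simp: plot_def)

lemma plot_compose:
  assumes p: "plot A S p" and q: "smooth_on T q" "open T" "q ` T \<subseteq> S"
  shows "plot A T (\<lambda>z. p (q z))"
  unfolding plot_def
proof (intro conjI ballI q)
  show c: "continuous_on T (\<lambda>z. p (q z))"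
    using p q by (intro continuous_on_compose2[OF _ smooth_on_continuous[OF q(1)]]) (auto simp: plot_def)
  fix d assume d: "d \<in> A"
  show "smooth_on (T \<inter> (\<lambda>z. p (q z)) -` chart_dom d) (\<lambda>z. chart_map d (p (q z)))"
    by (rule smooth_on_compose[OF plot_smooth[OF p d] smooth_on_subset[OF q(1)]])
      (use q d c in \<open>auto intro!: continuous_open_preimage open_dom\<close>)
qed

lemma plot_subset: "plot A S p \<Longrightarrow> open T \<Longrightarrow> T \<subseteq> S \<Longrightarrow> plot A T p"
  using plot_compose[of S p T "\<lambda>x. x"] by (simp add: smooth_on_ident)

lemma plot_cong: "plot A S p \<Longrightarrow> (\<And>z. z \<in> S \<Longrightarrow> p z = q z) \<Longrightarrow> plot A S q"
  unfolding plot_def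
proof (elim conjE, intro conjI ballI)
  assume eq: "\<And>z. z \<in> S \<Longrightarrow> p z = q z" and S: "open S" and cp: "continuous_on S p"
    and sm: "\<forall>d\<in>A. smooth_on (S \<inter> p -` chart_dom d) (\<lambda>z. chart_map d (p z))"
  show "open S" "continuous_on S q" using S continuous_on_eq[OF cp eq] by auto
  fix d assume d: "d \<in> A"
  have "S \<inter> p -` chart_dom d = S \<inter> q -` chart_dom d" using eq by auto
  moreover have "open (S \<inter> p -` chart_dom d)" by (intro continuous_open_preimage cp S open_dom d)
  then have "smooth_on (S \<inter> p -` chart_dom d) (\<lambda>z. chart_map d (q z))"
    by (rule smooth_on_cong[OF _ _ bspec[OF sm d]]) (use eq in auto)
  ultimately show "smooth_on (S \<inter> q -` chart_dom d) (\<lambda>z. chart_map d (q z))" by simp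
qed

lemma smooth_functions_iff: "f \<in> smooth_functions A \<longleftrightarrow> (\<forall>c\<in>A. smooth_on (chart_img c) (\<lambda>u. f (chart_inv c u)))"
  by (simp add: smooth_functions_def o_def)

lemma plot_smooth_function:
  assumes p: "plot A S p" and f: "f \<in> smooth_functions A"
  shows "smooth_on S (\<lambda>z. f (p z))"
proof (rule smooth_on_local)
  fix z assume z: "z \<in> S"
  obtain d where d: "d \<in> A" "p z \<in> chart_dom d" by (rule chart_at)
  let ?U = "S \<inter> p -` chart_dom d"
  have o: "open ?U" by (rule plot_open_preimage[OF p open_dom[OF d(1)]])
  have "smooth_on ?U (\<lambda>z. f (chart_inv d (chart_map d (p z))))"
    by (rule smooth_on_compose[OF _ plot_smooth[OF p d(1)] o, where T = "chart_img d"])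
      (use f d map_in[OF d(1)] in \<open>auto simp: smooth_functions_iff\<close>)
  then have "smooth_on ?U (\<lambda>z. f (p z))"
    by (rule smooth_on_cong[OF o, rotated]) (use inv_map[OF d(1)] in auto)
  then show "\<exists>U. open U \<and> z \<in> U \<and> smooth_on U (\<lambda>z. f (p z))" using o z d by blast
qed

lemma smooth_function_continuous:
  assumes f: "f \<in> smooth_functions A"
  shows "continuous_on UNIV f"
proof (rule continuous_at_imp_continuous_on, rule ballI)
  fix x
  obtain d where d: "d \<in> A" "x \<in> chart_dom d" by (rule chart_at)
  have "continuous_on (chart_dom d) (\<lambda>x. f (chart_inv d (chart_map d x)))"
    by (rule continuous_on_compose2[OF smooth_on_continuous map_cont[OF d(1)]])
      (use f d map_in[OF d(1)] in \<open>auto simp: smooth_functions_iff\<close>)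
  then have "continuous_on (chart_dom d) f" by (rule continuous_on_eq) (use inv_map[OF d(1)] in auto)
  then show "isCont f x" using d open_dom by (simp add: continuous_on_eq_continuous_at)
qed

lemma smooth_functions_const: "(\<lambda>x. a) \<in> smooth_functions A"
  and smooth_functions_add: "f \<in> smooth_functions A \<Longrightarrow> g \<in> smooth_functions A \<Longrightarrow> (\<lambda>x. f x + g x) \<in> smooth_functions A"
  and smooth_functions_mult: "f \<in> smooth_functions A \<Longrightarrow> g \<in> smooth_functions A \<Longrightarrow> (\<lambda>x. f x * g x) \<in> smooth_functions A"
  by (simp_all add: smooth_functions_iff smooth_intros open_img)

lemma smooth_functions_sum:
  "(\<And>i. i \<in> I \<Longrightarrow> f i \<in> smooth_functions A) \<Longrightarrow> (\<lambda>x. \<Sum>i\<in>I. f i x) \<in> smooth_functions A"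
  by (simp add: smooth_functions_iff smooth_intros open_img)

lemma plot_function_derivative:
  assumes "plot A S p" "z \<in> S" "f \<in> smooth_functions A"
  shows "((\<lambda>z. f (p z)) has_derivative (\<lambda>w. plot_vec A p z w f)) (at z)"
  using smooth_on_has_derivative[OF plot_smooth_function[OF assms(1,3)] assms(2)] assms(3)
  by (simp add: plot_vec_def)

lemma plot_vec_apply:
  assumes "plot A S p" "z \<in> S" "f \<in> smooth_functions A" "((\<lambda>z. f (p z)) has_derivative f') (at z)"
  shows "plot_vec A p z w f = f' w"
  using has_derivative_unique[OF plot_function_derivative[OF assms(1-3)] assms(4)] by metis

lemma plot_vec_linear:
  assumes "plot A S p" "z \<in> S"
  shows "plot_vec A p z (v + w) = tplus (plot_vec A p z v) (plot_vec A p z w)"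
    and "plot_vec A p z (a *\<^sub>R v) = tscale a (plot_vec A p z v)"
proof -
  have *: "linear (\<lambda>w. plot_vec A p z w f)" if "f \<in> smooth_functions A" for f
    using plot_function_derivative[OF assms that] by (rule has_derivative_linear)
  show "plot_vec A p z (v + w) = tplus (plot_vec A p z v) (plot_vec A p z w)"
  proof
    fix f show "plot_vec A p z (v + w) f = tplus (plot_vec A p z v) (plot_vec A p z w) f"
      using linear_add[OF *, of f] by (cases "f \<in> smooth_functions A") (auto simp: tplus_def plot_vec_def)
  qed
  show "plot_vec A p z (a *\<^sub>R v) = tscale a (plot_vec A p z v)"
  proof
    fix f show "plot_vec A p z (a *\<^sub>R v) f = tscale a (plot_vec A p z v) f"
      using linear_scale[OF *, of f] by (cases "f \<in> smooth_functions A") (auto simp: tscale_def plot_vec_def)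
  qed
qed

lemma plot_vec_tangent:
  assumes p: "plot A S p" "z \<in> S"
  shows "plot_vec A p z w \<in> tangent_space A (p z)"
  unfolding tangent_space_def mem_Collect_eq
proof (intro conjI ballI allI impI)
  fix f g assume f: "f \<in> smooth_functions A" and g: "g \<in> smooth_functions A"
  note df = plot_function_derivative[OF p f] and dg = plot_function_derivative[OF p g]
  show "plot_vec A p z w (\<lambda>y. f y + g y) = plot_vec A p z w f + plot_vec A p z w g"
    by (rule plot_vec_apply[OF p smooth_functions_add[OF f g] has_derivative_add[OF df dg]])
  show "plot_vec A p z w (\<lambda>y. f y * g y) = f (p z) * plot_vec A p z w g + g (p z) * plot_vec A p z w f"
    using plot_vec_apply[OF p smooth_functions_mult[OF f g] has_derivative_mult[OF df dg]] by (simp add: mult.commute)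
next
  fix a f assume f: "f \<in> smooth_functions A"
  show "plot_vec A p z w (\<lambda>y. a * f y) = a * plot_vec A p z w f"
    by (rule plot_vec_apply[OF p smooth_functions_mult[OF smooth_functions_const f]
      has_derivative_mult_right[OF plot_function_derivative[OF p f]]])
qed (simp add: plot_vec_def)

lemma plot_vec_chain:
  assumes p: "plot A S p" "q z \<in> S" and q: "(q has_derivative q') (at z)"
  shows "plot_vec A (\<lambda>z. p (q z)) z w = plot_vec A p (q z) (q' w)"
proof
  fix f
  show "plot_vec A (\<lambda>z. p (q z)) z w f = plot_vec A p (q z) (q' w) f"
  proof (cases "f \<in> smooth_functions A")
    case True
    have "((\<lambda>z. f (p (q z))) has_derivative (\<lambda>w. plot_vec A p (q z) (q' w) f)) (at z)"
      by (rule has_derivative_compose[OF q plot_function_derivative[OF p True]])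
    from frechet_derivative_at[OF this]
    have "frechet_derivative (\<lambda>z. f (p (q z))) (at z) w = plot_vec A p (q z) (q' w) f" by metis
    then show ?thesis using True unfolding plot_vec_def[of A "\<lambda>z. p (q z)"] by simp
  qed (simp add: plot_vec_def)
qed

lemma plot_vec_cong:
  assumes p: "plot A S p" "z \<in> S" and eq: "\<And>z. z \<in> S \<Longrightarrow> p z = q z"
  shows "plot_vec A q z = plot_vec A p z"
proof (intro ext)
  fix w f
  show "plot_vec A q z w f = plot_vec A p z w f"
  proof (cases "f \<in> smooth_functions A")
    case True
    have "plot_vec A q z w f = plot_vec A p z w f"
      by (rule plot_vec_apply[OF plot_cong[OF p(1) eq] p(2) True
        has_derivative_transform_within_open[OF plot_function_derivative[OF p True] plot_open[OF p(1)] p(2)]])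
        (auto simp: eq)
    then show ?thesis .
  qed (simp add: plot_vec_def)
qed

lemma plot_vec_coord:
  assumes p: "plot A S p" "z \<in> S" and d: "d \<in> A" "p z \<in> chart_dom d"
  shows "plot_vec A p z w = coord_vector A d (p z) (frechet_derivative (\<lambda>z. chart_map d (p z)) (at z) w)"
proof -
  let ?U = "S \<inter> p -` chart_dom d"
  have o: "open ?U" by (rule plot_open_preimage[OF p(1) open_dom[OF d(1)]])
  have z: "z \<in> ?U" using p d by auto
  have "plot_vec A (\<lambda>z. chart_inv d (chart_map d (p z))) z = plot_vec A p z"
    by (rule plot_vec_cong[OF plot_subset[OF p(1) o] z]) (use inv_map[OF d(1)] in auto)
  moreover have "plot_vec A (\<lambda>z. chart_inv d (chart_map d (p z))) z w =
     plot_vec A (chart_inv d) (chart_map d (p z)) (frechet_derivative (\<lambda>z. chart_map d (p z)) (at z) w)"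
    by (rule plot_vec_chain[OF plot_chart_inv[OF d(1)] map_in[OF d] smooth_on_has_derivative[OF plot_smooth[OF p(1) d(1)] z]])
  ultimately show ?thesis by (simp add: coord_vector_eq_plot_vec)
qed

section \<open>Globally defined test functions and coordinates of tangent vectors\<close>

definition chart_ext :: "('m, 'e) chart \<Rightarrow> 'e \<Rightarrow> real \<Rightarrow> ('e \<Rightarrow> real) \<Rightarrow> 'm \<Rightarrow> real" where
  "chart_ext c u0 r h x = (if x \<in> chart_dom c then bump u0 r (chart_map c x) * h (chart_map c x) else 0)"

text \<open>The image \<open>K\<close> of the closed ball is compact and, the manifold being
  Hausdorff, closed. Near a point of \<open>K\<close> the function is a smooth coordinate
  expression; on the open complement of \<open>K\<close> it is 0.\<close>

lemma chart_ext_smooth: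
  assumes c: "c \<in> A" and r: "0 < r" and V: "open V" "cball u0 r \<subseteq> V" "V \<subseteq> chart_img c" and h: "smooth_on V h"
  shows "chart_ext c u0 r h \<in> smooth_functions A"
  unfolding smooth_functions_iff
proof
  fix d assume d: "d \<in> A"
  define K where "K = chart_inv c ` cball u0 r"
  have "compact K"
    unfolding K_def by (rule compact_continuous_image[OF continuous_on_subset[OF inv_cont[OF c]]]) (use V in auto)
  then have K: "closed K" by (rule compact_imp_closed)
  have ext0: "chart_ext c u0 r h x = 0" if "x \<notin> K" for x
  proof (cases "x \<in> chart_dom c")
    case True
    then have "chart_map c x \<notin> ball u0 r" using that inv_map[OF c True] unfolding K_def by (metis ball_subset_cball image_eqI subsetD)
    then show ?thesis using r by (simp add: chart_ext_def bump_eq_0)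
  qed (simp add: chart_ext_def)
  show "smooth_on (chart_img d) (\<lambda>u. chart_ext c u0 r h (chart_inv d u))"
  proof (rule smooth_on_local)
    fix u assume u: "u \<in> chart_img d"
    show "\<exists>U. open U \<and> u \<in> U \<and> smooth_on U (\<lambda>u. chart_ext c u0 r h (chart_inv d u))"
    proof (cases "chart_inv d u \<in> K")
      case True
      let ?W = "chart_img d \<inter> chart_inv d -` chart_dom c"
      let ?T = "\<lambda>u. chart_map c (chart_inv d u)"
      let ?U = "?W \<inter> ?T -` V"
      have T: "smooth_on ?W ?T" "open ?W" using transition[OF d c] by auto
      have oU: "open ?U" by (rule continuous_open_preimage[OF smooth_on_continuous[OF T(1)] T(2) V(1)])
      have uU: "u \<in> ?U" using True u V inv_in[OF c] map_inv[OF c] by (auto simp: K_def subset_iff)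
      have TU: "smooth_on ?U ?T" by (rule smooth_on_subset[OF T(1)]) auto
      have "smooth_on ?U (\<lambda>u. bump u0 r (?T u) * h (?T u))"
        by (rule smooth_on_mult[OF smooth_on_compose[OF smooth_on_bump[OF V(1)] TU oU]
              smooth_on_compose[OF h TU oU] oU]) auto
      then have "smooth_on ?U (\<lambda>u. chart_ext c u0 r h (chart_inv d u))"
        by (rule smooth_on_cong[OF oU, rotated]) (auto simp: chart_ext_def)
      then show ?thesis using oU uU by blast
    next
      case False
      let ?U = "chart_img d \<inter> chart_inv d -` (- K)"
      have oU: "open ?U" by (rule continuous_open_preimage[OF inv_cont[OF d] open_img[OF d]]) (use K in auto)
      have "smooth_on ?U (\<lambda>u. chart_ext c u0 r h (chart_inv d u))"
        by (rule smooth_on_cong[OF oU _ smooth_on_const[of _ 0]]) (use ext0 in auto)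
      then show ?thesis using oU u False by blast
    qed
  qed
qed

context
  fixes c x assumes c: "c \<in> A" "x \<in> chart_dom c"
begin

private lemma chart_radius:
  obtains r where "r > 0" "ball (chart_map c x) (2 * r) \<subseteq> chart_img c"
proof -
  obtain e where "e > 0" "ball (chart_map c x) e \<subseteq> chart_img c"
    using open_img[OF c(1)] map_in[OF c] open_contains_ball by blast
  then show thesis using that[of "e / 2"] by simp
qed

lemma coord_vector_linear: "coord_vector A c x (v + w) = tplus (coord_vector A c x v) (coord_vector A c x w)"
    "coord_vector A c x (a *\<^sub>R v) = tscale a (coord_vector A c x v)"
  using plot_vec_linear[OF plot_chart_inv[OF c(1)] map_in[OF c]] by (auto simp: coord_vector_eq_plot_vec)

lemma coord_vector_tangent: "coord_vector A c x w \<in> tangent_space A x"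
  using plot_vec_tangent[OF plot_chart_inv[OF c(1)] map_in[OF c], of w] inv_map[OF c]
  by (simp add: coord_vector_eq_plot_vec)

text \<open>Cut-off coordinate functions recover the components: the coordinate difference vanishes
  at the centre, so there the derivative of the product only sees the positive value of the
  bump.\<close>

lemma coord_vector_inject:
  assumes eq: "coord_vector A c x v = coord_vector A c x w"
  shows "v = w"
proof (rule euclidean_eqI)
  fix i :: 'e
  let ?u = "chart_map c x"
  obtain r where r: "r > 0" "ball ?u (2 * r) \<subseteq> chart_img c" by (rule chart_radius)
  let ?h = "\<lambda>u. (u - ?u) \<bullet> i"
  let ?X = "chart_ext c ?u r ?h"
  have X: "?X \<in> smooth_functions A"
    by (rule chart_ext_smooth[OF c(1) r(1), of "ball ?u (2 * r)"]) (use r in \<open>auto intro!: smooth_intros\<close>)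
  have "((\<lambda>u. bump ?u r u * ?h u) has_derivative (\<lambda>w. bump ?u r ?u * (w \<bullet> i))) (at ?u)"
  proof -
    have "(?h has_derivative (\<lambda>w. w \<bullet> i)) (at ?u)" by (auto intro!: derivative_eq_intros)
    from has_derivative_mult[OF smooth_on_has_derivative[OF smooth_on_bump[OF open_UNIV] UNIV_I, of ?u r ?u] this]
    show ?thesis by simp
  qed
  then have "((\<lambda>u. ?X (chart_inv c u)) has_derivative (\<lambda>w. bump ?u r ?u * (w \<bullet> i))) (at ?u)"
    by (rule has_derivative_transform_within_open[OF _ open_img[OF c(1)] map_in[OF c]])
      (use inv_in[OF c(1)] map_inv[OF c(1)] in \<open>auto simp: chart_ext_def\<close>)
  then have "coord_vector A c x w ?X = bump ?u r ?u * (w \<bullet> i)" for w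
    using plot_vec_apply[OF plot_chart_inv[OF c(1)] map_in[OF c] X] by (simp add: coord_vector_eq_plot_vec)
  with eq show "v \<bullet> i = w \<bullet> i" using bump_pos[OF r(1), of ?u] by (metis mult_left_cancel less_irrefl)
qed

text \<open>Hadamard's lemma in the chart, multiplied by the square of a bump function, expresses \<open>f\<close> near
  \<open>x\<close> by globally smooth functions, to which the derivation can be applied.\<close>
lemma tangent_coord_vector:
  assumes v: "v \<in> tangent_space A x"
  shows "\<exists>w. v = coord_vector A c x w"
proof -
  let ?u = "chart_map c x"
  obtain r' where r': "r' > 0" "ball ?u (2 * r') \<subseteq> chart_img c" by (rule chart_radius)
  define r where "r = r' / 2"
  have r: "r > 0" "cball ?u r \<subseteq> ball ?u r'" "ball ?u r' \<subseteq> chart_img c"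
    using r' by (auto simp: r_def)
  have ext: "chart_ext c ?u r h \<in> smooth_functions A" if "smooth_on (ball ?u r') h" for h
    by (rule chart_ext_smooth[OF c(1) r(1) open_ball r(2,3) that])
  have ext_x: "chart_ext c ?u r h x = bump ?u r ?u * h ?u" for h using c by (simp add: chart_ext_def)
  note vD = v[unfolded tangent_space_def mem_Collect_eq]
  have vadd: "v (\<lambda>y. f y + g y) = v f + v g" and vmult: "v (\<lambda>y. f y * g y) = f x * v g + g x * v f"
    and vscale: "v (\<lambda>y. a * f y) = a * v f"
    if "f \<in> smooth_functions A" "g \<in> smooth_functions A" for f g a using vD that by blast+
  have v0: "v (\<lambda>y. 0) = 0"
    using vscale[OF smooth_functions_const smooth_functions_const, of 0 0] by simp
  have vsum: "v (\<lambda>y. \<Sum>i\<in>I. f i y) = (\<Sum>i\<in>I. v (f i))" if "finite I" "\<And>i. i \<in> I \<Longrightarrow> f i \<in> smooth_functions A" for I :: "'e set" and f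
    using that
  proof (induction I)
    case (insert i I)
    have "v (\<lambda>y. f i y + (\<Sum>i\<in>I. f i y)) = v (f i) + v (\<lambda>y. \<Sum>i\<in>I. f i y)"
      by (rule vadd) (use insert in \<open>auto intro: smooth_functions_sum\<close>)
    then show ?case using insert by simp
  qed (simp add: v0)
  define \<beta> where "\<beta> = chart_ext c ?u r (\<lambda>_. 1)"
  define b where "b = bump ?u r ?u"
  have b: "b > 0" using bump_pos[OF r(1)] by (simp add: b_def)
  have \<beta>: "\<beta> \<in> smooth_functions A" "\<beta> x = b"
    unfolding \<beta>_def by (auto intro!: ext smooth_on_const simp: ext_x b_def)
  define X where "X i = chart_ext c ?u r (\<lambda>u. (u - ?u) \<bullet> i)" for i
  have X: "X i \<in> smooth_functions A" "X i x = 0" for i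
    unfolding X_def by (auto intro!: ext smooth_intros simp: ext_x)
  \<comment> \<open>Applying \<open>v\<close> to the product of \<open>f\<close> with the squared
    cut-off gives b^2 v(f) plus a term that cancels, while each summand of the Hadamard expansion
    contributes one factor \<open>b\<close> times v(\<open>X i\<close>); one division by
    \<open>b\<close> remains.\<close>
  define w where "w = (\<Sum>i\<in>Basis. (v (X i) / b) *\<^sub>R i)"
  have "v f = coord_vector A c x w f" for f
  proof (cases "f \<in> smooth_functions A")
    case True
    let ?f = "\<lambda>u. f (chart_inv c u)"
    have fs: "smooth_on (chart_img c) ?f" using True c by (auto simp: smooth_functions_iff)
    have fx: "?f ?u = f x" using inv_map[OF c] by simp
    obtain g where g: "\<And>i. i \<in> Basis \<Longrightarrow> smooth_on (ball ?u r') (g i)"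
      "\<And>y. y \<in> ball ?u r' \<Longrightarrow> ?f y = ?f ?u + (\<Sum>i\<in>Basis. ((y - ?u) \<bullet> i) * g i y)"
      "\<And>i. i \<in> Basis \<Longrightarrow> g i ?u = frechet_derivative ?f (at ?u) i"
      using hadamard_smooth[OF r'(1) smooth_on_subset[OF fs r'(2)]] by blast
    define G where "G i = chart_ext c ?u r (g i)" for i
    have G: "G i \<in> smooth_functions A" "G i x = b * frechet_derivative ?f (at ?u) i" if "i \<in> Basis" for i
      unfolding G_def using g that by (auto intro!: ext simp: ext_x b_def)
    have "f y * (\<beta> y * \<beta> y) = f x * (\<beta> y * \<beta> y) + (\<Sum>i\<in>Basis. X i y * G i y)" for y
    proof (cases "y \<in> chart_dom c \<and> chart_map c y \<in> ball ?u r")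
      case True
      then have y: "y \<in> chart_dom c" "chart_map c y \<in> ball ?u r'" using r(2) ball_subset_cball by blast+
      have "f y = f x + (\<Sum>i\<in>Basis. ((chart_map c y - ?u) \<bullet> i) * g i (chart_map c y))"
        using g(2)[OF y(2)] inv_map[OF c(1) y(1)] fx by simp
      then show ?thesis using y
        by (simp add: \<beta>_def X_def G_def chart_ext_def sum_distrib_left sum_distrib_right algebra_simps)
    next
      case False
      then show ?thesis using r bump_eq_0[of r _ ?u] by (auto simp: \<beta>_def X_def G_def chart_ext_def)
    qed
    then have "v (\<lambda>y. f y * (\<beta> y * \<beta> y)) = v (\<lambda>y. f x * (\<beta> y * \<beta> y) + (\<Sum>i\<in>Basis. X i y * G i y))" by presburger
    also have "\<dots> = f x * v (\<lambda>y. \<beta> y * \<beta> y) + (\<Sum>i\<in>Basis. v (\<lambda>y. X i y * G i y))"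
    proof -
      have bb: "(\<lambda>y. \<beta> y * \<beta> y) \<in> smooth_functions A" by (intro smooth_functions_mult \<beta>)
      have xg: "(\<lambda>y. X i y * G i y) \<in> smooth_functions A" if "i \<in> Basis" for i by (intro smooth_functions_mult X G that)
      have "v (\<lambda>y. f x * (\<beta> y * \<beta> y) + (\<Sum>i\<in>Basis. X i y * G i y)) = v (\<lambda>y. f x * (\<beta> y * \<beta> y)) + v (\<lambda>y. \<Sum>i\<in>Basis. X i y * G i y)"
        by (rule vadd) (auto intro!: smooth_functions_mult[OF smooth_functions_const bb] smooth_functions_sum xg)
      then show ?thesis using vscale[OF bb bb, of "f x"] vsum[OF finite_Basis xg] by simp
    qed
    also have "(\<Sum>i\<in>Basis. v (\<lambda>y. X i y * G i y)) = (\<Sum>i\<in>Basis. b * frechet_derivative ?f (at ?u) i * v (X i))"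
      by (rule sum.cong[OF refl]) (simp add: vmult X G)
    finally have "b * b * v f = b * (\<Sum>i\<in>Basis. frechet_derivative ?f (at ?u) i * v (X i))"
      using vmult[OF True smooth_functions_mult[OF \<beta>(1) \<beta>(1)]] \<beta>(2)
      by (simp add: sum_distrib_left mult.assoc)
    then have "v f = (\<Sum>i\<in>Basis. frechet_derivative ?f (at ?u) i * v (X i)) / b" using b by (simp add: field_simps)
    also have "\<dots> = (\<Sum>i\<in>Basis. (w \<bullet> i) *\<^sub>R frechet_derivative ?f (at ?u) i)"
      unfolding sum_divide_distrib
      by (rule sum.cong) (auto simp: w_def inner_sum_left inner_Basis if_distrib cong: if_cong)
    also have "\<dots> = frechet_derivative ?f (at ?u) w"
      using frechet_derivative_expand[OF smooth_on_differentiable[OF fs map_in[OF c]]] by metis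
    finally show ?thesis using True by (simp add: coord_vector_def o_def)
  next
    case False
    then show ?thesis using vD by (simp add: coord_vector_def)
  qed
  then show ?thesis by blast
qed

end

end

section \<open>Flows on compact manifolds\<close>

context smooth_mfd
begin

lemma plot_local:
  assumes S: "open S" and loc: "\<And>z. z \<in> S \<Longrightarrow> \<exists>U. z \<in> U \<and> plot A U p"
  shows "plot A S p"
proof (rule plotI_local[OF S])
  fix z assume "z \<in> S"
  then obtain U where U: "z \<in> U" "plot A U p" using loc by blast
  obtain d where d: "d \<in> A" "p z \<in> chart_dom d" by (rule chart_at)
  have "open (U \<inter> p -` chart_dom d)" by (rule plot_open_preimage[OF U(2) open_dom[OF d(1)]])
  with plot_smooth[OF U(2) d(1)] U d
  show "\<exists>d\<in>A. \<exists>U. open U \<and> z \<in> U \<and> p ` U \<subseteq> chart_dom d \<and> smooth_on U (\<lambda>z. chart_map d (p z))"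
    by (intro bexI[of _ d] exI[of _ "U \<inter> p -` chart_dom d"]) auto
qed

end

locale compact_mfd_field = smooth_mfd A
  for A :: "('m::{t2_space,second_countable_topology}, 'e::euclidean_space) chart set" +
  fixes X :: "'m \<Rightarrow> 'm tvec"
  assumes X: "X \<in> vector_fields A" and compact_mfd: "compact (UNIV :: 'm set)"
begin

definition xi :: "('m, 'e) chart \<Rightarrow> 'e \<Rightarrow> 'e" where
  "xi c = (SOME \<xi>. smooth_on (chart_img c) \<xi> \<and>
        (\<forall>x\<in>chart_dom c. X x = coord_vector A c x (\<xi> (chart_map c x))))"

lemma xi:
  assumes "c \<in> A"
  shows "smooth_on (chart_img c) (xi c)"
    "x \<in> chart_dom c \<Longrightarrow> X x = coord_vector A c x (xi c (chart_map c x))"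
proof -
  have "\<exists>\<xi>. smooth_on (chart_img c) \<xi> \<and> (\<forall>x\<in>chart_dom c. X x = coord_vector A c x (\<xi> (chart_map c x)))"
    using X assms unfolding vector_fields_def by blast
  from someI_ex[OF this, folded xi_def]
  show "smooth_on (chart_img c) (xi c)"
    "x \<in> chart_dom c \<Longrightarrow> X x = coord_vector A c x (xi c (chart_map c x))" by blast+
qed

text \<open>The transformation law of the components of a vector field: both sides are coordinates
  of the same vector in the chart \<open>d\<close>, where coordinates are unique.\<close>

lemma xi_transition:
  assumes c: "c \<in> A" "x \<in> chart_dom c" and d: "d \<in> A" "x \<in> chart_dom d"
  shows "xi d (chart_map d x) =
    frechet_derivative (\<lambda>u. chart_map d (chart_inv c u)) (at (chart_map c x)) (xi c (chart_map c x))"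
proof (rule coord_vector_inject[OF d])
  have "coord_vector A d x (xi d (chart_map d x)) = plot_vec A (chart_inv c) (chart_map c x) (xi c (chart_map c x))"
    using xi(2)[OF c] xi(2)[OF d] by (simp add: coord_vector_eq_plot_vec)
  also have "\<dots> = coord_vector A d x (frechet_derivative (\<lambda>u. chart_map d (chart_inv c u)) (at (chart_map c x)) (xi c (chart_map c x)))"
    using plot_vec_coord[OF plot_chart_inv[OF c(1)] map_in[OF c] d(1)] d inv_map[OF c] by simp
  finally show "coord_vector A d x (xi d (chart_map d x)) =
    coord_vector A d x (frechet_derivative (\<lambda>u. chart_map d (chart_inv c u)) (at (chart_map c x)) (xi c (chart_map c x)))" .
qed

section \<open>Integral curves\<close>

definition int_curve :: "real set \<Rightarrow> (real \<Rightarrow> 'm) \<Rightarrow> bool" where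
  "int_curve I \<gamma> \<longleftrightarrow> open I \<and> continuous_on I \<gamma> \<and> (\<forall>c\<in>A. \<forall>t\<in>I. \<gamma> t \<in> chart_dom c \<longrightarrow>
     ((\<lambda>s. chart_map c (\<gamma> s)) has_vector_derivative xi c (chart_map c (\<gamma> t))) (at t))"

lemma int_curve_subset: "int_curve I \<gamma> \<Longrightarrow> open J \<Longrightarrow> J \<subseteq> I \<Longrightarrow> int_curve J \<gamma>"
  unfolding int_curve_def by (meson continuous_on_subset subsetD)

lemma int_curve_local:
  assumes "\<And>t. t \<in> I \<Longrightarrow> \<exists>J. t \<in> J \<and> int_curve J \<gamma>" "open I"
  shows "int_curve I \<gamma>"
  unfolding int_curve_def
proof (intro conjI ballI impI assms)
  show "continuous_on I \<gamma>"
    using assms unfolding int_curve_def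
    by (metis continuous_at_imp_continuous_on continuous_on_eq_continuous_at)
  fix c t assume "c \<in> A" "t \<in> I" "\<gamma> t \<in> chart_dom c"
  then show "((\<lambda>s. chart_map c (\<gamma> s)) has_vector_derivative xi c (chart_map c (\<gamma> t))) (at t)"
    using assms(1) unfolding int_curve_def by blast
qed

lemma int_curve_cong:
  assumes g: "int_curve I \<gamma>" and eq: "\<And>t. t \<in> I \<Longrightarrow> \<gamma> t = \<gamma>' t"
  shows "int_curve I \<gamma>'"
  unfolding int_curve_def
proof (intro conjI ballI impI)
  have I: "open I" and cg: "continuous_on I \<gamma>" using g by (auto simp: int_curve_def)
  show "open I" by (rule I)
  show "continuous_on I \<gamma>'" by (rule continuous_on_eq[OF cg eq])
  fix c t assume c: "c \<in> A" "t \<in> I" "\<gamma>' t \<in> chart_dom c"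
  have "((\<lambda>s. chart_map c (\<gamma> s)) has_vector_derivative xi c (chart_map c (\<gamma> t))) (at t)"
    using g c eq unfolding int_curve_def by metis
  then have "((\<lambda>s. chart_map c (\<gamma>' s)) has_vector_derivative xi c (chart_map c (\<gamma> t))) (at t)"
    by (rule has_vector_derivative_transform_within_open[OF _ I c(2)]) (simp add: eq)
  then show "((\<lambda>s. chart_map c (\<gamma>' s)) has_vector_derivative xi c (chart_map c (\<gamma>' t))) (at t)"
    using eq c by simp
qed

lemma int_curve_shift:
  assumes g: "int_curve I \<gamma>"
  shows "int_curve ((\<lambda>s. s + a) -` I) (\<lambda>s. \<gamma> (s + a))"
  unfolding int_curve_def
proof (intro conjI ballI impI)
  have I: "open I" and cg: "continuous_on I \<gamma>" using g by (auto simp: int_curve_def)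
  show "open ((\<lambda>s. s + a) -` I)" by (intro open_vimage I continuous_intros)
  show "continuous_on ((\<lambda>s. s + a) -` I) (\<lambda>s. \<gamma> (s + a))"
    by (rule continuous_on_compose2[OF cg]) (auto intro!: continuous_intros)
  fix c t assume c: "c \<in> A" "t \<in> (\<lambda>s. s + a) -` I" "\<gamma> (t + a) \<in> chart_dom c"
  have "((\<lambda>s. chart_map c (\<gamma> s)) has_vector_derivative xi c (chart_map c (\<gamma> (t + a)))) (at (t + a))"
    using g c unfolding int_curve_def by auto
  moreover have "((\<lambda>s. s + a) has_vector_derivative 1) (at t)"
    by (auto simp: has_vector_derivative_def intro!: derivative_eq_intros)
  ultimately show "((\<lambda>s. chart_map c (\<gamma> (s + a))) has_vector_derivative xi c (chart_map c (\<gamma> (t + a)))) (at t)"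
    using vector_diff_chain_at[of "\<lambda>s. s + a" 1 t] by (fastforce simp: o_def)
qed

text \<open>\<open>int_curve\<close> demands the differential equation in every chart, which makes
  restricting and gluing immediate. The price is paid here once: a solution in one chart solves the
  equation in the others by the transformation law of the components.\<close>

lemma int_curve_chartI:
  assumes J: "open J" and c: "c \<in> A" and y: "y ` J \<subseteq> chart_img c"
    and der: "\<And>t. t \<in> J \<Longrightarrow> (y has_vector_derivative xi c (y t)) (at t)"
  shows "int_curve J (\<lambda>t. chart_inv c (y t))"
  unfolding int_curve_def
proof (intro conjI ballI impI J)
  have cy: "continuous_on J y"
    using der by (auto intro!: continuous_at_imp_continuous_on has_vector_derivative_continuous)
  show "continuous_on J (\<lambda>t. chart_inv c (y t))"
    by (rule continuous_on_compose2[OF inv_cont[OF c] cy y])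
  fix d t assume d: "d \<in> A" and t: "t \<in> J" and ty: "chart_inv c (y t) \<in> chart_dom d"
  have yt: "y t \<in> chart_img c" using y t by blast
  let ?T = "\<lambda>u. chart_map d (chart_inv c u)"
  have "(?T has_derivative frechet_derivative ?T (at (y t))) (at (y t))"
    by (rule smooth_on_has_derivative[OF transition(2)[OF c d]]) (use yt ty in auto)
  from vector_derivative_diff_chain_within[OF der[OF t] has_derivative_at_withinI[OF this]]
  have "((\<lambda>s. ?T (y s)) has_vector_derivative frechet_derivative ?T (at (y t)) (xi c (y t))) (at t)"
    by (simp add: o_def)
  also have "frechet_derivative ?T (at (y t)) (xi c (y t)) = xi d (?T (y t))"
    using xi_transition[OF c inv_in[OF c yt] d ty] map_inv[OF c yt] by simp
  finally show "((\<lambda>s. ?T (y s)) has_vector_derivative xi d (?T (y t))) (at t)" .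
qed

lemma int_curve_unique_local:
  assumes g: "int_curve I \<gamma>" "int_curve I \<gamma>'" and t: "t \<in> I" "\<gamma> t = \<gamma>' t"
  shows "\<exists>e>0. ball t e \<subseteq> I \<and> (\<forall>s\<in>ball t e. \<gamma> s = \<gamma>' s)"
proof -
  obtain c where c: "c \<in> A" "\<gamma> t \<in> chart_dom c" by (rule chart_at)
  have I: "open I" and cg: "continuous_on I \<gamma>" "continuous_on I \<gamma>'" using g by (auto simp: int_curve_def)
  obtain R L where R: "0 < R" "ball (chart_map c (\<gamma> t)) R \<subseteq> chart_img c"
    and L: "\<And>x y. x \<in> ball (chart_map c (\<gamma> t)) R \<Longrightarrow> y \<in> ball (chart_map c (\<gamma> t)) R \<Longrightarrow> norm (xi c x - xi c y) \<le> L * norm (x - y)"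
    using smooth_locally_lipschitz[OF xi(1)[OF c(1)] open_img[OF c(1)] map_in[OF c]] by metis
  define V where "V = chart_dom c \<inter> chart_map c -` ball (chart_map c (\<gamma> t)) R"
  have V: "open V" unfolding V_def by (rule continuous_open_preimage[OF map_cont[OF c(1)] open_dom[OF c(1)] open_ball])
  have "open ((I \<inter> \<gamma> -` V) \<inter> (I \<inter> \<gamma>' -` V))" by (intro open_Int[of "I \<inter> \<gamma> -` V"] continuous_open_preimage cg I V)
  moreover have "t \<in> (I \<inter> \<gamma> -` V) \<inter> (I \<inter> \<gamma>' -` V)" using t c R by (auto simp: V_def)
  ultimately obtain e where e: "e > 0" "ball t e \<subseteq> (I \<inter> \<gamma> -` V) \<inter> (I \<inter> \<gamma>' -` V)" using open_contains_ball by blast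
  have be: "ball t e = {t - e<..<t + e}" by (simp add: ball_eq_greaterThanLessThan)
  have "\<gamma> s = \<gamma>' s" if s: "s \<in> ball t e" for s
  proof -
    have "chart_map c (\<gamma> s) - chart_map c (\<gamma>' s) = 0"
    proof (rule gronwall_zero[of "t - e" "t + e" "\<lambda>s. chart_map c (\<gamma> s) - chart_map c (\<gamma>' s)"
          "\<lambda>s. xi c (chart_map c (\<gamma> s)) - xi c (chart_map c (\<gamma>' s))" L t])
      fix s assume "s \<in> {t - e<..<t + e}"
      then have s: "s \<in> I" "\<gamma> s \<in> V" "\<gamma>' s \<in> V" using e(2) unfolding be by blast+
      show "((\<lambda>s. chart_map c (\<gamma> s) - chart_map c (\<gamma>' s)) has_vector_derivative
          xi c (chart_map c (\<gamma> s)) - xi c (chart_map c (\<gamma>' s))) (at s)"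
        using g s c unfolding int_curve_def V_def by (intro has_vector_derivative_diff) blast+
      show "norm (xi c (chart_map c (\<gamma> s)) - xi c (chart_map c (\<gamma>' s))) \<le> L * norm (chart_map c (\<gamma> s) - chart_map c (\<gamma>' s))"
        using s by (intro L) (auto simp: V_def)
    qed (use t e s in \<open>auto simp: be\<close>)
    moreover have "\<gamma> s \<in> chart_dom c" "\<gamma>' s \<in> chart_dom c" using s e by (auto simp: V_def)
    ultimately show ?thesis using inv_map[OF c(1)] by (metis eq_iff_diff_eq_0)
  qed
  then show ?thesis using e by blast
qed

text \<open>The set of agreement is open by local uniqueness, the set of disagreement is open
  because the manifold is Hausdorff, and a connected interval cannot be split by the two.\<close>

lemma int_curve_unique:
  assumes g: "int_curve I \<gamma>" "int_curve I \<gamma>'" and I: "connected I" and t0: "t0 \<in> I" "\<gamma> t0 = \<gamma>' t0" and t: "t \<in> I"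
  shows "\<gamma> t = \<gamma>' t"
proof (rule ccontr)
  assume ne: "\<gamma> t \<noteq> \<gamma>' t"
  have oI: "open I" and cg: "continuous_on I \<gamma>" "continuous_on I \<gamma>'" using g by (auto simp: int_curve_def)
  define E where "E = {s \<in> I. \<gamma> s = \<gamma>' s}"
  define N where "N = {s \<in> I. \<gamma> s \<noteq> \<gamma>' s}"
  have "\<exists>e>0. ball s e \<subseteq> E" if "s \<in> E" for s
    using int_curve_unique_local[OF g, of s] that unfolding E_def by blast
  then have oE: "open E" using open_contains_ball by blast
  have oN: "open N"
  proof (subst open_subopen, rule ballI)
    fix s assume s: "s \<in> N"
    then obtain U V where UV: "open U" "open V" "\<gamma> s \<in> U" "\<gamma>' s \<in> V" "U \<inter> V = {}"
      using hausdorff[of "\<gamma> s" "\<gamma>' s"] by (auto simp: N_def)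
    have "open ((I \<inter> \<gamma> -` U) \<inter> (I \<inter> \<gamma>' -` V))"
      by (intro open_Int[of "I \<inter> \<gamma> -` U"] continuous_open_preimage cg oI UV)
    then show "\<exists>T. open T \<and> s \<in> T \<and> T \<subseteq> N"
      using UV s by (intro exI[of _ "(I \<inter> \<gamma> -` U) \<inter> (I \<inter> \<gamma>' -` V)"]) (auto simp: N_def)
  qed
  show False
    using connectedD[OF I oE oN] t t0 ne by (auto simp: E_def N_def)
qed

text \<open>\<open>U\<close> is the chart preimage of the ball supplied by
  \<open>local_flow\<close>. Smoothness is stated over the chart image of \<open>U\<close> because
  plots have Euclidean parameters.\<close>

lemma local_flow_mfd:
  "\<exists>U e F. open U \<and> x0 \<in> U \<and> e > 0 \<and> (\<forall>x\<in>U. int_curve {-e<..<e} (\<lambda>t. F t x) \<and> F 0 x = x) \<and>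
    (\<exists>c\<in>A. U \<subseteq> chart_dom c \<and> plot A ({-e<..<e} \<times> chart_map c ` U) (\<lambda>z. F (fst z) (chart_inv c (snd z))))"
proof -
  obtain c where c: "c \<in> A" "x0 \<in> chart_dom c" by (rule chart_at)
  obtain e r Fl where e: "0 < e" and r: "0 < r" "ball (chart_map c x0) r \<subseteq> chart_img c"
    and Fs: "smooth_on ({-e<..<e} \<times> ball (chart_map c x0) r) Fl" and F0: "\<And>u. Fl (0, u) = u"
    and FV: "\<And>z. z \<in> {-e<..<e} \<times> ball (chart_map c x0) r \<Longrightarrow> Fl z \<in> chart_img c"
    and Fd: "\<And>t u. t \<in> {-e<..<e} \<Longrightarrow> u \<in> ball (chart_map c x0) r \<Longrightarrow>
      ((\<lambda>t. Fl (t, u)) has_vector_derivative xi c (Fl (t, u))) (at t)"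
    by (rule local_flow[OF open_img[OF c(1)] map_in[OF c] xi(1)[OF c(1)]]) blast
  let ?B = "ball (chart_map c x0) r"
  define U where "U = chart_dom c \<inter> chart_map c -` ?B"
  define F where "F t x = chart_inv c (Fl (t, chart_map c x))" for t x
  have U: "open U" unfolding U_def by (rule continuous_open_preimage[OF map_cont[OF c(1)] open_dom[OF c(1)] open_ball])
  have xU: "x0 \<in> U" using c r by (simp add: U_def)
  have cU: "chart_map c ` U = ?B"
    using r inv_in[OF c(1)] map_inv[OF c(1)] by (force simp: U_def image_iff)
  have "int_curve {-e<..<e} (\<lambda>t. F t x)" "F 0 x = x" if "x \<in> U" for x
  proof -
    have x: "x \<in> chart_dom c" "chart_map c x \<in> ?B" using that by (auto simp: U_def)
    show "F 0 x = x" using inv_map[OF c(1) x(1)] by (simp add: F_def F0)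
    show "int_curve {-e<..<e} (\<lambda>t. F t x)"
      unfolding F_def by (rule int_curve_chartI[OF _ c(1)]) (use Fd FV x in auto)
  qed
  moreover have "plot A ({-e<..<e} \<times> chart_map c ` U) (\<lambda>z. F (fst z) (chart_inv c (snd z)))"
  proof -
    have o: "open ({-e<..<e} \<times> ?B)" by (auto intro: open_Times)
    have "plot A ({-e<..<e} \<times> ?B) (\<lambda>z. chart_inv c (Fl z))"
      by (rule plot_compose[OF plot_chart_inv[OF c(1)] Fs o]) (use FV in blast)
    then have "plot A ({-e<..<e} \<times> ?B) (\<lambda>z. F (fst z) (chart_inv c (snd z)))"
      by (rule plot_cong) (use map_inv[OF c(1)] r in \<open>auto simp: F_def\<close>)
    then show ?thesis by (simp only: cU)
  qed
  moreover have "U \<subseteq> chart_dom c" by (auto simp: U_def)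
  ultimately show ?thesis using U xU e c by blast
qed

section \<open>Completeness of the field\<close>

definition lives :: "real \<Rightarrow> bool" where
  "lives e \<longleftrightarrow> (\<forall>x. \<exists>\<gamma>. int_curve {-e<..<e} \<gamma> \<and> \<gamma> 0 = x)"

text \<open>Since the lifetime is the same at all points, a curve restarted at its values at the
  times \<open>e / 2\<close> and \<open>- (e / 2)\<close> runs on for another \<open>e\<close> from
  there. The three pieces overlap and agree by uniqueness, so the lifetime grows by the factor
  3/2.\<close>

lemma lives_extend:
  assumes l: "lives e" and e: "0 < e"
  shows "lives (e + e / 2)"
  unfolding lives_def
proof
  fix x
  obtain \<gamma> where \<gamma>: "int_curve {-e<..<e} \<gamma>" "\<gamma> 0 = x" using l unfolding lives_def by blast
  obtain \<gamma>1 where \<gamma>1: "int_curve {-e<..<e} \<gamma>1" "\<gamma>1 0 = \<gamma> (e / 2)" using l unfolding lives_def by blast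
  obtain \<gamma>2 where \<gamma>2: "int_curve {-e<..<e} \<gamma>2" "\<gamma>2 0 = \<gamma> (- (e / 2))" using l unfolding lives_def by blast
  define \<mu> where "\<mu> s = (if s \<ge> e / 2 then \<gamma>1 (s - e / 2) else if s \<le> - (e / 2) then \<gamma>2 (s + e / 2) else \<gamma> s)" for s
  have sh1: "int_curve {-(e / 2)<..<e + e / 2} (\<lambda>s. \<gamma>1 (s - e / 2))"
    by (rule int_curve_subset[OF int_curve_shift[OF \<gamma>1(1), of "- (e / 2)", simplified]]) auto
  have sh2: "int_curve {-(e + e / 2)<..<e / 2} (\<lambda>s. \<gamma>2 (s + e / 2))"
    by (rule int_curve_subset[OF int_curve_shift[OF \<gamma>2(1), of "e / 2"]]) auto
  \<comment> \<open>The piece must agree with \<gamma> on a whole open interval, not just at the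
    restart time, for the definition by cases to be an integral curve across it.\<close>
  have eq1: "\<gamma>1 (s - e / 2) = \<gamma> s" if "s \<in> {-(e / 2)<..<e}" for s
    by (rule int_curve_unique[of "{-(e / 2)<..<e}" "\<lambda>s. \<gamma>1 (s - e / 2)" \<gamma> "e / 2"])
      (use \<gamma>1(2) e that in \<open>auto intro: int_curve_subset[OF sh1] int_curve_subset[OF \<gamma>(1)]\<close>)
  have eq2: "\<gamma>2 (s + e / 2) = \<gamma> s" if "s \<in> {-e<..<e / 2}" for s
    by (rule int_curve_unique[of "{-e<..<e / 2}" "\<lambda>s. \<gamma>2 (s + e / 2)" \<gamma> "- (e / 2)"])
      (use \<gamma>2(2) e that in \<open>auto intro: int_curve_subset[OF sh2] int_curve_subset[OF \<gamma>(1)]\<close>)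
  have "int_curve {-(e + e / 2)<..<e + e / 2} \<mu>"
  proof (rule int_curve_local)
    fix t assume t: "t \<in> {-(e + e / 2)<..<e + e / 2}"
    consider "t \<in> {-e<..<e}" | "t \<in> {e / 2<..<e + e / 2}" | "t \<in> {-(e + e / 2)<..<-(e / 2)}"
      using t e by fastforce
    then show "\<exists>J. t \<in> J \<and> int_curve J \<mu>"
    proof cases
      case 1
      have "int_curve {-e<..<e} \<mu>"
        by (rule int_curve_cong[OF \<gamma>(1)]) (use eq1 eq2 e in \<open>auto simp: \<mu>_def\<close>)
      then show ?thesis using 1 by blast
    next
      case 2
      have "int_curve {e / 2<..<e + e / 2} (\<lambda>s. \<gamma>1 (s - e / 2))"
        by (rule int_curve_subset[OF sh1]) (use e in auto)
      then have "int_curve {e / 2<..<e + e / 2} \<mu>"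
        by (rule int_curve_cong) (use e in \<open>auto simp: \<mu>_def\<close>)
      then show ?thesis using 2 by blast
    next
      case 3
      have "int_curve {-(e + e / 2)<..<-(e / 2)} (\<lambda>s. \<gamma>2 (s + e / 2))"
        by (rule int_curve_subset[OF sh2]) (use e in auto)
      then have "int_curve {-(e + e / 2)<..<-(e / 2)} \<mu>"
        by (rule int_curve_cong) (use e in \<open>auto simp: \<mu>_def\<close>)
      then show ?thesis using 3 by blast
    qed
  qed auto
  moreover have "\<mu> 0 = x" using \<gamma>(2) e by (simp add: \<mu>_def)
  ultimately show "\<exists>\<gamma>. int_curve {-(e + e / 2)<..<e + e / 2} \<gamma> \<and> \<gamma> 0 = x" by blast
qed

text \<open>By compactness finitely many flow boxes cover the manifold, and the least of their times
  is positive and works at every point.\<close>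

lemma uniform_local_flow:
  "\<exists>e>0. lives e \<and> (\<forall>x0. \<exists>U F. open U \<and> x0 \<in> U \<and> (\<forall>x\<in>U. int_curve {-e<..<e} (\<lambda>t. F t x) \<and> F 0 x = x) \<and>
    (\<exists>c\<in>A. U \<subseteq> chart_dom c \<and> plot A ({-e<..<e} \<times> chart_map c ` U) (\<lambda>z. F (fst z) (chart_inv c (snd z)))))"
proof -
  define P where "P x0 U e F \<longleftrightarrow> open U \<and> x0 \<in> U \<and> e > 0 \<and> (\<forall>x\<in>U. int_curve {-e<..<e} (\<lambda>t. F t x) \<and> F 0 x = x) \<and>
    (\<exists>c\<in>A. U \<subseteq> chart_dom c \<and> plot A ({-e<..<e} \<times> chart_map c ` U) (\<lambda>z. F (fst z) (chart_inv c (snd z))))"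
    for x0 U e F
  have "\<exists>U e F. P x0 U e F" for x0 using local_flow_mfd unfolding P_def .
  then obtain U e F where P: "\<And>x. P x (U x) (e x) (F x)" by metis
  have "\<exists>D. finite D \<and> UNIV \<subseteq> (\<Union>x\<in>D. U x)"
    using compactE_image[OF compact_mfd, of UNIV U] P unfolding P_def by (metis UNIV_I UN_I subsetI)
  then obtain D where D: "finite D" "UNIV \<subseteq> (\<Union>x\<in>D. U x)" by blast
  then have "D \<noteq> {}" by auto
  define e0 where "e0 = Min (e ` D)"
  have e0: "0 < e0" "\<And>x. x \<in> D \<Longrightarrow> e0 \<le> e x"
    using D \<open>D \<noteq> {}\<close> P by (auto simp: e0_def P_def)
  have Q: "\<exists>U F. open U \<and> x0 \<in> U \<and> (\<forall>x\<in>U. int_curve {-e0<..<e0} (\<lambda>t. F t x) \<and> F 0 x = x) \<and>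
    (\<exists>c\<in>A. U \<subseteq> chart_dom c \<and> plot A ({-e0<..<e0} \<times> chart_map c ` U) (\<lambda>z. F (fst z) (chart_inv c (snd z))))" for x0
  proof -
    obtain x where x: "x \<in> D" "x0 \<in> U x" using D by blast
    have sub: "{-e0<..<e0} \<subseteq> {-e x<..<e x}" using e0(2)[OF x(1)] by auto
    obtain c where c: "c \<in> A" "U x \<subseteq> chart_dom c"
      "plot A ({-e x<..<e x} \<times> chart_map c ` U x) (\<lambda>z. F x (fst z) (chart_inv c (snd z)))"
      using P[of x] unfolding P_def by blast
    have "open (chart_img c \<inter> chart_inv c -` U x)"
      using P[of x] unfolding P_def by (intro continuous_open_preimage inv_cont open_img c) auto
    moreover have "chart_map c ` U x = chart_img c \<inter> chart_inv c -` U x"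
      using c(2) map_in[OF c(1)] inv_map[OF c(1)] map_inv[OF c(1)] by (force simp: image_iff subset_iff)
    ultimately have "open ({-e0<..<e0} \<times> chart_map c ` U x)" by (auto intro: open_Times)
    then have "plot A ({-e0<..<e0} \<times> chart_map c ` U x) (\<lambda>z. F x (fst z) (chart_inv c (snd z)))"
      by (rule plot_subset[OF c(3)]) (use sub in auto)
    moreover have "int_curve {-e0<..<e0} (\<lambda>t. F x t y)" if "y \<in> U x" for y
      by (rule int_curve_subset[OF _ _ sub]) (use P[of x] that in \<open>auto simp: P_def\<close>)
    ultimately show ?thesis using P[of x] x c unfolding P_def by (intro exI[of _ "U x"] exI[of _ "F x"]) blast
  qed
  moreover have "lives e0" unfolding lives_def using Q by meson
  ultimately show ?thesis using e0(1) by blast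
qed

lemma lives_all: "lives a"
proof -
  obtain e where e: "e > 0" "lives e" using uniform_local_flow by blast
  have "lives (e * (3/2) ^ n) \<and> 0 < e * (3/2) ^ n" for n
  proof (induction n)
    case (Suc n)
    have eq: "e * (3/2) ^ Suc n = e * (3/2) ^ n + e * (3/2) ^ n / 2" by simp
    show ?case unfolding eq using lives_extend[of "e * (3/2) ^ n"] Suc by auto
  qed (use e in simp)
  moreover obtain n where "a / e < (3/2) ^ n" using real_arch_pow[of "3/2" "a / e"] by auto
  then have "a < e * (3/2) ^ n" using e by (simp add: field_simps)
  ultimately show ?thesis
    unfolding lives_def
    by (metis (no_types, lifting) int_curve_subset greaterThanLessThan_subseteq_greaterThanLessThan less_eq_real_def neg_less_iff_less open_greaterThanLessThan)
qed

text \<open>A curve is chosen anew for each \<open>t\<close>, because curves are only available on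
  bounded intervals; the interval contains both 0 and \<open>t\<close>. By \<open>flow_eq\<close>
  the choice does not affect the value.\<close>

definition flow :: "real \<Rightarrow> 'm \<Rightarrow> 'm" where
  "flow t x = (SOME \<gamma>. int_curve {-(\<bar>t\<bar> + 1)<..<\<bar>t\<bar> + 1} \<gamma> \<and> \<gamma> 0 = x) t"

lemma flow_eq:
  assumes g: "int_curve {-a<..<a} \<gamma>" "\<gamma> 0 = x" and t: "\<bar>t\<bar> < a"
  shows "flow t x = \<gamma> t"
proof -
  define \<mu> where "\<mu> = (SOME \<gamma>. int_curve {-(\<bar>t\<bar> + 1)<..<\<bar>t\<bar> + 1} \<gamma> \<and> \<gamma> 0 = x)"
  have \<mu>: "int_curve {-(\<bar>t\<bar> + 1)<..<\<bar>t\<bar> + 1} \<mu>" "\<mu> 0 = x"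
    using someI_ex[of "\<lambda>\<gamma>. int_curve {-(\<bar>t\<bar> + 1)<..<\<bar>t\<bar> + 1} \<gamma> \<and> \<gamma> 0 = x"] lives_all unfolding lives_def \<mu>_def by blast+
  define b where "b = min a (\<bar>t\<bar> + 1)"
  have "int_curve {-b<..<b} \<mu>" by (rule int_curve_subset[OF \<mu>(1)]) (auto simp: b_def)
  moreover have "int_curve {-b<..<b} \<gamma>" by (rule int_curve_subset[OF g(1)]) (auto simp: b_def)
  ultimately have "\<mu> t = \<gamma> t"
    by (rule int_curve_unique[where ?t0.0 = 0]) (use \<mu> g t in \<open>auto simp: b_def\<close>)
  then show ?thesis by (simp add: flow_def \<mu>_def)
qed

lemma flow_0: "flow 0 x = x"
proof -
  obtain \<gamma> where "int_curve {-1<..<1} \<gamma>" "\<gamma> 0 = x" using lives_all[of 1] unfolding lives_def by blast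
  then show ?thesis using flow_eq[of 1 \<gamma> x 0] by simp
qed

lemma flow_int_curve: "int_curve UNIV (\<lambda>t. flow t x)"
proof (rule int_curve_local)
  fix t :: real
  obtain \<gamma> where \<gamma>: "int_curve {-(\<bar>t\<bar> + 1)<..<\<bar>t\<bar> + 1} \<gamma>" "\<gamma> 0 = x" using lives_all unfolding lives_def by blast
  have "int_curve {-(\<bar>t\<bar> + 1)<..<\<bar>t\<bar> + 1} (\<lambda>t. flow t x)"
    by (rule int_curve_cong[OF \<gamma>(1)]) (rule flow_eq[OF \<gamma>, symmetric], auto)
  then show "\<exists>J. t \<in> J \<and> int_curve J (\<lambda>t. flow t x)" by (intro exI[of _ "{-(\<bar>t\<bar> + 1)<..<\<bar>t\<bar> + 1}"]) auto
qed auto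

lemma flow_add: "flow s (flow t x) = flow (s + t) x"
proof -
  have "int_curve UNIV (\<lambda>s. flow (s + t) x)" using int_curve_shift[OF flow_int_curve, of t x] by simp
  then have "int_curve {-(\<bar>s\<bar> + 1)<..<\<bar>s\<bar> + 1} (\<lambda>s. flow (s + t) x)" by (rule int_curve_subset) auto
  from flow_eq[OF this, of "flow t x" s] show ?thesis by simp
qed

section \<open>Smoothness of the global flow\<close>

definition smooth_flow :: "real \<Rightarrow> bool" where
  "smooth_flow e \<longleftrightarrow> (\<forall>c\<in>A. plot A ({-e<..<e} \<times> chart_img c) (\<lambda>z. flow (fst z) (chart_inv c (snd z))))"

lemma smooth_flow_compose:
  assumes e: "smooth_flow e" and p: "plot A S p" and \<sigma>: "smooth_on S \<sigma>" "\<And>z. z \<in> S \<Longrightarrow> \<sigma> z \<in> {-e<..<e}"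
  shows "plot A S (\<lambda>z. flow (\<sigma> z) (p z))"
proof (rule plot_local[OF plot_open[OF p]])
  fix z assume z: "z \<in> S"
  obtain c where c: "c \<in> A" "p z \<in> chart_dom c" by (rule chart_at)
  let ?U = "S \<inter> p -` chart_dom c"
  have o: "open ?U" by (rule plot_open_preimage[OF p open_dom[OF c(1)]])
  have fl: "plot A ({-e<..<e} \<times> chart_img c) (\<lambda>z. flow (fst z) (chart_inv c (snd z)))"
    using e c by (auto simp: smooth_flow_def)
  have sm: "smooth_on ?U (\<lambda>z. (\<sigma> z, chart_map c (p z)))"
    by (intro smooth_on_Pair smooth_on_subset[OF \<sigma>(1)] plot_smooth[OF p c(1)] o) auto
  have im: "(\<lambda>z. (\<sigma> z, chart_map c (p z))) ` ?U \<subseteq> {-e<..<e} \<times> chart_img c"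
    using \<sigma>(2) map_in[OF c(1)] by auto
  have "plot A ?U (\<lambda>z. flow (\<sigma> z) (chart_inv c (chart_map c (p z))))"
    using plot_compose[OF fl sm o im] by simp
  then have "plot A ?U (\<lambda>z. flow (\<sigma> z) (p z))" by (rule plot_cong) (use inv_map[OF c(1)] in auto)
  then show "\<exists>U. z \<in> U \<and> plot A U (\<lambda>z. flow (\<sigma> z) (p z))"
    using z c by (intro exI[of _ ?U]) auto
qed

text \<open>By the group law the flow for time t is the flow for time t/2 applied twice, and
  composition preserves plots.\<close>

lemma smooth_flow_double:
  assumes e: "smooth_flow e"
  shows "smooth_flow (2 * e)"
  unfolding smooth_flow_def
proof
  fix c assume c: "c \<in> A"
  let ?S = "{-(2 * e)<..<2 * e} \<times> chart_img c"
  have o: "open ?S" by (intro open_Times open_img[OF c]) auto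
  have p: "plot A ?S (\<lambda>z. chart_inv c (snd z))"
    by (rule plot_compose[OF plot_chart_inv[OF c] smooth_on_snd[OF o] o]) auto
  have h: "smooth_on ?S (\<lambda>z. fst z / 2)"
    using o by (auto intro!: smooth_on_bounded_linear[OF bounded_linear_divide] smooth_intros)
  have "plot A ?S (\<lambda>z. flow (fst z / 2) (flow (fst z / 2) (chart_inv c (snd z))))"
    by (rule smooth_flow_compose[OF e smooth_flow_compose[OF e p h] h]) auto
  then show "plot A ?S (\<lambda>z. flow (fst z) (chart_inv c (snd z)))" by (simp add: flow_add)
qed

text \<open>For the uniform short time the flow coincides with the local flow boxes and is smooth;
  doubling then reaches every time, with no need to follow a long trajectory through successive
  charts.\<close>

lemma smooth_flow_all: "smooth_flow a"
proof -
  obtain e where e: "e > 0" and loc: "\<And>x0. \<exists>U F. open U \<and> x0 \<in> U \<and> (\<forall>x\<in>U. int_curve {-e<..<e} (\<lambda>t. F t x) \<and> F 0 x = x) \<and>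
    (\<exists>c\<in>A. U \<subseteq> chart_dom c \<and> plot A ({-e<..<e} \<times> chart_map c ` U) (\<lambda>z. F (fst z) (chart_inv c (snd z))))"
    using uniform_local_flow by blast
  have "smooth_flow e"
    unfolding smooth_flow_def
  proof
    fix d assume d: "d \<in> A"
    let ?S = "{-e<..<e} \<times> chart_img d"
    have oS: "open ?S" by (intro open_Times open_img[OF d]) auto
    show "plot A ?S (\<lambda>z. flow (fst z) (chart_inv d (snd z)))"
    proof (rule plot_local[OF oS])
      fix z assume z: "z \<in> ?S"
      obtain U F c where U: "open U" "chart_inv d (snd z) \<in> U" and F: "\<And>x. x \<in> U \<Longrightarrow> int_curve {-e<..<e} (\<lambda>t. F t x)" "\<And>x. x \<in> U \<Longrightarrow> F 0 x = x"
        and c: "c \<in> A" "U \<subseteq> chart_dom c" "plot A ({-e<..<e} \<times> chart_map c ` U) (\<lambda>z. F (fst z) (chart_inv c (snd z)))"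
        using loc[of "chart_inv d (snd z)"] by blast
      let ?W = "{-e<..<e} \<times> (chart_img d \<inter> chart_inv d -` U)"
      have oW: "open ?W" by (intro open_Times continuous_open_preimage inv_cont open_img d U) auto
      have "smooth_on ?W (\<lambda>z. chart_map c (chart_inv d (snd z)))"
        by (rule smooth_on_compose[OF transition(2)[OF d c(1)] smooth_on_snd[OF oW] oW]) (use c(2) in auto)
      then have sm: "smooth_on ?W (\<lambda>z. (fst z, chart_map c (chart_inv d (snd z))))"
        by (intro smooth_on_Pair smooth_on_fst oW)
      have "plot A ?W (\<lambda>z. F (fst z) (chart_inv c (chart_map c (chart_inv d (snd z)))))"
      proof -
        have im: "(\<lambda>z. (fst z, chart_map c (chart_inv d (snd z)))) ` ?W \<subseteq> {-e<..<e} \<times> chart_map c ` U" by auto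
        from plot_compose[OF c(3) sm oW im] show ?thesis by simp
      qed
      then have "plot A ?W (\<lambda>z. flow (fst z) (chart_inv d (snd z)))"
      proof (rule plot_cong)
        fix z assume z: "z \<in> ?W"
        then have "flow (fst z) (chart_inv d (snd z)) = F (fst z) (chart_inv d (snd z))"
          by (intro flow_eq[of e] F) auto
        moreover have "chart_inv c (chart_map c (chart_inv d (snd z))) = chart_inv d (snd z)"
          using z c by (intro inv_map) auto
        ultimately show "F (fst z) (chart_inv c (chart_map c (chart_inv d (snd z)))) = flow (fst z) (chart_inv d (snd z))"
          by simp
      qed
      then show "\<exists>U. z \<in> U \<and> plot A U (\<lambda>z. flow (fst z) (chart_inv d (snd z)))"
        using z U by (intro exI[of _ ?W]) auto
    qed
  qed
  then have dbl: "smooth_flow (2 ^ n * e)" for n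
  proof (induction n)
    case (Suc n)
    then show ?case using smooth_flow_double[of "2 ^ n * e"] by (simp add: mult.assoc)
  qed simp
  obtain n where "a / e < 2 ^ n" using real_arch_pow[of 2 "a / e"] by auto
  then have a: "a < 2 ^ n * e" using e by (simp add: field_simps)
  show ?thesis
    unfolding smooth_flow_def
  proof
    fix c assume c: "c \<in> A"
    have "plot A ({-(2 ^ n * e)<..<2 ^ n * e} \<times> chart_img c) (\<lambda>z. flow (fst z) (chart_inv c (snd z)))"
      using dbl[of n] c unfolding smooth_flow_def by blast
    moreover have "open ({-a<..<a} \<times> chart_img c)" by (intro open_Times open_img c) auto
    ultimately show "plot A ({-a<..<a} \<times> chart_img c) (\<lambda>z. flow (fst z) (chart_inv c (snd z)))"
      by (rule plot_subset) (use a in auto)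
  qed
qed

text \<open>\<open>smooth_flow\<close> covers a bounded range of times, whereas \<sigma> may be
  unbounded on \<open>S\<close>. Near each parameter \<sigma> stays below its absolute value there
  plus 1.\<close>

lemma flow_plot:
  assumes p: "plot A S p" and \<sigma>: "smooth_on S \<sigma>"
  shows "plot A S (\<lambda>z. flow (\<sigma> z) (p z))"
proof (rule plot_local[OF plot_open[OF p]])
  fix z assume z: "z \<in> S"
  let ?e = "\<bar>\<sigma> z\<bar> + 1"
  let ?U = "S \<inter> \<sigma> -` {-?e<..<?e}"
  have o: "open ?U" by (rule continuous_open_preimage[OF smooth_on_continuous[OF \<sigma>] plot_open[OF p]]) auto
  have "plot A ?U (\<lambda>z. flow (\<sigma> z) (p z))"
    by (rule smooth_flow_compose[OF smooth_flow_all[of ?e] plot_subset[OF p o] smooth_on_subset[OF \<sigma>]]) auto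
  then show "\<exists>U. z \<in> U \<and> plot A U (\<lambda>z. flow (\<sigma> z) (p z))" using z by (intro exI[of _ ?U]) auto
qed

lemma flow_plot_chart:
  assumes c: "c \<in> A"
  shows "plot A (UNIV \<times> chart_img c) (\<lambda>z. flow (fst z) (chart_inv c (snd z)))"
proof -
  have o: "open (UNIV \<times> chart_img c)" by (intro open_Times open_UNIV open_img[OF c])
  have "plot A (UNIV \<times> chart_img c) (\<lambda>z. chart_inv c (snd z))"
    by (rule plot_compose[OF plot_chart_inv[OF c] smooth_on_snd[OF o] o]) auto
  then show ?thesis by (rule flow_plot[OF _ smooth_on_fst[OF o]])
qed

lemma flow_time_vec:
  assumes c: "c \<in> A" and z: "z \<in> UNIV \<times> chart_img c"
  shows "plot_vec A (\<lambda>z. flow (fst z) (chart_inv c (snd z))) z (1, 0) = X (flow (fst z) (chart_inv c (snd z)))"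
proof -
  let ?p = "\<lambda>z. flow (fst z) (chart_inv c (snd z))"
  obtain d where d: "d \<in> A" "?p z \<in> chart_dom d" by (rule chart_at)
  let ?q = "\<lambda>z. chart_map d (?p z)"
  have sm: "(?q has_derivative frechet_derivative ?q (at z)) (at z)"
    by (rule smooth_on_has_derivative[OF plot_smooth[OF flow_plot_chart[OF c] d(1)]]) (use z d in auto)
  have "((\<lambda>t. (t, snd z)) has_derivative (\<lambda>h. (h, 0))) (at (fst z))"
    by (auto intro!: derivative_eq_intros)
  from has_derivative_compose[OF this, of ?q] sm
  have "((\<lambda>t. ?q (t, snd z)) has_derivative (\<lambda>h. frechet_derivative ?q (at z) (h, 0))) (at (fst z))" by simp
  moreover have "((\<lambda>t. ?q (t, snd z)) has_derivative (\<lambda>h. h *\<^sub>R xi d (?q z))) (at (fst z))"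
    using flow_int_curve[of "chart_inv c (snd z)"] d unfolding int_curve_def has_vector_derivative_def by auto
  ultimately have "(\<lambda>h. frechet_derivative ?q (at z) (h, 0)) = (\<lambda>h. h *\<^sub>R xi d (?q z))"
    by (rule has_derivative_unique)
  then have "frechet_derivative ?q (at z) (1, 0) = xi d (?q z)" by (metis scaleR_one)
  then show ?thesis
    using plot_vec_coord[OF flow_plot_chart[OF c] z d, of "(1, 0)"] xi(2)[OF d] by simp
qed

end

section \<open>Closed forms along flows\<close>

lemma smooth_family_derivative_expand:
  fixes B :: "'e::euclidean_space \<Rightarrow> 'f::euclidean_space \<Rightarrow> real"
  assumes V: "open V" "u \<in> V" and B: "\<And>w. smooth_on V (\<lambda>u. B u w)" "\<And>u. u \<in> V \<Longrightarrow> linear (B u)"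
  shows "frechet_derivative (\<lambda>u. B u w) (at u) h = (\<Sum>i\<in>Basis. (w \<bullet> i) * frechet_derivative (\<lambda>u. B u i) (at u) h)"
proof -
  have dB: "((\<lambda>u. B u i) has_derivative frechet_derivative (\<lambda>u. B u i) (at u)) (at u)" for i
    using smooth_on_has_derivative[OF B(1) V(2)] .
  have "((\<lambda>u. \<Sum>i\<in>Basis. (w \<bullet> i) * B u i) has_derivative
      (\<lambda>h. \<Sum>i\<in>Basis. (w \<bullet> i) * frechet_derivative (\<lambda>u. B u i) (at u) h)) (at u)"
    by (intro has_derivative_sum has_derivative_mult_right dB)
  then have "((\<lambda>u. B u w) has_derivative (\<lambda>h. \<Sum>i\<in>Basis. (w \<bullet> i) * frechet_derivative (\<lambda>u. B u i) (at u) h)) (at u)"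
    by (rule has_derivative_transform_within_open[OF _ V]) (simp add: linear_expand_Basis[OF B(2), of _ w])
  from has_derivative_unique[OF dB this] show ?thesis by (rule fun_cong)
qed

lemma has_derivative_transform_near:
  assumes f: "(f has_derivative f') (at z)" and q: "(q has_derivative q') (at z)" "open V" "q z \<in> V"
    and eq: "\<And>y. q y \<in> V \<Longrightarrow> f y = g y"
  shows "(g has_derivative f') (at z)"
proof -
  have "\<forall>\<^sub>F y in at z. q y \<in> V"
    using has_derivative_continuous[OF q(1)] q unfolding continuous_at by (auto intro: topological_tendstoD)
  then have "\<forall>\<^sub>F y in at z. f y = g y" by eventually_elim (rule eq)
  then show ?thesis by (rule has_derivative_transform_eventually[OF f]) (simp_all add: eq q)
qed

text \<open>A product rule for a linear form with moving base point \<open>q z\<close> and moving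
  argument \<open>Q z\<close>. Expanding the argument over the basis reduces it to products of
  scalar functions; the expansion is valid only over \<open>V\<close>, hence near
  \<open>z\<close>.\<close>

lemma smooth_family_linear_has_derivative:
  fixes B :: "'e::euclidean_space \<Rightarrow> 'f::euclidean_space \<Rightarrow> real"
    and q :: "'p::euclidean_space \<Rightarrow> 'e"
  assumes V: "open V" "q z \<in> V" and B: "\<And>w. smooth_on V (\<lambda>u. B u w)" "\<And>u. u \<in> V \<Longrightarrow> linear (B u)"
    and q: "(q has_derivative q') (at z)" and Q: "(Q has_derivative Q') (at z)"
  shows "((\<lambda>z. B (q z) (Q z)) has_derivative
    (\<lambda>v. frechet_derivative (\<lambda>u. B u (Q z)) (at (q z)) (q' v) + B (q z) (Q' v))) (at z)"
proof -
  note ex = linear_expand_Basis[OF B(2), simplified]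
  let ?D = "\<lambda>i. frechet_derivative (\<lambda>u. B u i) (at (q z))"
  have dB: "((\<lambda>u. B u i) has_derivative ?D i) (at (q z))" for i
    using smooth_on_has_derivative[OF B(1) V(2)] .
  have "((\<lambda>z. \<Sum>i\<in>Basis. (Q z \<bullet> i) * B (q z) i) has_derivative
      (\<lambda>v. \<Sum>i\<in>Basis. (Q z \<bullet> i) * ?D i (q' v) + (Q' v \<bullet> i) * B (q z) i)) (at z)"
    by (intro has_derivative_sum has_derivative_mult has_derivative_inner_left Q has_derivative_compose[OF q dB])
  then have "((\<lambda>z. \<Sum>i\<in>Basis. (Q z \<bullet> i) * B (q z) i) has_derivative
      (\<lambda>v. ?D (Q z) (q' v) + B (q z) (Q' v))) (at z)"
    by (rule has_derivative_eq_rhs)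
      (simp add: fun_eq_iff sum.distrib smooth_family_derivative_expand[OF V B, of "Q z"] ex[OF V(2), of "Q' _"])
  then show ?thesis by (rule has_derivative_transform_near[OF _ q V]) (simp add: ex[symmetric])
qed

lemma smooth_family_bilinear_has_derivative:
  fixes B :: "'e::euclidean_space \<Rightarrow> 'f::euclidean_space \<Rightarrow> 'f \<Rightarrow> real"
    and q :: "'p::euclidean_space \<Rightarrow> 'e"
  assumes V: "open V" "q z \<in> V" and B: "\<And>v w. smooth_on V (\<lambda>u. B u v w)"
    "\<And>u v. u \<in> V \<Longrightarrow> linear (B u v)" "\<And>u w. u \<in> V \<Longrightarrow> linear (\<lambda>v. B u v w)"
    and q: "(q has_derivative q') (at z)" and P: "(P has_derivative P') (at z)" and Q: "(Q has_derivative Q') (at z)"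
  shows "((\<lambda>z. B (q z) (P z) (Q z)) has_derivative
    (\<lambda>v. frechet_derivative (\<lambda>u. B u (P z) (Q z)) (at (q z)) (q' v) + B (q z) (P' v) (Q z) + B (q z) (P z) (Q' v))) (at z)"
proof -
  note ex = linear_expand_Basis[OF B(3), simplified]
  let ?D = "\<lambda>i. frechet_derivative (\<lambda>u. B u i (Q z)) (at (q z))"
  have l: "((\<lambda>z. B (q z) i (Q z)) has_derivative (\<lambda>v. ?D i (q' v) + B (q z) i (Q' v))) (at z)" for i
    by (rule smooth_family_linear_has_derivative[OF V B(1,2) q Q])
  have "((\<lambda>z. \<Sum>i\<in>Basis. (P z \<bullet> i) * B (q z) i (Q z)) has_derivative
      (\<lambda>v. \<Sum>i\<in>Basis. (P z \<bullet> i) * (?D i (q' v) + B (q z) i (Q' v)) + (P' v \<bullet> i) * B (q z) i (Q z))) (at z)"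
    by (intro has_derivative_sum has_derivative_mult has_derivative_inner_left P l)
  then have "((\<lambda>z. \<Sum>i\<in>Basis. (P z \<bullet> i) * B (q z) i (Q z)) has_derivative
      (\<lambda>v. ?D (P z) (q' v) + B (q z) (P' v) (Q z) + B (q z) (P z) (Q' v))) (at z)"
    by (rule has_derivative_eq_rhs)
      (simp add: fun_eq_iff sum.distrib distrib_left ex[OF V(2), of "P' _"] ex[OF V(2), of "P z"]
        smooth_family_derivative_expand[where B = "\<lambda>u v. B u v (Q z)" and w = "P z", OF V B(1,3)])
  then show ?thesis by (rule has_derivative_transform_near[OF _ q V]) (simp add: ex[symmetric])
qed

lemma constant_in_first_variable:
  fixes h :: "real \<times> 'p::euclidean_space \<Rightarrow> real"
  assumes h: "\<And>s. h differentiable (at (s, u))" "\<And>s. frechet_derivative h (at (s, u)) (1, 0) = 0"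
  shows "h (s, u) = h (0, u)"
proof -
  have "((\<lambda>s. h (s, u)) has_real_derivative 0) (at s)" for s
  proof -
    have f: "(h has_derivative frechet_derivative h (at (s, u))) (at (s, u))"
      using h(1) by (simp add: frechet_derivative_works)
    have "((\<lambda>s. (s, u)) has_derivative (\<lambda>r. (r, 0))) (at s)" by (auto intro!: derivative_eq_intros)
    from has_derivative_compose[OF this f]
    show ?thesis
      unfolding has_field_derivative_def
    proof (rule has_derivative_eq_rhs)
      have "frechet_derivative h (at (s, u)) (r *\<^sub>R (1, 0)) = 0" for r
        unfolding linear_scale[OF has_derivative_linear[OF f]] h(2) by simp
      then show "(\<lambda>r. frechet_derivative h (at (s, u)) (r, 0)) = (*) 0" by (simp add: fun_eq_iff)
    qed
  qed
  then show ?thesis by (rule DERIV_isconst_all[rule_format, of "\<lambda>s. h (s, u)"])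
qed

section \<open>Pull-backs of closed forms along plots\<close>

context smooth_mfd
begin

lemma one_formD:
  assumes "\<eta> \<in> one_forms A"
  shows "v \<in> tangent_space A x \<Longrightarrow> w \<in> tangent_space A x \<Longrightarrow> \<eta> x (tplus v w) = \<eta> x v + \<eta> x w"
    and "v \<in> tangent_space A x \<Longrightarrow> \<eta> x (tscale a v) = a * \<eta> x v"
    and "v \<notin> tangent_space A x \<Longrightarrow> \<eta> x v = 0"
    and "c \<in> A \<Longrightarrow> smooth_on (chart_img c) (\<lambda>u. form1_local A c \<eta> u w')"
  using assms unfolding one_forms_def cotangent_space_def by blast+

lemma two_formD:
  assumes "\<omega> \<in> two_forms A"
  shows "u \<in> tangent_space A x \<Longrightarrow> v \<in> tangent_space A x \<Longrightarrow> w \<in> tangent_space A x \<Longrightarrow>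
      \<omega> x u (tplus v w) = \<omega> x u v + \<omega> x u w"
    and "u \<in> tangent_space A x \<Longrightarrow> v \<in> tangent_space A x \<Longrightarrow> \<omega> x u (tscale a v) = a * \<omega> x u v"
    and "u \<in> tangent_space A x \<Longrightarrow> v \<in> tangent_space A x \<Longrightarrow> \<omega> x u v = - \<omega> x v u"
    and "u \<notin> tangent_space A x \<or> v \<notin> tangent_space A x \<Longrightarrow> \<omega> x u v = 0"
    and "c \<in> A \<Longrightarrow> smooth_on (chart_img c) (\<lambda>z. form2_local A c \<omega> z w1 w2)"
proof -
  note D = assms[unfolded two_forms_def cotangent_space_def mem_Collect_eq]
  show "u \<in> tangent_space A x \<Longrightarrow> v \<in> tangent_space A x \<Longrightarrow> w \<in> tangent_space A x \<Longrightarrow>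
      \<omega> x u (tplus v w) = \<omega> x u v + \<omega> x u w"
    "u \<in> tangent_space A x \<Longrightarrow> v \<in> tangent_space A x \<Longrightarrow> \<omega> x u (tscale a v) = a * \<omega> x u v"
    "u \<in> tangent_space A x \<Longrightarrow> v \<in> tangent_space A x \<Longrightarrow> \<omega> x u v = - \<omega> x v u"
    "c \<in> A \<Longrightarrow> smooth_on (chart_img c) (\<lambda>z. form2_local A c \<omega> z w1 w2)" using D by blast+
  show "u \<notin> tangent_space A x \<or> v \<notin> tangent_space A x \<Longrightarrow> \<omega> x u v = 0"
    using D by (metis (no_types, lifting))
qed

lemma tangent_tplus: "v \<in> tangent_space A x \<Longrightarrow> w \<in> tangent_space A x \<Longrightarrow> tplus v w \<in> tangent_space A x"
  and tangent_tscale: "v \<in> tangent_space A x \<Longrightarrow> tscale a v \<in> tangent_space A x"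
proof -
  obtain c where c: "c \<in> A" "x \<in> chart_dom c" by (rule chart_at)
  note t = tangent_coord_vector[OF c] coord_vector_tangent[OF c] coord_vector_linear[OF c]
  show "v \<in> tangent_space A x \<Longrightarrow> w \<in> tangent_space A x \<Longrightarrow> tplus v w \<in> tangent_space A x"
    "v \<in> tangent_space A x \<Longrightarrow> tscale a v \<in> tangent_space A x" using t by metis+
qed

lemma two_form_left:
  assumes "\<omega> \<in> two_forms A" "u \<in> tangent_space A x" "v \<in> tangent_space A x"
  shows "w \<in> tangent_space A x \<Longrightarrow> \<omega> x (tplus v w) u = \<omega> x v u + \<omega> x w u"
    "\<omega> x (tscale a v) u = a * \<omega> x v u"
proof -
  note D = two_formD[OF assms(1)] and u = assms(2) and v = assms(3)
  show "\<omega> x (tplus v w) u = \<omega> x v u + \<omega> x w u" if w: "w \<in> tangent_space A x"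
    using D(3)[OF tangent_tplus[OF v w] u] D(1)[OF u v w] D(3)[OF u v] D(3)[OF u w] by linarith
  show "\<omega> x (tscale a v) u = a * \<omega> x v u"
    by (simp only: D(3)[OF tangent_tscale[OF v] u] D(2)[OF u v] D(3)[OF v u] mult_minus_right)
qed

lemma form1_local_linear:
  assumes "\<eta> \<in> one_forms A" "c \<in> A" "u \<in> chart_img c"
  shows "linear (form1_local A c \<eta> u)"
  using one_formD[OF assms(1)] coord_vector_tangent[OF assms(2) inv_in[OF assms(2,3)]]
    coord_vector_linear[OF assms(2) inv_in[OF assms(2,3)]]
  by (intro linearI) (auto simp: form1_local_def)

lemma form2_local_linear:
  assumes "\<omega> \<in> two_forms A" "c \<in> A" "u \<in> chart_img c"
  shows "linear (form2_local A c \<omega> u v)" "linear (\<lambda>v. form2_local A c \<omega> u v w)"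
  using coord_vector_tangent[OF assms(2) inv_in[OF assms(2,3)]]
  by (intro linearI; simp add: form2_local_def two_formD(1,2)[OF assms(1)] two_form_left[OF assms(1)]
      coord_vector_linear[OF assms(2) inv_in[OF assms(2,3)]])+

text \<open>The functions \<theta> are the components of the pulled-back form, and their symmetric
  derivatives say that it is closed. The derivative has two parts: one is symmetric because \<eta>
  is closed in the chart, the other contains a second derivative of the plot in coordinates, which
  is symmetric too.\<close>

lemma closed1_plot:
  assumes \<eta>: "\<eta> \<in> one_forms A" "closed1 A \<eta>" and p: "plot A S p" "z \<in> S"
  defines "\<theta> \<equiv> \<lambda>w z. \<eta> (p z) (plot_vec A p z w)"
  shows "\<theta> w differentiable (at z)" "frechet_derivative (\<theta> w) (at z) v = frechet_derivative (\<theta> v) (at z) w"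
proof -
  obtain d where d: "d \<in> A" "p z \<in> chart_dom d" by (rule chart_at)
  let ?U = "S \<inter> p -` chart_dom d" and ?q = "\<lambda>z. chart_map d (p z)"
  let ?Q = "\<lambda>w z. frechet_derivative ?q (at z) w" and ?B = "form1_local A d \<eta>"
  have o: "open ?U" by (rule plot_open_preimage[OF p(1) open_dom[OF d(1)]])
  have z: "z \<in> ?U" using p d by auto
  have q: "smooth_on ?U ?q" by (rule plot_smooth[OF p(1) d(1)])
  have qz: "?q z \<in> chart_img d" using map_in[OF d] .
  have eq: "?B (?q y) (?Q w y) = \<theta> w y" if "y \<in> ?U" for y w
    using plot_vec_coord[OF p(1) _ d(1), of y w] inv_map[OF d(1), of "p y"] that
    by (simp add: \<theta>_def form1_local_def)
  have "((\<lambda>y. ?B (?q y) (?Q w y)) has_derivative (\<lambda>v. frechet_derivative (\<lambda>u. ?B u (?Q w z)) (at (?q z)) (?Q v z)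
      + ?B (?q z) (frechet_derivative (?Q w) (at z) v))) (at z)" for w
    by (rule smooth_family_linear_has_derivative[OF open_img[OF d(1)] qz one_formD(4)[OF \<eta>(1) d(1)]
          form1_local_linear[OF \<eta>(1) d(1)] smooth_on_has_derivative[OF q z]
          smooth_on_has_derivative[OF smooth_on_derivative[OF q] z]])
  then have der: "(\<theta> w has_derivative (\<lambda>v. frechet_derivative (\<lambda>u. ?B u (?Q w z)) (at (?q z)) (?Q v z)
      + ?B (?q z) (frechet_derivative (?Q w) (at z) v))) (at z)" for w
    by (rule has_derivative_transform_within_open[OF _ o z]) (rule eq)
  then show "\<theta> w differentiable (at z)" by (auto simp: differentiable_def)
  have D: "frechet_derivative (\<theta> w) (at z) v = frechet_derivative (\<lambda>u. ?B u (?Q w z)) (at (?q z)) (?Q v z)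
      + ?B (?q z) (frechet_derivative (?Q w) (at z) v)" for v w
    by (rule fun_cong[OF frechet_derivative_at[OF der[of w], symmetric]])
  have "frechet_derivative (\<lambda>u. ?B u (?Q w z)) (at (?q z)) (?Q v z) = frechet_derivative (\<lambda>u. ?B u (?Q v z)) (at (?q z)) (?Q w z)"
    using \<eta>(2) d(1) qz by (simp add: closed1_def ext_deriv1_local_def)
  then show "frechet_derivative (\<theta> w) (at z) v = frechet_derivative (\<theta> v) (at z) w"
    unfolding D using second_derivative_symmetric[OF o z q, of v w] by simp
qed

text \<open>Differentiating the base point gives the cyclic sum that vanishes by closedness.
  Differentiating the two arguments gives six terms with second derivatives of the plot, which
  cancel in pairs by their symmetry and the antisymmetry of \<omega>.\<close>

lemma closed2_plot:
  assumes \<omega>: "\<omega> \<in> two_forms A" "closed2 A \<omega>" and p: "plot A S p" "z \<in> S"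
  defines "\<theta> \<equiv> \<lambda>v w z. \<omega> (p z) (plot_vec A p z v) (plot_vec A p z w)"
  shows "\<theta> v w differentiable (at z)"
    "frechet_derivative (\<theta> v w) (at z) e + frechet_derivative (\<theta> w e) (at z) v + frechet_derivative (\<theta> e v) (at z) w = 0"
proof -
  obtain d where d: "d \<in> A" "p z \<in> chart_dom d" by (rule chart_at)
  let ?U = "S \<inter> p -` chart_dom d" and ?q = "\<lambda>z. chart_map d (p z)"
  let ?Q = "\<lambda>w z. frechet_derivative ?q (at z) w" and ?B = "form2_local A d \<omega>"
  have o: "open ?U" by (rule plot_open_preimage[OF p(1) open_dom[OF d(1)]])
  have z: "z \<in> ?U" using p d by auto
  have q: "smooth_on ?U ?q" by (rule plot_smooth[OF p(1) d(1)])
  have qz: "?q z \<in> chart_img d" using map_in[OF d] .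
  have eq: "?B (?q y) (?Q v y) (?Q w y) = \<theta> v w y" if "y \<in> ?U" for y v w
    using plot_vec_coord[OF p(1) _ d(1), of y] inv_map[OF d(1), of "p y"] that
    by (simp add: \<theta>_def form2_local_def)
  have "((\<lambda>y. ?B (?q y) (?Q v y) (?Q w y)) has_derivative
      (\<lambda>e. frechet_derivative (\<lambda>u. ?B u (?Q v z) (?Q w z)) (at (?q z)) (?Q e z)
      + ?B (?q z) (frechet_derivative (?Q v) (at z) e) (?Q w z)
      + ?B (?q z) (?Q v z) (frechet_derivative (?Q w) (at z) e))) (at z)" for v w
    by (rule smooth_family_bilinear_has_derivative[OF open_img[OF d(1)] qz two_formD(5)[OF \<omega>(1) d(1)]
          form2_local_linear[OF \<omega>(1) d(1)] smooth_on_has_derivative[OF q z]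
          smooth_on_has_derivative[OF smooth_on_derivative[OF q] z]
          smooth_on_has_derivative[OF smooth_on_derivative[OF q] z]])
  then have der: "(\<theta> v w has_derivative
      (\<lambda>e. frechet_derivative (\<lambda>u. ?B u (?Q v z) (?Q w z)) (at (?q z)) (?Q e z)
      + ?B (?q z) (frechet_derivative (?Q v) (at z) e) (?Q w z)
      + ?B (?q z) (?Q v z) (frechet_derivative (?Q w) (at z) e))) (at z)" for v w
    by (rule has_derivative_transform_within_open[OF _ o z]) (rule eq)
  then show "\<theta> v w differentiable (at z)" by (auto simp: differentiable_def)
  have D: "frechet_derivative (\<theta> v w) (at z) e = frechet_derivative (\<lambda>u. ?B u (?Q v z) (?Q w z)) (at (?q z)) (?Q e z)
      + ?B (?q z) (frechet_derivative (?Q v) (at z) e) (?Q w z)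
      + ?B (?q z) (?Q v z) (frechet_derivative (?Q w) (at z) e)" for v w e
    by (rule fun_cong[OF frechet_derivative_at[OF der[of v w], symmetric]])
  have cl: "frechet_derivative (\<lambda>u. ?B u (?Q v z) (?Q w z)) (at (?q z)) (?Q e z)
    + frechet_derivative (\<lambda>u. ?B u (?Q w z) (?Q e z)) (at (?q z)) (?Q v z)
    + frechet_derivative (\<lambda>u. ?B u (?Q e z) (?Q v z)) (at (?q z)) (?Q w z) = 0"
    using \<omega>(2)[unfolded closed2_def, rule_format, OF d(1) qz, of "?Q e z" "?Q v z" "?Q w z"]
    unfolding ext_deriv2_local_def .
  have an: "?B (?q z) a b = - ?B (?q z) b a" for a b
    unfolding form2_local_def by (intro two_formD(3)[OF \<omega>(1)] coord_vector_tangent d(1) inv_in qz)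
  have sy: "frechet_derivative (?Q v) (at z) w = frechet_derivative (?Q w) (at z) v" for v w
    by (rule second_derivative_symmetric[OF o z q])
  show "frechet_derivative (\<theta> v w) (at z) e + frechet_derivative (\<theta> w e) (at z) v + frechet_derivative (\<theta> e v) (at z) w = 0"
    unfolding D
    using cl an[of "frechet_derivative (?Q v) (at z) e" "?Q w z"] an[of "frechet_derivative (?Q w) (at z) e" "?Q v z"]
      an[of "frechet_derivative (?Q w) (at z) v" "?Q e z"] sy[of v e] sy[of w e] sy[of v w] by simp
qed

lemma smooth_mapI:
  assumes h: "\<And>c. c \<in> A \<Longrightarrow> plot A (chart_img c) (\<lambda>u. h (chart_inv c u))"
  shows "smooth_map A h"
  unfolding smooth_map_def
proof (intro conjI ballI)
  show "continuous_on UNIV h"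
  proof (rule continuous_at_imp_continuous_on, rule ballI)
    fix x
    obtain c where c: "c \<in> A" "x \<in> chart_dom c" by (rule chart_at)
    have "continuous_on (chart_img c) (\<lambda>u. h (chart_inv c u))" using h[OF c(1)] by (simp add: plot_def)
    then have "continuous_on (chart_dom c) (\<lambda>x. h (chart_inv c (chart_map c x)))"
      by (rule continuous_on_compose2[OF _ map_cont[OF c(1)]]) (use map_in[OF c(1)] in auto)
    then have "continuous_on (chart_dom c) h"
      by (rule continuous_on_eq) (simp add: inv_map[OF c(1)])
    then show "isCont h x" using c open_dom[OF c(1)] by (simp add: continuous_on_eq_continuous_at)
  qed
  fix c d assume c: "c \<in> A" and d: "d \<in> A"
  have "chart_map c ` (chart_dom c \<inter> h -` chart_dom d) = chart_img c \<inter> (\<lambda>u. h (chart_inv c u)) -` chart_dom d"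
    using map_in[OF c] inv_map[OF c] inv_in[OF c] map_inv[OF c] by (force simp: image_iff)
  then show "smooth_on (chart_map c ` (chart_dom c \<inter> h -` chart_dom d)) (chart_map d \<circ> h \<circ> chart_inv c)"
    using plot_smooth[OF h[OF c] d] by (simp add: o_def)
qed

text \<open>Translates the push-forward in the definition of pull-backs into the calculus of plots.
  Composition with \<open>h\<close> preserves smooth functions, so the conventional value 0 on
  nonsmooth functions never intervenes.\<close>

lemma push_forward_coord_vector:
  assumes h: "\<And>c. c \<in> A \<Longrightarrow> plot A (chart_img c) (\<lambda>u. h (chart_inv c u))"
  shows "push_forward A h (coord_vector A c x w) = plot_vec A (\<lambda>u. h (chart_inv c u)) (chart_map c x) w"
proof
  fix f
  have "f \<circ> h \<in> smooth_functions A" if "f \<in> smooth_functions A"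
    using plot_smooth_function[OF h that] by (auto simp: smooth_functions_iff)
  then show "push_forward A h (coord_vector A c x w) f = plot_vec A (\<lambda>u. h (chart_inv c u)) (chart_map c x) w f"
    by (auto simp: push_forward_def coord_vector_def plot_vec_def o_def)
qed

end

section \<open>Invariance of forms under the flow\<close>

context compact_mfd_field
begin

lemma X_tangent: "X x \<in> tangent_space A x"
  using X unfolding vector_fields_def by blast

lemma flow_slice:
  assumes c: "c \<in> A" and u: "u \<in> chart_img c"
  defines "p \<equiv> \<lambda>z. flow (fst z) (chart_inv c (snd z))"
  shows "plot_vec A p (0, u) (0, w) = coord_vector A c (chart_inv c u) w"
proof -
  have "plot_vec A (\<lambda>y. p (0, y)) u w = plot_vec A p (0, u) (0, w)"
    by (rule plot_vec_chain[OF flow_plot_chart[OF c, folded p_def]])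
      (use u in \<open>auto intro!: derivative_eq_intros\<close>)
  then show ?thesis using map_inv[OF c u] by (simp add: p_def flow_0 coord_vector_eq_plot_vec)
qed

text \<open>Since \<open>\<eta>(X)\<close> is constant, closedness of the pullback along \<open>(s, u) \<mapsto> flow s u\<close> says that its
  spatial components do not depend on \<open>s\<close>; the same argument with \<open>\<omega>(X, _) = 0\<close> applies to 2-forms.\<close>
lemma flow_preserves1:
  assumes \<eta>: "\<eta> \<in> one_forms A" "closed1 A \<eta>" "\<And>x. \<eta> x (X x) = k" and c: "c \<in> A" and u: "u \<in> chart_img c"
  defines "p \<equiv> \<lambda>z. flow (fst z) (chart_inv c (snd z))"
  shows "\<eta> (p (s, u)) (plot_vec A p (s, u) (0, w)) = \<eta> (chart_inv c u) (coord_vector A c (chart_inv c u) w)"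
proof -
  let ?\<theta> = "\<lambda>w z. \<eta> (p z) (plot_vec A p z w)"
  have p: "plot A (UNIV \<times> chart_img c) p" unfolding p_def by (rule flow_plot_chart[OF c])
  have z: "(s, u) \<in> UNIV \<times> chart_img c" for s using u by auto
  have o: "open ((UNIV :: real set) \<times> chart_img c)" by (rule plot_open[OF p])
  have dz: "frechet_derivative (?\<theta> (0, w)) (at (s, u)) (1, 0) = 0" for s
  proof -
    have "((\<lambda>z. k) has_derivative (\<lambda>h. 0)) (at (s, u))" by simp
    then have "(?\<theta> (1, 0) has_derivative (\<lambda>h. 0)) (at (s, u))"
      by (rule has_derivative_transform_within_open[OF _ o z])
        (use flow_time_vec[OF c] \<eta>(3) in \<open>simp add: p_def\<close>)
    then have "frechet_derivative (?\<theta> (1, 0)) (at (s, u)) = (\<lambda>h. 0)" by (rule frechet_derivative_at[symmetric])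
    then show ?thesis using closed1_plot(2)[OF \<eta>(1,2) p z[of s], of "(0, w)" "(1, 0)"] by simp
  qed
  have "?\<theta> (0, w) (s, u) = ?\<theta> (0, w) (0, u)"
    by (rule constant_in_first_variable[OF closed1_plot(1)[OF \<eta>(1,2) p z] dz])
  then show ?thesis using flow_slice[OF c u, of w] by (simp add: p_def flow_0)
qed

lemma flow_preserves2:
  assumes \<omega>: "\<omega> \<in> two_forms A" "closed2 A \<omega>" "\<And>x v. \<omega> x (X x) v = 0" and c: "c \<in> A" and u: "u \<in> chart_img c"
  defines "p \<equiv> \<lambda>z. flow (fst z) (chart_inv c (snd z))"
  shows "\<omega> (p (s, u)) (plot_vec A p (s, u) (0, v)) (plot_vec A p (s, u) (0, w)) =
    \<omega> (chart_inv c u) (coord_vector A c (chart_inv c u) v) (coord_vector A c (chart_inv c u) w)"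
proof -
  let ?\<theta> = "\<lambda>v w z. \<omega> (p z) (plot_vec A p z v) (plot_vec A p z w)"
  let ?e = "(1, 0) :: real \<times> 'e"
  have p: "plot A (UNIV \<times> chart_img c) p" unfolding p_def by (rule flow_plot_chart[OF c])
  have z: "(s, u) \<in> UNIV \<times> chart_img c" for s using u by auto
  have o: "open ((UNIV :: real set) \<times> chart_img c)" by (rule plot_open[OF p])
  have e0: "?\<theta> ?e w z = 0" "?\<theta> w ?e z = 0" if "z \<in> UNIV \<times> chart_img c" for w z
  proof -
    have X: "plot_vec A p z ?e = X (p z)" using flow_time_vec[OF c that] by (simp add: p_def)
    show "?\<theta> ?e w z = 0" by (simp add: X \<omega>(3))
    show "?\<theta> w ?e z = 0"
      unfolding X using two_formD(3)[OF \<omega>(1) plot_vec_tangent[OF p that] X_tangent, of w] \<omega>(3) by simp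
  qed
  have d0: "frechet_derivative (?\<theta> ?e w) (at (s, u)) = (\<lambda>h. 0)" "frechet_derivative (?\<theta> w ?e) (at (s, u)) = (\<lambda>h. 0)" for s w
  proof -
    have c0: "((\<lambda>z. 0::real) has_derivative (\<lambda>h. 0)) (at (s, u))" by simp
    have "(?\<theta> ?e w has_derivative (\<lambda>h. 0)) (at (s, u))"
      by (rule has_derivative_transform_within_open[OF c0 o z]) (rule e0(1)[symmetric])
    then show "frechet_derivative (?\<theta> ?e w) (at (s, u)) = (\<lambda>h. 0)" by (rule frechet_derivative_at[symmetric])
    have "(?\<theta> w ?e has_derivative (\<lambda>h. 0)) (at (s, u))"
      by (rule has_derivative_transform_within_open[OF c0 o z]) (rule e0(2)[symmetric])
    then show "frechet_derivative (?\<theta> w ?e) (at (s, u)) = (\<lambda>h. 0)" by (rule frechet_derivative_at[symmetric])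
  qed
  \<comment> \<open>In the cyclic identity for (0, v), (0, w) and the time direction, the two terms
    whose component involves the time direction are derivatives of functions that vanish
    identically.\<close>
  have dz: "frechet_derivative (?\<theta> (0, v) (0, w)) (at (s, u)) ?e = 0" for s
    using closed2_plot(2)[OF \<omega>(1,2) p z[of s], of "(0, v)" "(0, w)" ?e] by (simp add: d0)
  have "?\<theta> (0, v) (0, w) (s, u) = ?\<theta> (0, v) (0, w) (0, u)"
    by (rule constant_in_first_variable[OF closed2_plot(1)[OF \<omega>(1,2) p z] dz])
  then show ?thesis using flow_slice[OF c u] by (simp add: p_def flow_0)
qed

lemma X_function_smooth:
  assumes g: "g \<in> smooth_functions A"
  shows "(\<lambda>x. X x g) \<in> smooth_functions A"
  unfolding smooth_functions_iff
proof
  fix c assume c: "c \<in> A"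
  let ?g = "\<lambda>u. g (chart_inv c u)"
  have gs: "smooth_on (chart_img c) ?g" using g c by (simp add: smooth_functions_iff)
  have "smooth_on (chart_img c) (\<lambda>u. \<Sum>i\<in>Basis. (xi c u \<bullet> i) *\<^sub>R frechet_derivative ?g (at u) i)"
    by (intro smooth_intros smooth_on_derivative[OF gs] xi(1)[OF c] open_img[OF c])
  then show "smooth_on (chart_img c) (\<lambda>u. X (chart_inv c u) g)"
  proof (rule smooth_on_cong[OF open_img[OF c], rotated])
    fix u assume u: "u \<in> chart_img c"
    have "X (chart_inv c u) g = frechet_derivative ?g (at u) (xi c u)"
      using xi(2)[OF c inv_in[OF c u]] map_inv[OF c u] g by (simp add: coord_vector_def o_def)
    then show "(\<Sum>i\<in>Basis. (xi c u \<bullet> i) *\<^sub>R frechet_derivative ?g (at u) i) = X (chart_inv c u) g"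
      using frechet_derivative_expand[OF smooth_on_differentiable[OF gs u]] by metis
  qed
qed

lemma flow_function_derivative:
  assumes g: "g \<in> smooth_functions A"
  shows "((\<lambda>s. g (flow s x)) has_real_derivative X (flow s x) g) (at s)"
proof -
  obtain c where c: "c \<in> A" "x \<in> chart_dom c" by (rule chart_at)
  let ?p = "\<lambda>z. flow (fst z) (chart_inv c (snd z))" and ?u = "chart_map c x"
  have z: "(s, ?u) \<in> UNIV \<times> chart_img c" using map_in[OF c] by auto
  note p = flow_plot_chart[OF c(1)]
  have "((\<lambda>s. (s, ?u)) has_derivative (\<lambda>h. (h, 0))) (at s)" by (auto intro!: derivative_eq_intros)
  from has_derivative_compose[OF this plot_function_derivative[OF p z g]]
  have "((\<lambda>s. g (flow s x)) has_derivative (\<lambda>h. plot_vec A ?p (s, ?u) (h, 0) g)) (at s)"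
    using inv_map[OF c] by simp
  moreover have "plot_vec A ?p (s, ?u) (h, 0) g = X (flow s x) g * h" for h
  proof -
    have "plot_vec A ?p (s, ?u) (h *\<^sub>R (1, 0)) g = h * plot_vec A ?p (s, ?u) (1, 0) g"
      unfolding plot_vec_linear(2)[OF p z] by (simp add: tscale_def)
    then show ?thesis using flow_time_vec[OF c(1) z] inv_map[OF c] by (simp add: mult.commute)
  qed
  ultimately show ?thesis by (simp add: has_field_derivative_def)
qed

end

section \<open>The isotopy\<close>

text \<open>What the construction takes from the theorem: \<open>X\<close> is a Reeb field for
  (\<omega>, \<eta>), and \<open>g\<close> is a potential of the change of \<eta>. The bound on X(g)
  is the positivity of 1 + t X(g) for all t in [0,1], which is affine in t and equals 1 at t =
  0.\<close>

locale reeb_flow = compact_mfd_field A X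
  for A :: "('m::{t2_space,second_countable_topology}, 'e::euclidean_space) chart set" and X +
  fixes \<omega> :: "'m form2" and \<eta> :: "'m form1" and g :: "'m \<Rightarrow> real"
  assumes \<omega>: "\<omega> \<in> two_forms A" "closed2 A \<omega>" "\<And>x v. \<omega> x (X x) v = 0"
    and \<eta>: "\<eta> \<in> one_forms A" "closed1 A \<eta>" "\<And>x. \<eta> x (X x) = 1"
    and g: "g \<in> smooth_functions A" "\<And>x. X x g > -1"
begin

text \<open>Smoothness up to the end points of [0,1] requires smooth functions on an open set of
  times, so the positivity that makes the implicit time unique has to extend slightly beyond the
  interval.\<close>

definition time_margin :: "real \<Rightarrow> bool" where
  "time_margin \<delta> \<longleftrightarrow> 0 < \<delta> \<and> (\<exists>\<kappa>>0. \<forall>t\<in>{-\<delta><..<1 + \<delta>}. \<forall>x. \<kappa> \<le> 1 + t * X x g)"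

lemma time_margin_exists: "\<exists>\<delta>. time_margin \<delta>"
proof -
  let ?\<rho> = "\<lambda>x. X x g"
  have c: "continuous_on UNIV ?\<rho>" by (rule smooth_function_continuous[OF X_function_smooth[OF g(1)]])
  obtain x0 where x0: "\<And>x. ?\<rho> x0 \<le> ?\<rho> x" using continuous_attains_inf[OF compact_mfd UNIV_not_empty c] by blast
  obtain x1 where x1: "\<And>x. ?\<rho> x \<le> ?\<rho> x1" using continuous_attains_sup[OF compact_mfd UNIV_not_empty c] by blast
  \<comment> \<open>\<open>k\<close> bounds 1 + s X(g) from below for s in [0,1], by its values at
    the two ends. Leaving [0,1] by at most \<delta> changes this by at most
    \<open>\<delta> * R = k / 2\<close>, so half of the bound survives.\<close>
  define k where "k = min 1 (1 + ?\<rho> x0)"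
  define R where "R = \<bar>?\<rho> x0\<bar> + \<bar>?\<rho> x1\<bar> + 1"
  define \<delta> where "\<delta> = k / (2 * R)"
  have k: "0 < k" "k \<le> 1" "\<And>x. k \<le> 1 + ?\<rho> x" using g(2)[of x0] x0 by (auto simp: k_def min.coboundedI2)
  have R: "0 < R" "\<And>x. \<bar>?\<rho> x\<bar> \<le> R"
  proof -
    show "\<bar>?\<rho> x\<bar> \<le> R" for x using x0[of x] x1[of x] unfolding R_def by linarith
    show "0 < R" unfolding R_def by linarith
  qed
  have \<delta>: "0 < \<delta>" "\<delta> * R = k / 2" using k R by (auto simp: \<delta>_def)
  have "k / 2 \<le> 1 + t * ?\<rho> x" if t: "t \<in> {-\<delta><..<1 + \<delta>}" for t x
  proof -
    \<comment> \<open>The point of [0,1] nearest to \<open>t\<close>.\<close>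
    define s where "s = max 0 (min 1 t)"
    have s: "0 \<le> s" "s \<le> 1" "\<bar>t - s\<bar> \<le> \<delta>" using t \<delta> by (auto simp: s_def)
    have "k = (1 - s) * k + s * k" by (simp add: algebra_simps)
    also have "\<dots> \<le> (1 - s) * 1 + s * (1 + ?\<rho> x)" using s k by (intro add_mono mult_left_mono) auto
    finally have "k \<le> 1 + s * ?\<rho> x" by (simp add: algebra_simps)
    moreover have "\<bar>(t - s) * ?\<rho> x\<bar> \<le> \<delta> * R" unfolding abs_mult using s R \<delta> by (intro mult_mono) auto
    moreover have "t * ?\<rho> x = s * ?\<rho> x + (t - s) * ?\<rho> x" by (simp add: algebra_simps)
    ultimately show ?thesis using \<delta>(2) by linarith
  qed
  then show ?thesis using \<delta>(1) k(1) unfolding time_margin_def by (intro exI[of _ \<delta>] conjI exI[of _ "k / 2"]) auto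
qed

definition margin :: real where "margin = (SOME \<delta>. time_margin \<delta>)"

definition times :: "real set" where "times = {-margin<..<1 + margin}"

lemma margin: "0 < margin" "\<exists>\<kappa>>0. \<forall>t\<in>times. \<forall>x. \<kappa> \<le> 1 + t * X x g"
  using someI_ex[OF time_margin_exists, folded margin_def] unfolding time_margin_def times_def by auto

lemma times_unit: "{0..1} \<subseteq> times" and open_times: "open times"
  using margin(1) by (auto simp: times_def)

lemma speed_pos: "t \<in> times \<Longrightarrow> 0 < 1 + t * X x g"
  using margin(2) by (meson less_le_trans)

section \<open>The implicit time\<close>

definition G :: "real \<Rightarrow> 'm \<Rightarrow> real \<Rightarrow> real" where "G t x s = s + t * g (flow s x)"

lemma G_derivative: "(G t x has_real_derivative 1 + t * X (flow s x) g) (at s)"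
  unfolding G_def[abs_def] by (auto intro!: derivative_eq_intros flow_function_derivative[OF g(1)])

lemma G_mono: "t \<in> times \<Longrightarrow> s < s' \<Longrightarrow> G t x s < G t x s'"
  by (rule DERIV_pos_imp_increasing) (use G_derivative speed_pos in blast)+

text \<open>\<open>g\<close> is bounded on the compact manifold, so at distance |t| M from 0 the
  term \<open>s\<close> outweighs \<open>t * g\<close> and forces a change of sign.\<close>

lemma G_zero_exists: "\<exists>s. G t x s = 0"
proof -
  have "bounded (range g)"
    using compact_continuous_image[OF smooth_function_continuous[OF g(1)] compact_mfd] by (rule compact_imp_bounded)
  then obtain M where M: "\<And>x. \<bar>g x\<bar> \<le> M" by (auto simp: bounded_iff)
  have b: "\<bar>t * g y\<bar> \<le> \<bar>t\<bar> * M" for y unfolding abs_mult by (intro mult_left_mono M) auto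
  have "0 \<le> \<bar>t\<bar> * M" using b[of undefined] by linarith
  then have le: "- (\<bar>t\<bar> * M) \<le> \<bar>t\<bar> * M" by linarith
  have "\<exists>s\<ge>- (\<bar>t\<bar> * M). s \<le> \<bar>t\<bar> * M \<and> G t x s = 0"
  proof (rule IVT'[OF _ _ le])
    show "G t x (- (\<bar>t\<bar> * M)) \<le> 0" "0 \<le> G t x (\<bar>t\<bar> * M)"
      unfolding G_def using b[of "flow (- (\<bar>t\<bar> * M)) x"] b[of "flow (\<bar>t\<bar> * M) x"] by linarith+
    show "continuous_on {- (\<bar>t\<bar> * M)..\<bar>t\<bar> * M} (G t x)"
      using DERIV_isCont[OF G_derivative] by (intro continuous_at_imp_continuous_on) auto
  qed
  then show ?thesis by blast
qed

definition \<tau> :: "real \<Rightarrow> 'm \<Rightarrow> real" where "\<tau> t x = (SOME s. G t x s = 0)"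

lemma G_\<tau>: "G t x (\<tau> t x) = 0"
  unfolding \<tau>_def by (rule someI_ex[OF G_zero_exists])

lemma \<tau>_unique: "t \<in> times \<Longrightarrow> G t x s = 0 \<Longrightarrow> \<tau> t x = s"
  using G_mono[of t s "\<tau> t x" x] G_mono[of t "\<tau> t x" s x] G_\<tau>[of t x] by (metis less_irrefl linorder_neqE)

text \<open>\<open>implicit_scalar_smooth\<close> needs continuity first. Since \<open>G\<close>
  increases strictly in \<open>s\<close>, it is negative just below the zero and positive just
  above; these two signs persist for nearby parameters and trap their zeros. The derivative in
  \<open>s\<close> is 1 + t X(g), which is positive on \<open>times\<close>.\<close>

lemma \<tau>_smooth:
  assumes c: "c \<in> A"
  shows "smooth_on (times \<times> chart_img c) (\<lambda>z. \<tau> (fst z) (chart_inv c (snd z)))"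
proof -
  let ?S = "times \<times> chart_img c" and ?\<tau> = "\<lambda>z. \<tau> (fst z) (chart_inv c (snd z))"
  let ?W = "(UNIV :: real set) \<times> (UNIV :: real set) \<times> chart_img c"
  let ?H = "\<lambda>w. G (fst (snd w)) (chart_inv c (snd (snd w))) (fst w)"
  have oS: "open ?S" by (intro open_Times open_times open_img[OF c])
  have oW: "open ?W" by (intro open_Times open_UNIV open_img[OF c])
  have Hs: "smooth_on ?W ?H"
  proof -
    have s2: "smooth_on ?W (\<lambda>w. snd (snd w))" "smooth_on ?W (\<lambda>w. fst (snd w))"
      by (auto intro!: smooth_on_linear oW bounded_linear_compose[OF bounded_linear_snd bounded_linear_snd]
          bounded_linear_compose[OF bounded_linear_fst bounded_linear_snd])
    have "plot A ?W (\<lambda>w. chart_inv c (snd (snd w)))"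
      by (rule plot_compose[OF plot_chart_inv[OF c] s2(1) oW]) auto
    from plot_smooth_function[OF flow_plot[OF this smooth_on_fst[OF oW]] g(1)]
    show ?thesis unfolding G_def by (intro smooth_intros s2 oW)
  qed
  have Hc: "continuous_on ?W ?H" by (rule smooth_on_continuous[OF Hs])
  have \<tau>c: "continuous_on ?S ?\<tau>"
  proof (rule continuous_at_imp_continuous_on, rule ballI)
    fix z assume z: "z \<in> ?S"
    have side: "\<forall>\<^sub>F y in nhds z. P (?H (a, y))" if "P (?H (a, z))" "open {r. P r}" for P a
    proof -
      have "continuous_on ?S (\<lambda>y. ?H (a, y))"
        by (rule continuous_on_compose2[OF Hc]) (auto intro!: continuous_intros)
      then have "open (?S \<inter> (\<lambda>y. ?H (a, y)) -` {r. P r})" by (rule continuous_open_preimage[OF _ oS that(2)])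
      then have "\<forall>\<^sub>F y in nhds z. y \<in> ?S \<inter> (\<lambda>y. ?H (a, y)) -` {r. P r}"
        using z that(1) by (intro eventually_nhds_in_open) auto
      then show ?thesis by eventually_elim simp
    qed
    have zt: "fst z \<in> times" using z by auto
    show "isCont ?\<tau> z"
      unfolding isCont_def tendsto_iff
    proof (intro allI impI)
      fix e :: real assume e: "0 < e"
      have "?H (?\<tau> z - e, z) < 0" "0 < ?H (?\<tau> z + e, z)"
        using G_mono[OF zt, of "?\<tau> z - e" "?\<tau> z" "chart_inv c (snd z)"]
          G_mono[OF zt, of "?\<tau> z" "?\<tau> z + e" "chart_inv c (snd z)"] e by (simp_all add: G_\<tau>)
      then have "\<forall>\<^sub>F y in nhds z. ?H (?\<tau> z - e, y) < 0" "\<forall>\<^sub>F y in nhds z. 0 < ?H (?\<tau> z + e, y)"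
        using side[of "\<lambda>r. r < 0"] side[of "\<lambda>r. 0 < r"] by (auto simp: lessThan_def[symmetric] greaterThan_def[symmetric])
      moreover have "\<forall>\<^sub>F y in nhds z. y \<in> ?S" using z oS by (rule eventually_nhds_in_open[rotated])
      ultimately have "\<forall>\<^sub>F y in nhds z. dist (?\<tau> y) (?\<tau> z) < e"
      proof eventually_elim
        case (elim y)
        then have yt: "fst y \<in> times" by auto
        have "?\<tau> z - e < ?\<tau> y"
          using elim(1) G_\<tau>[of "fst y" "chart_inv c (snd y)"]
            G_mono[OF yt, of "?\<tau> y" "?\<tau> z - e" "chart_inv c (snd y)"] by (cases "?\<tau> y" "?\<tau> z - e" rule: linorder_cases) auto
        moreover have "?\<tau> y < ?\<tau> z + e"
          using elim(2) G_\<tau>[of "fst y" "chart_inv c (snd y)"]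
            G_mono[OF yt, of "?\<tau> z + e" "?\<tau> y" "chart_inv c (snd y)"] by (cases "?\<tau> y" "?\<tau> z + e" rule: linorder_cases) auto
        ultimately show ?case by (simp add: dist_real_def abs_less_iff)
      qed
      then show "\<forall>\<^sub>F y in at z. dist (?\<tau> y) (?\<tau> z) < e" by (simp add: eventually_at_filter eventually_mono)
    qed
  qed
  show ?thesis
  proof (rule implicit_scalar_smooth[OF oW Hs oS \<tau>c])
    fix z assume z: "z \<in> ?S"
    show w: "(?\<tau> z, z) \<in> ?W" using z by (auto simp: mem_Times_iff)
    show "?H (?\<tau> z, z) = 0" by (simp add: G_\<tau>)
    have f: "(?H has_derivative frechet_derivative ?H (at (?\<tau> z, z))) (at (?\<tau> z, z))"
      by (rule smooth_on_has_derivative[OF Hs w])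
    have "((\<lambda>s. (s, z)) has_derivative (\<lambda>h. (h, 0))) (at (?\<tau> z))" by (auto intro!: derivative_eq_intros)
    from has_derivative_compose[OF this, of ?H, OF f]
    have "(G (fst z) (chart_inv c (snd z)) has_derivative (\<lambda>h. frechet_derivative ?H (at (?\<tau> z, z)) (h, 0))) (at (?\<tau> z))"
      by simp
    from has_derivative_unique[OF this G_derivative[unfolded has_field_derivative_def]]
    have "frechet_derivative ?H (at (?\<tau> z, z)) (1, 0) = (1 + fst z * X (flow (?\<tau> z) (chart_inv c (snd z))) g) * 1"
      by (rule fun_cong)
    then show "frechet_derivative ?H (at (?\<tau> z, z)) (1, 0) \<noteq> 0"
      using speed_pos[of "fst z" "flow (?\<tau> z) (chart_inv c (snd z))"] z by auto
  qed
qed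

section \<open>The isotopy and its pull-backs\<close>

definition \<phi> :: "real \<Rightarrow> 'm \<Rightarrow> 'm" where "\<phi> t x = flow (\<tau> t x) x"

definition \<psi> :: "real \<Rightarrow> 'm \<Rightarrow> 'm" where "\<psi> t x = flow (t * g x) x"

lemma \<psi>_\<phi>: "\<psi> t (\<phi> t x) = x"
proof -
  have "t * g (\<phi> t x) = - \<tau> t x" using G_\<tau>[of t x] by (simp add: G_def \<phi>_def)
  then show ?thesis by (simp add: \<psi>_def) (simp add: \<phi>_def flow_add flow_0)
qed

lemma \<phi>_\<psi>: "t \<in> times \<Longrightarrow> \<phi> t (\<psi> t x) = x"
proof -
  assume t: "t \<in> times"
  have "\<tau> t (\<psi> t x) = - (t * g x)" by (rule \<tau>_unique[OF t]) (simp add: G_def \<psi>_def flow_add flow_0)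
  then show ?thesis by (simp add: \<phi>_def) (simp add: \<psi>_def flow_add flow_0)
qed

lemma \<phi>_plot:
  assumes c: "c \<in> A"
  shows "plot A (times \<times> chart_img c) (\<lambda>z. \<phi> (fst z) (chart_inv c (snd z)))"
proof -
  have o: "open (times \<times> chart_img c)" by (intro open_Times open_times open_img[OF c])
  have "plot A (times \<times> chart_img c) (\<lambda>z. chart_inv c (snd z))"
    by (rule plot_compose[OF plot_chart_inv[OF c] smooth_on_snd[OF o] o]) auto
  from flow_plot[OF this \<tau>_smooth[OF c]] show ?thesis by (simp only: \<phi>_def)
qed

lemma \<phi>_plot_at:
  assumes t: "t \<in> times" and c: "c \<in> A"
  shows "plot A (chart_img c) (\<lambda>u. \<phi> t (chart_inv c u))"
proof -
  have "smooth_on (chart_img c) (\<lambda>u. (t, u))" by (intro smooth_intros open_img[OF c])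
  from plot_compose[OF \<phi>_plot[OF c] this open_img[OF c]] show ?thesis using t by auto
qed

lemma \<phi>_diffeomorphism:
  assumes t: "t \<in> times"
  shows "diffeomorphism A (\<phi> t)"
proof -
  have "plot A (chart_img c) (\<lambda>u. \<psi> t (chart_inv c u))" if c: "c \<in> A" for c
    unfolding \<psi>_def
    by (rule flow_plot[OF plot_chart_inv[OF c]])
      (intro smooth_intros open_img[OF c] plot_smooth_function[OF plot_chart_inv[OF c] g(1)])
  then have "smooth_map A (\<psi> t)" by (rule smooth_mapI)
  moreover have "smooth_map A (\<phi> t)" using \<phi>_plot_at[OF t] by (rule smooth_mapI)
  moreover have "bij (\<phi> t)" by (rule o_bij[of "\<psi> t"]) (simp_all add: fun_eq_iff \<psi>_\<phi> \<phi>_\<psi>[OF t])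
  moreover have "inv (\<phi> t) = \<psi> t" using \<psi>_\<phi> \<phi>_\<psi>[OF t] by (intro inv_equality)
  ultimately show ?thesis by (simp add: diffeomorphism_def)
qed

lemma \<phi>_isotopy: "isotopy A \<phi>"
  unfolding isotopy_def
proof (intro conjI ballI)
  show "continuous_on ({0..1} \<times> UNIV) (\<lambda>(t, x). \<phi> t x)"
  proof (rule continuous_on_subset)
    show "continuous_on (times \<times> UNIV) (\<lambda>(t, x). \<phi> t x)"
    proof (rule continuous_at_imp_continuous_on, rule ballI)
      fix z assume z: "z \<in> times \<times> (UNIV :: 'm set)"
      obtain c where c: "c \<in> A" "snd z \<in> chart_dom c" by (rule chart_at)
      have cm: "continuous_on (times \<times> chart_dom c) (\<lambda>z. (fst z, chart_map c (snd z)))"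
        by (intro continuous_intros continuous_on_compose2[OF map_cont[OF c(1)]]) auto
      have cp: "continuous_on (times \<times> chart_img c) (\<lambda>z. \<phi> (fst z) (chart_inv c (snd z)))"
        using \<phi>_plot[OF c(1)] by (simp add: plot_def)
      have im: "(\<lambda>z. (fst z, chart_map c (snd z))) ` (times \<times> chart_dom c) \<subseteq> times \<times> chart_img c"
        using map_in[OF c(1)] by auto
      have "continuous_on (times \<times> chart_dom c) (\<lambda>(t, x). \<phi> t x)"
        by (rule continuous_on_eq[OF continuous_on_compose2[OF cp cm im]]) (use inv_map[OF c(1)] in auto)
      moreover have "open (times \<times> chart_dom c)" by (intro open_Times open_times open_dom[OF c(1)])
      moreover have "z \<in> times \<times> chart_dom c" using z c by (cases z) auto
      ultimately show "isCont (\<lambda>(t, x). \<phi> t x) z" using continuous_on_eq_continuous_at by blast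
    qed
  qed (use times_unit in auto)
  show "diffeomorphism A (\<phi> t)" if "t \<in> {0..1}" for t using \<phi>_diffeomorphism that times_unit by blast
  show "\<phi> 0 = id"
  proof
    fix x
    have "\<tau> 0 x = 0" using G_\<tau>[of 0 x] by (simp add: G_def)
    then show "\<phi> 0 x = id x" by (simp add: \<phi>_def flow_0)
  qed
  fix c d assume c: "c \<in> A" and d: "d \<in> A"
  let ?P = "\<lambda>z. \<phi> (fst z) (chart_inv c (snd z))"
  \<comment> \<open>One open set, reaching beyond [0,1] in time, serves as the neighbourhood at
    every point, and the same formula is the smooth extension.\<close>
  let ?U = "(times \<times> chart_img c) \<inter> ?P -` chart_dom d"
  have "open ?U" "smooth_on ?U (\<lambda>z. chart_map d (?P z))"
    using plot_open_preimage[OF \<phi>_plot[OF c] open_dom[OF d]] plot_smooth[OF \<phi>_plot[OF c] d] by auto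
  then show "smooth_within {(t, u). t \<in> {0..1} \<and> u \<in> chart_img c \<and> \<phi> t (chart_inv c u) \<in> chart_dom d}
      (\<lambda>(t, u). chart_map d (\<phi> t (chart_inv c u)))"
    unfolding smooth_within_def using times_unit
    by (intro ballI exI[of _ ?U] exI[of _ "\<lambda>z. chart_map d (?P z)"]) auto
qed

text \<open>In coordinates \<phi> is the flow plot evaluated on the graph of \<tau>. The tangent
  vector (a w, w) of the graph splits into a time part, which is mapped to a multiple of X, and a
  space part, on which the flow preserves the forms.\<close>

lemma \<phi>_vec:
  assumes t: "t \<in> times" and c: "c \<in> A" and u: "u \<in> chart_img c"
  defines "p \<equiv> \<lambda>z. flow (fst z) (chart_inv c (snd z))" and "a \<equiv> frechet_derivative (\<lambda>u. \<tau> t (chart_inv c u)) (at u)"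
    and "z \<equiv> (\<tau> t (chart_inv c u), u)"
  shows "plot_vec A (\<lambda>u. \<phi> t (chart_inv c u)) u w =
      tplus (tscale (a w) (X (p z))) (plot_vec A p z (0, w))"
    and "a w + t * plot_vec A (\<lambda>u. \<phi> t (chart_inv c u)) u w g = 0"
proof -
  have p: "plot A (UNIV \<times> chart_img c) p" unfolding p_def by (rule flow_plot_chart[OF c])
  have z: "z \<in> UNIV \<times> chart_img c" using u by (simp add: z_def)
  have \<tau>s: "smooth_on (chart_img c) (\<lambda>u. \<tau> t (chart_inv c u))"
  proof -
    have "smooth_on (chart_img c) (\<lambda>u. (t, u))" by (intro smooth_intros open_img[OF c])
    from smooth_on_compose[OF \<tau>_smooth[OF c] this open_img[OF c]] show ?thesis using t by auto
  qed
  have a: "((\<lambda>u. \<tau> t (chart_inv c u)) has_derivative a) (at u)"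
    unfolding a_def by (rule smooth_on_has_derivative[OF \<tau>s u])
  have "((\<lambda>u. (\<tau> t (chart_inv c u), u)) has_derivative (\<lambda>w. (a w, w))) (at u)"
    by (intro has_derivative_Pair a has_derivative_ident)
  from plot_vec_chain[OF p _ this, of w]
  have "plot_vec A (\<lambda>u. p (\<tau> t (chart_inv c u), u)) u w = plot_vec A p z (a w, w)" using u by (simp add: z_def)
  also have "(a w, w) = a w *\<^sub>R (1, 0) + (0, w)" by simp
  also have "plot_vec A p z (a w *\<^sub>R (1, 0) + (0, w)) = tplus (tscale (a w) (plot_vec A p z (1, 0))) (plot_vec A p z (0, w))"
    by (simp only: plot_vec_linear[OF p z])
  also have "plot_vec A p z (1, 0) = X (p z)" using flow_time_vec[OF c z] by (simp add: p_def)
  finally show "plot_vec A (\<lambda>u. \<phi> t (chart_inv c u)) u w =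
      tplus (tscale (a w) (X (p z))) (plot_vec A p z (0, w))" by (simp add: \<phi>_def p_def)
  \<comment> \<open>The equation defining \<tau> holds identically in \<open>u\<close>; its
    derivative relates \<open>a\<close> to the derivative of \<open>g\<close> along the image
    vector.\<close>
  have "((\<lambda>u. \<tau> t (chart_inv c u) + t * g (\<phi> t (chart_inv c u))) has_derivative
      (\<lambda>w. a w + t * plot_vec A (\<lambda>u. \<phi> t (chart_inv c u)) u w g)) (at u)"
    by (intro has_derivative_add has_derivative_mult_right a plot_function_derivative[OF \<phi>_plot_at[OF t c] u g(1)])
  moreover have "(\<lambda>u. \<tau> t (chart_inv c u) + t * g (\<phi> t (chart_inv c u))) = (\<lambda>u. 0)"
    using G_\<tau> by (simp add: G_def \<phi>_def fun_eq_iff)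
  ultimately have "((\<lambda>u. 0) has_derivative (\<lambda>w. a w + t * plot_vec A (\<lambda>u. \<phi> t (chart_inv c u)) u w g)) (at u)" by simp
  from fun_cong[OF has_derivative_unique[OF this has_derivative_const], of w]
  show "a w + t * plot_vec A (\<lambda>u. \<phi> t (chart_inv c u)) u w g = 0" .
qed

lemma \<phi>_pullback1:
  assumes t: "t \<in> times"
  shows "pullback1 A (\<phi> t) (\<lambda>x v. \<eta> x v + t * differential A g x v) = \<eta>"
proof (intro ext)
  fix x v
  show "pullback1 A (\<phi> t) (\<lambda>x v. \<eta> x v + t * differential A g x v) x v = \<eta> x v"
  proof (cases "v \<in> tangent_space A x")
    case True
    obtain c where c: "c \<in> A" "x \<in> chart_dom c" by (rule chart_at)
    obtain w where w: "v = coord_vector A c x w" using tangent_coord_vector[OF c True] by blast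
    define u where "u = chart_map c x"
    have u: "u \<in> chart_img c" "chart_inv c u = x" using map_in[OF c] inv_map[OF c] by (auto simp: u_def)
    let ?V = "plot_vec A (\<lambda>u. \<phi> t (chart_inv c u)) u w"
    let ?p = "\<lambda>z. flow (fst z) (chart_inv c (snd z))" and ?z = "(\<tau> t x, u)"
    let ?a = "frechet_derivative (\<lambda>u. \<tau> t (chart_inv c u)) (at u) w"
    note V = \<phi>_vec[OF t c(1) u(1), of w, unfolded u(2)]
    have z: "?z \<in> UNIV \<times> chart_img c" using u by simp
    have tan: "plot_vec A ?p ?z (0, w) \<in> tangent_space A (?p ?z)"
      by (rule plot_vec_tangent[OF flow_plot_chart[OF c(1)] z])
    have pz: "?p ?z = \<phi> t x" using u by (simp add: \<phi>_def)
    have "\<eta> (?p ?z) ?V = ?a * \<eta> (?p ?z) (X (?p ?z)) + \<eta> (?p ?z) (plot_vec A ?p ?z (0, w))"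
      unfolding V(1) using one_formD(1)[OF \<eta>(1) tangent_tscale[OF X_tangent] tan] one_formD(2)[OF \<eta>(1) X_tangent] by simp
    also have "\<dots> = ?a + \<eta> x v"
      using flow_preserves1[OF \<eta> c(1) u(1), of "\<tau> t x" w] u w \<eta>(3) by simp
    finally have e: "\<eta> (\<phi> t x) ?V = ?a + \<eta> x v" unfolding pz .
    have "?V \<in> tangent_space A (\<phi> t x)"
      using plot_vec_tangent[OF \<phi>_plot_at[OF t c(1)] u(1), of w] u by simp
    then have "differential A g (\<phi> t x) ?V = ?V g" by (simp add: differential_def)
    \<comment> \<open>The contribution \<open>?a\<close> of the moving time is cancelled by
      \<open>t\<close> times the differential of \<open>g\<close>, by the second part of
      \<open>\<phi>_vec\<close>.\<close>
    then have "\<eta> (\<phi> t x) ?V + t * differential A g (\<phi> t x) ?V = \<eta> x v" using e V(2) by simp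
    moreover have "push_forward A (\<phi> t) v = ?V"
      unfolding w u_def by (rule push_forward_coord_vector[OF \<phi>_plot_at[OF t]])
    ultimately show ?thesis using True by (simp add: pullback1_def)
  next
    case False
    then show ?thesis using one_formD(3)[OF \<eta>(1)] by (simp add: pullback1_def)
  qed
qed

lemma \<phi>_pullback2:
  assumes t: "t \<in> times"
  shows "pullback2 A (\<phi> t) \<omega> = \<omega>"
proof (intro ext)
  fix x v1 v2
  show "pullback2 A (\<phi> t) \<omega> x v1 v2 = \<omega> x v1 v2"
  proof (cases "v1 \<in> tangent_space A x \<and> v2 \<in> tangent_space A x")
    case True
    obtain c where c: "c \<in> A" "x \<in> chart_dom c" by (rule chart_at)
    obtain w1 w2 where w: "v1 = coord_vector A c x w1" "v2 = coord_vector A c x w2"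
      using tangent_coord_vector[OF c] True by blast
    define u where "u = chart_map c x"
    have u: "u \<in> chart_img c" "chart_inv c u = x" using map_in[OF c] inv_map[OF c] by (auto simp: u_def)
    let ?p = "\<lambda>z. flow (fst z) (chart_inv c (snd z))" and ?z = "(\<tau> t x, u)"
    let ?V = "\<lambda>w. plot_vec A (\<lambda>u. \<phi> t (chart_inv c u)) u w"
    let ?a = "frechet_derivative (\<lambda>u. \<tau> t (chart_inv c u)) (at u)"
    let ?T = "tangent_space A (?p ?z)" and ?Q = "\<lambda>w. plot_vec A ?p ?z (0, w)"
    note V = \<phi>_vec(1)[OF t c(1) u(1), unfolded u(2)]
    have z: "?z \<in> UNIV \<times> chart_img c" using u by simp
    have Q: "?Q w \<in> ?T" for w by (rule plot_vec_tangent[OF flow_plot_chart[OF c(1)] z])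
    have pz: "?p ?z = \<phi> t x" using u by (simp add: \<phi>_def)
    have XT: "tscale b (X (?p ?z)) \<in> ?T" for b by (rule tangent_tscale[OF X_tangent])
    \<comment> \<open>The time parts of both image vectors are multiples of X and drop out, because
      X lies in the kernel of \<omega>; only the space parts remain.\<close>
    have X0: "\<omega> (?p ?z) (tscale b (X (?p ?z))) v = 0" if "v \<in> ?T" for b v
      using two_form_left(2)[OF \<omega>(1) that X_tangent, of b] \<omega>(3) by simp
    have X0': "\<omega> (?p ?z) v (tscale b (X (?p ?z))) = 0" if "v \<in> ?T" for b v
      using two_formD(3)[OF \<omega>(1) that XT, of b] X0[OF that] by simp
    have "\<omega> (?p ?z) (?V w1) (?V w2) = \<omega> (?p ?z) (tplus (tscale (?a w1) (X (?p ?z))) (?Q w1)) (tplus (tscale (?a w2) (X (?p ?z))) (?Q w2))"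
      unfolding V ..
    also have "\<dots> = \<omega> (?p ?z) (tplus (tscale (?a w1) (X (?p ?z))) (?Q w1)) (?Q w2)"
      using two_formD(1)[OF \<omega>(1) tangent_tplus[OF XT Q] XT Q] X0'[OF tangent_tplus[OF XT Q]] by simp
    also have "\<dots> = \<omega> (?p ?z) (?Q w1) (?Q w2)"
      using two_form_left(1)[OF \<omega>(1) Q XT Q] X0[OF Q] by simp
    also have "\<dots> = \<omega> x v1 v2"
      using flow_preserves2[OF \<omega> c(1) u(1), of "\<tau> t x" w1 w2] u w by simp
    finally have "\<omega> (\<phi> t x) (?V w1) (?V w2) = \<omega> x v1 v2" unfolding pz .
    moreover have "push_forward A (\<phi> t) v1 = ?V w1"
      unfolding w(1) u_def by (rule push_forward_coord_vector[OF \<phi>_plot_at[OF t]])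
    moreover have "push_forward A (\<phi> t) v2 = ?V w2"
      unfolding w(2) u_def by (rule push_forward_coord_vector[OF \<phi>_plot_at[OF t]])
    ultimately show ?thesis using True by (simp add: pullback2_def)
  next
    case False
    then have "\<omega> x v1 v2 = 0" by (intro two_formD(4)[OF \<omega>(1)]) blast
    then show ?thesis using False by (auto simp: pullback2_def)
  qed
qed

end

section \<open>The Reeb field\<close>

lemma (in smooth_mfd) two_form_kernel:
  assumes \<omega>: "\<omega> \<in> two_forms A" and n: "odd DIM('e)" and c: "c \<in> A" "x \<in> chart_dom c"
  shows "\<exists>z. z \<noteq> 0 \<and> (\<forall>v. \<omega> x (coord_vector A c x z) v = 0)"
proof -
  let ?B = "\<lambda>v w. \<omega> x (coord_vector A c x v) (coord_vector A c x w)"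
  note D = two_formD[OF \<omega>] and T = coord_vector_tangent[OF c] and L = coord_vector_linear[OF c]
  have lin: "linear (\<lambda>v. ?B v w)" for w
    by (intro linearI) (simp_all add: L two_form_left[OF \<omega> T T] T)
  have anti: "?B v w = - ?B w v" for v w by (rule D(3)[OF T T])
  have "\<exists>z\<in>UNIV. z \<noteq> 0 \<and> (\<forall>w\<in>UNIV. ?B z w = 0)"
    by (rule antisymmetric_kernel[OF lin anti subspace_UNIV]) (simp add: n)
  then obtain z where z: "z \<noteq> 0" "\<And>w. ?B z w = 0" by blast
  have "\<omega> x (coord_vector A c x z) v = 0" for v
  proof (cases "v \<in> tangent_space A x")
    case True
    then show ?thesis using tangent_coord_vector[OF c True] z by auto
  qed (simp add: D(4))
  then show ?thesis using z by blast
qed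

text \<open>The field representing \<open>\<eta>\<close> under \<open>Y \<mapsto> \<omega>(Y, _) + \<eta>(Y) \<eta>\<close> is the Reeb field. This needs the odd
  dimension: in even dimension it may be \<open>\<omega>\<close>-dual to \<open>\<eta>\<close> instead.\<close>
lemma (in smooth_mfd) reeb_field:
  assumes \<omega>: "\<omega> \<in> two_forms A" and \<eta>: "\<eta> \<in> one_forms A" and n: "odd DIM('e)"
    and inj: "inj_on (flat_at \<eta> \<omega> x) (tangent_space A x)"
    and R: "R \<in> tangent_space A x" "flat_at \<eta> \<omega> x R = \<eta> x"
  shows "\<omega> x R v = 0" "\<eta> x R = 1"
proof -
  obtain c where c: "c \<in> A" "x \<in> chart_dom c" by (rule chart_at)
  note T = coord_vector_tangent[OF c]
  obtain z where z: "z \<noteq> 0" "\<And>v. \<omega> x (coord_vector A c x z) v = 0"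
    using two_form_kernel[OF \<omega> n c] by blast
  let ?Z = "coord_vector A c x z"
  have k: "flat_at \<eta> \<omega> x (tscale a ?Z) = (\<lambda>v. a * \<eta> x ?Z * \<eta> x v)" "\<And>v. \<omega> x (tscale a ?Z) v = 0" for a
  proof -
    show w: "\<omega> x (tscale a ?Z) v = 0" for v
      by (cases "v \<in> tangent_space A x") (simp_all add: two_form_left(2)[OF \<omega> _ T] z two_formD(4)[OF \<omega>])
    show "flat_at \<eta> \<omega> x (tscale a ?Z) = (\<lambda>v. a * \<eta> x ?Z * \<eta> x v)"
      by (simp add: flat_at_def w one_formD(2)[OF \<eta> T])
  qed
  have e: "\<eta> x ?Z \<noteq> 0"
  proof
    assume "\<eta> x ?Z = 0"
    then have "flat_at \<eta> \<omega> x (tscale 1 ?Z) = flat_at \<eta> \<omega> x (tscale 0 ?Z)" by (simp add: k)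
    then have "tscale 1 ?Z = tscale 0 ?Z" using inj tangent_tscale[OF T] by (meson inj_onD)
    then have "coord_vector A c x (1 *\<^sub>R z) = coord_vector A c x (0 *\<^sub>R z)" by (simp only: coord_vector_linear(2)[OF c])
    from coord_vector_inject[OF c this] show False using z by simp
  qed
  \<comment> \<open>A kernel vector with \<eta>(Z) = 1 is mapped to \<eta> itself, so after this
    normalisation injectivity identifies it with \<open>R\<close>.\<close>
  let ?a = "1 / \<eta> x ?Z"
  have "flat_at \<eta> \<omega> x (tscale ?a ?Z) = flat_at \<eta> \<omega> x R" unfolding k R(2) using e by simp
  then have "R = tscale ?a ?Z" using inj R tangent_tscale[OF T] by (metis inj_onD)
  then show "\<omega> x R v = 0" "\<eta> x R = 1" using k(2) e by (simp_all add: one_formD(2)[OF \<eta> T])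
qed

theorem theorem2p7:
  fixes A :: "('m::{t2_space,second_countable_topology}, 'e::euclidean_space) chart set"
    and \<omega> :: "'m form2" and \<eta>0 \<eta>1 :: "'m form1" and n :: nat
  assumes "smooth_manifold A"
    and "DIM('e) = 2 * n + 1"
    and "compact (UNIV :: 'm set)"
    and "cosymplectic A \<omega> \<eta>0"
    and "cosymplectic A \<omega> \<eta>1"
    and "cohomologous1 A \<eta>0 \<eta>1"
    and "\<And>t. t \<in> {0..1} \<Longrightarrow> smooth_module_iso A (I_tilde (segment1 \<eta>0 \<eta>1 t) \<omega>)"
  shows "\<exists>\<phi>. isotopy A \<phi> \<and>
           (\<forall>t\<in>{0..1}. pullback2 A (\<phi> t) \<omega> = \<omega> \<and>
              pullback1 A (\<phi> t) (segment1 \<eta>0 \<eta>1 t) = \<eta>0)"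
proof -
  interpret smooth_mfd A by standard (rule assms(1))
  have \<omega>: "\<omega> \<in> two_forms A" "closed2 A \<omega>" and \<eta>0: "\<eta>0 \<in> one_forms A" "closed1 A \<eta>0"
    and inj: "\<And>x. inj_on (flat_at \<eta>0 \<omega> x) (tangent_space A x)"
    using assms(4) by (auto simp: cosymplectic_def bij_betw_def)
  have odd: "odd DIM('e)" using assms(2) by simp
  have surj: "\<exists>Y\<in>vector_fields A. I_tilde (segment1 \<eta>0 \<eta>1 t) \<omega> Y = \<eta>0" if "t \<in> {0..1}" for t
  proof -
    have "I_tilde (segment1 \<eta>0 \<eta>1 t) \<omega> ` vector_fields A = one_forms A"
      using assms(7)[OF that] by (simp add: smooth_module_iso_def bij_betw_def)
    with \<eta>0(1) have "\<eta>0 \<in> I_tilde (segment1 \<eta>0 \<eta>1 t) \<omega> ` vector_fields A" by simp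
    then show ?thesis by (elim imageE) (rule bexI, rule sym)
  qed
  \<comment> \<open>At t = 0 the module map belongs to the structure (\<omega>, \<eta>0). Its
    surjectivity gives the Reeb vectors as one smooth field at once, so no matrix has to be inverted
    smoothly.\<close>
  have "segment1 \<eta>0 \<eta>1 0 = \<eta>0" by (simp add: segment1_def)
  with surj[of 0] obtain X where X: "X \<in> vector_fields A" and I: "I_tilde \<eta>0 \<omega> X = \<eta>0" by auto
  have XT: "X x \<in> tangent_space A x" for x using X by (auto simp: vector_fields_def)
  have fl: "flat_at \<eta>0 \<omega> x (X x) = \<eta>0 x" for x using fun_cong[OF I, of x] by (simp add: I_tilde_def)
  have X\<omega>: "\<omega> x (X x) v = 0" and X\<eta>: "\<eta>0 x (X x) = 1" for x v
    using reeb_field[OF \<omega>(1) \<eta>0(1) odd inj XT fl] by auto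
  obtain g where g: "g \<in> smooth_functions A" and dg: "(\<lambda>x v. \<eta>1 x v - \<eta>0 x v) = differential A g"
    using assms(6) by (auto simp: cohomologous1_def)
  have seg: "segment1 \<eta>0 \<eta>1 t = (\<lambda>x v. \<eta>0 x v + t * differential A g x v)" for t
    by (simp add: segment1_def dg[symmetric] algebra_simps)
  have Xg: "segment1 \<eta>0 \<eta>1 t x (X x) = 1 + t * X x g" for t x
    by (simp add: seg differential_def XT X\<eta>)
  have nz: "1 + t * X x g \<noteq> 0" if t: "t \<in> {0..1}" for t x
  proof -
    obtain Y where Y: "Y \<in> vector_fields A" "I_tilde (segment1 \<eta>0 \<eta>1 t) \<omega> Y = \<eta>0" using surj[OF t] by blast
    \<comment> \<open>Evaluated at X, the equation for \<open>Y\<close> loses its \<omega>-term and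
      states that the values of \<eta>_t on Y and on X have product
      \<open>\<eta>0 x (X x) = 1\<close>.\<close>
    have "\<omega> x (Y x) (X x) = - \<omega> x (X x) (Y x)"
      by (rule two_formD(3)[OF \<omega>(1)]) (use Y XT in \<open>auto simp: vector_fields_def\<close>)
    then have "segment1 \<eta>0 \<eta>1 t x (Y x) * (1 + t * X x g) = 1"
      using fun_cong[OF fun_cong[OF Y(2), of x], of "X x"] by (simp add: I_tilde_def flat_at_def X\<omega> X\<eta> Xg)
    then show ?thesis by auto
  qed
  \<comment> \<open>A value X(g) \<le> -1 would make 1 + t X(g) vanish at t = - 1 / X(g), which lies
    in [0,1].\<close>
  have gt: "X x g > -1" for x
  proof (rule ccontr)
    assume "\<not> X x g > -1"
    then have le: "X x g \<le> -1" by simp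
    then have "- 1 / X x g \<in> {0..1}" by (auto simp: divide_simps)
    from nz[OF this, of x] show False using le by (simp add: divide_simps)
  qed
  interpret reeb_flow A X \<omega> \<eta>0 g
    by unfold_locales (use X assms(3) \<omega> X\<omega> \<eta>0 X\<eta> g gt in auto)
  have "pullback2 A (\<phi> t) \<omega> = \<omega>" "pullback1 A (\<phi> t) (segment1 \<eta>0 \<eta>1 t) = \<eta>0" if "t \<in> {0..1}" for t
    using \<phi>_pullback1[of t] \<phi>_pullback2[of t] times_unit that unfolding seg by auto
  then show ?thesis using \<phi>_isotopy by blast
qed

end
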